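(* Let $n\ge2$, $1<p<\infty$, $0<\gamma<1$, $m\in\mathbb R$ with $m\neq0$, $s>4n/\gamma$, $a_m(t)=(|t|+m^2)^{\gamma/2}$, $\kappa\in\mathbb R$, $\beta>0$, and let $x\mapsto\rho(|x|)$ be a continuous real-valued radial function of compact support on $\mathbb R^n$. Consider the two equations $$\left[1+(-\Delta+m^2)^{\gamma/2}\right]^{s/2}u=\kappa\,u^3+\rho(|x|)\qquad\text{and}\qquad \left[1+(-\Delta+m^2)^{\gamma/2}\right]^{s/2}u=|u|^\beta u+\rho(|x|).$$ For the first put $\alpha=3$ and $V(x,y)=\kappa y^3+\rho(|x|)$; for the second put $\alpha=\beta+1$ and $V(x,y)=|y|^\beta y+\rho(|x|)$. In each case let $C>0$ be a constant such that, for some $g\in L^{\frac{\alpha p}{\alpha-1}}(\mathbb R^n)$, $$|V(x,y)|\le C(|\rho(|x|)|+|y|^\alpha),\qquad \left|\frac{\partial}{\partial y}V(x,y)\right|\le C(|g(x)|+|y|^{\alpha-1}),$$ let $N>0$ be a constant such that $\|u\|_{L^{\alpha p}(\mathbb R^n)}\le N\|u\|_{\mathcal H^{s,p}(a_m)}$ for all $u\in\mathcal H^{s,p}_r(a_m)$, and choose $0<\epsilon<(2^pC^pN)^{1/(1-\alpha)}$ and $\rho_\epsilon=\epsilon/(2^pC^pN)-\epsilon^\alpha$. If $\|\rho(|\cdot|)\|_{L^p(\mathbb R^n)}<\rho_\epsilon$, then the corresponding equation has a spherically symmetric (real-valued) solution $u\in\mathcal H^{s,p}_r(a_m)$.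
   Context: $\mathcal F$ denotes the Fourier transform. With $a=a_m$ as in the claim, the function $(1+a(|\xi|^2))^{-s/2}$ is a Fourier multiplier for $L^p(\mathbb R^n)$, and $T_s$ denotes the bounded operator on $L^p(\mathbb R^n)$ which is the unique bounded extension of $f\mapsto\mathcal F^{-1}\big((1+a(|\xi|^2))^{-s/2}\mathcal F f\big)$, $f\in L^2\cap L^p$. Define $$\mathcal H^{s,p}(a)=\{u\in L^p(\mathbb R^n):\mathcal F^{-1}((1+a(|\xi|^2))^{s/2}\mathcal F u)\in L^p(\mathbb R^n)\},\quad \|u\|_{\mathcal H^{s,p}(a)}=\|\mathcal F^{-1}((1+a(|\xi|^2))^{s/2}\mathcal F u)\|_{L^p},$$ where $\mathcal F^{-1}((1+a(|\xi|^2))^{s/2}\mathcal F u)=g$ (in the sense of tempered distributions) is identified with $u=T_s g$; i.e. $\mathcal H^{s,p}(a)=T_s(L^p)$ with $\|T_sg\|_{\mathcal H^{s,p}(a)}=\|g\|_{L^p}$. The operator $[1+(-\Delta+m^2)^{\gamma/2}]^{s/2}$ is $u\mapsto\mathcal F^{-1}((1+a_m(|\xi|^2))^{s/2}\mathcal F u)$ on $\mathcal H^{s,p}(a_m)$, so that the equation with right-hand side $g\in L^p$ means $u=T_sg$. $\mathcal H^{s,p}_r(a)$ is the subspace of spherically symmetric elements of $\mathcal H^{s,p}(a)$. *)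

theory Defs
  imports "HOL-Analysis.Analysis"
begin

text \<open>
  Elements of \<open>L\<^sup>p\<close> are represented by Borel functions; equality of elements of \<open>L\<^sup>p\<close> is
  equality almost everywhere and is always written out as such.
\<close>

definition Lp :: "real \<Rightarrow> ('a::euclidean_space \<Rightarrow> 'b::{banach, second_countable_topology}) set" where
  "Lp p = {f \<in> borel_measurable lborel. integrable lborel (\<lambda>x. norm (f x) powr p)}"

definition Lp_norm :: "real \<Rightarrow> ('a::euclidean_space \<Rightarrow> 'b::{banach, second_countable_topology}) \<Rightarrow> real" where
  "Lp_norm p f = (\<integral>x. norm (f x) powr p \<partial>lborel) powr (1 / p)"

text \<open>
  Since \<open>bounded_linear_Lp p B\<close> forces \<open>B f = B g\<close> a.e. whenever \<open>f = g\<close> a.e., such a map on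
  representatives is the same thing as a bounded linear operator on \<open>L\<^sup>p\<close>.
\<close>

definition bounded_linear_Lp ::
    "real \<Rightarrow> (('a::euclidean_space \<Rightarrow> complex) \<Rightarrow> ('a \<Rightarrow> complex)) \<Rightarrow> bool" where
  "bounded_linear_Lp p B \<longleftrightarrow>
     (\<forall>f\<in>Lp p. B f \<in> Lp p) \<and>
     (\<forall>f\<in>Lp p. \<forall>g\<in>Lp p. AE x in lborel. B (\<lambda>y. f y + g y) x = B f x + B g x) \<and>
     (\<forall>c. \<forall>f\<in>Lp p. AE x in lborel. B (\<lambda>y. c * f y) x = c * B f x) \<and>
     (\<exists>K. \<forall>f\<in>Lp p. Lp_norm p (B f) \<le> K * Lp_norm p f)"

definition bounded_extension ::
    "real \<Rightarrow> ('a::euclidean_space \<Rightarrow> complex) set \<Rightarrow>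
      (('a \<Rightarrow> complex) \<Rightarrow> ('a \<Rightarrow> complex)) \<Rightarrow> (('a \<Rightarrow> complex) \<Rightarrow> ('a \<Rightarrow> complex)) \<Rightarrow> bool" where
  "bounded_extension p D A B \<longleftrightarrow>
     bounded_linear_Lp p B \<and> (\<forall>f\<in>D. AE x in lborel. B f x = A f x)"

text \<open>
  The unitary normalisation is used. The sign and scale of the phase are the ones for which
  \<open>-\<Delta>\<close> has symbol \<open>|\<xi>|\<^sup>2\<close>.
\<close>

definition fourier_integral :: "('a::euclidean_space \<Rightarrow> complex) \<Rightarrow> ('a \<Rightarrow> complex)" where
  "fourier_integral f \<xi> =
     of_real ((2 * pi) powr (- real DIM('a) / 2)) * (\<integral>x. exp (- \<i> * of_real (x \<bullet> \<xi>)) * f x \<partial>lborel)"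

definition inverse_fourier_integral :: "('a::euclidean_space \<Rightarrow> complex) \<Rightarrow> ('a \<Rightarrow> complex)" where
  "inverse_fourier_integral f x =
     of_real ((2 * pi) powr (- real DIM('a) / 2)) * (\<integral>\<xi>. exp (\<i> * of_real (x \<bullet> \<xi>)) * f \<xi> \<partial>lborel)"

text \<open>
  The Fourier transforms on \<open>L\<^sup>2\<close> are the bounded extensions (unique up to equality a.e.) of the
  integrals on \<open>L\<^sup>1 \<inter> L\<^sup>2\<close>.
\<close>

definition fourier_L2 :: "('a::euclidean_space \<Rightarrow> complex) \<Rightarrow> ('a \<Rightarrow> complex)" where
  "fourier_L2 = (SOME B. bounded_extension 2 (Lp 1 \<inter> Lp 2) fourier_integral B)"

definition inverse_fourier_L2 :: "('a::euclidean_space \<Rightarrow> complex) \<Rightarrow> ('a \<Rightarrow> complex)" where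
  "inverse_fourier_L2 = (SOME B. bounded_extension 2 (Lp 1 \<inter> Lp 2) inverse_fourier_integral B)"

definition fourier_multiplier_L2 ::
    "('a::euclidean_space \<Rightarrow> real) \<Rightarrow> ('a \<Rightarrow> complex) \<Rightarrow> ('a \<Rightarrow> complex)" where
  "fourier_multiplier_L2 \<mu> f = inverse_fourier_L2 (\<lambda>\<xi>. of_real (\<mu> \<xi>) * fourier_L2 f \<xi>)"

definition T_op ::
    "real \<Rightarrow> real \<Rightarrow> (real \<Rightarrow> real) \<Rightarrow> ('a::euclidean_space \<Rightarrow> complex) \<Rightarrow> ('a \<Rightarrow> complex)" where
  "T_op s p a =
     (SOME B. bounded_extension p (Lp 2 \<inter> Lp p)
        (fourier_multiplier_L2 (\<lambda>\<xi>. (1 + a ((norm \<xi>)\<^sup>2)) powr (- s / 2))) B)"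

definition Hsp :: "real \<Rightarrow> real \<Rightarrow> (real \<Rightarrow> real) \<Rightarrow> ('a::euclidean_space \<Rightarrow> complex) set" where
  "Hsp s p a = {u \<in> Lp p. \<exists>g\<in>Lp p. AE x in lborel. u x = T_op s p a g x}"

text \<open>
  The operator with symbol \<open>(1 + a(|\<xi>|\<^sup>2))\<^bsup>s/2\<^esup>\<close> on \<open>Hsp s p a\<close>: it sends \<open>u\<close> to the
  \<open>g \<in> L\<^sup>p\<close>, unique up to equality a.e., with \<open>u = T_op s p a g\<close>.
\<close>

definition J_op ::
    "real \<Rightarrow> real \<Rightarrow> (real \<Rightarrow> real) \<Rightarrow> ('a::euclidean_space \<Rightarrow> complex) \<Rightarrow> ('a \<Rightarrow> complex)" where
  "J_op s p a u = (SOME g. g \<in> Lp p \<and> (AE x in lborel. u x = T_op s p a g x))"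

definition Hsp_norm :: "real \<Rightarrow> real \<Rightarrow> (real \<Rightarrow> real) \<Rightarrow> ('a::euclidean_space \<Rightarrow> complex) \<Rightarrow> real" where
  "Hsp_norm s p a u = Lp_norm p (J_op s p a u)"

definition spherically_symmetric :: "('a::euclidean_space \<Rightarrow> complex) \<Rightarrow> bool" where
  "spherically_symmetric u \<longleftrightarrow> (\<exists>\<phi>. AE x in lborel. u x = \<phi> (norm x))"

definition Hsp_r :: "real \<Rightarrow> real \<Rightarrow> (real \<Rightarrow> real) \<Rightarrow> ('a::euclidean_space \<Rightarrow> complex) set" where
  "Hsp_r s p a = {u \<in> Hsp s p a. spherically_symmetric u}"

definition a_sym :: "real \<Rightarrow> real \<Rightarrow> real \<Rightarrow> real" where
  "a_sym \<gamma> m t = (\<bar>t\<bar> + m\<^sup>2) powr (\<gamma> / 2)"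

end

theory Submission
  imports Defs "HOL-Probability.Probability"
begin

text \<open>
  On the ball of radius \<open>\<epsilon>\<close> of real radial functions in $L^{\alpha p}$ the map
  \<open>u \<mapsto> T\<^sub>s (V(x, u))\<close> is a contraction: letting \<open>y\<close> tend to infinity in the bound on
  \<open>\<partial>V/\<partial>y\<close> bounds the coefficient of the nonlinearity by \<open>C / \<alpha>\<close>, and \<open>C \<ge> 1\<close> unless \<open>\<rho>\<close> vanishes
  (in which case \<open>u = 0\<close> is a solution), so the Lipschitz constant is less than
  \<open>2 C N / (2\<^bsup>p\<^esup> C\<^bsup>p\<^esup> N) \<le> 1\<close>.

  The symbol of \<open>T\<^sub>s\<close> is a limit of combinations, with nonnegative coefficients of sum at most 1, of
  powers of the Gaussians \<open>exp (- h |\<xi>|\<^sup>2)\<close>. Those act as convolutions with Gaussian kernels, hence as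
  contractions of $L^p$ that preserve real radial functions; this passes to products and to pointwise
  limits of symbols. Injectivity of \<open>T\<^sub>s\<close> on $L^p$ follows since the symbols \<open>(1 + a/j)\<^bsup>-n\<^esup>\<close>, which
  tend to 1, are multiples of the symbol of \<open>T\<^sub>s\<close> by $L^p$ multipliers.
\<close>

section \<open>The spaces $L^p$\<close>

text \<open>The ball sits in \<open>Lp (\<alpha> * p)\<close> rather than in the Bessel space
  because \<open>V\<close> maps it to \<open>Lp p\<close> and \<open>N\<close> brings
  \<open>T\<^sub>s\<close> of that back to \<open>Lp (\<alpha> * p)\<close>. The second half puts
  two demands on \<open>T\<^sub>s\<close>. The embedding is assumed for radial functions only, so
  \<open>T\<^sub>s\<close> has to preserve them. And \<open>Hsp_norm\<close> is defined through
  \<open>J_op\<close>, which chooses some preimage under \<open>T\<^sub>s\<close>: only injectivity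
  turns the norm of \<open>T\<^sub>s g\<close> into that of \<open>g\<close>, and the chosen
  preimage of the fixed point into \<open>V(x, u)\<close>. The Fourier transforms on L^2 and
  \<open>T\<^sub>s\<close> are themselves chosen operators, about which nothing is known until an
  extension has been shown to exist. Their properties are therefore proved on dense classes, chiefly
  truncations, and carried over by limits; pointwise properties such as being radial go through a.e.
  convergent subsequences. No kernel of \<open>T\<^sub>s\<close> and no derivative of its symbol is
  estimated: Gaussians contract every \<open>Lp p\<close>, and averaging contractions costs no
  constant.\<close>

lemma Lp_iff: "f \<in> Lp p \<longleftrightarrow> f \<in> borel_measurable borel \<and> integrable lborel (\<lambda>x. norm (f x) powr p)"
  by (simp add: Lp_def)

lemma Lp_measurable [measurable_dest]: "f \<in> Lp p \<Longrightarrow> f \<in> borel_measurable borel"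
  by (simp add: Lp_iff)

lemma Lp_integrable: "f \<in> Lp p \<Longrightarrow> integrable lborel (\<lambda>x. norm (f x) powr p)"
  by (simp add: Lp_iff)

lemma Lp_norm_nonneg [simp]: "0 \<le> Lp_norm p f"
  by (simp add: Lp_norm_def)

lemma Lp_norm_powr: "p > 0 \<Longrightarrow> Lp_norm p f powr p = (\<integral>x. norm (f x) powr p \<partial>lborel)"
  by (simp add: Lp_norm_def powr_powr)

lemma Lp_norm_le_iff:
  assumes "p > 0" "M \<ge> 0"
  shows "Lp_norm p f \<le> M \<longleftrightarrow> (\<integral>x. norm (f x) powr p \<partial>lborel) \<le> M powr p"
proof -
  have "Lp_norm p f \<le> M \<longleftrightarrow> Lp_norm p f powr p \<le> M powr p"
    using assms powr_mono2[of p "Lp_norm p f" M] powr_less_mono2[of p M "Lp_norm p f"]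
    by (force simp: not_le[symmetric])
  then show ?thesis by (simp add: Lp_norm_powr assms)
qed

lemma Lp_cong_AE:
  assumes "f \<in> Lp p" "g \<in> borel_measurable borel" "AE x in lborel. f x = g x"
  shows "g \<in> Lp p"
proof -
  note [measurable] = assms(1,2)
  have "integrable lborel (\<lambda>x. norm (g x) powr p)"
    by (rule integrable_cong_AE_imp[OF Lp_integrable[OF assms(1)]]) (use assms(3) in auto)
  then show ?thesis by (simp add: Lp_iff assms)
qed

lemma Lp_norm_cong_AE:
  assumes [measurable]: "f \<in> borel_measurable borel" "g \<in> borel_measurable borel"
    and "AE x in lborel. f x = g x"
  shows "Lp_norm p f = Lp_norm p g"
proof -
  have "(\<integral>x. norm (f x) powr p \<partial>lborel) = (\<integral>x. norm (g x) powr p \<partial>lborel)"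
    by (rule integral_cong_AE) (use assms(3) in auto)
  then show ?thesis by (simp add: Lp_norm_def)
qed

lemma Lp_bound:
  assumes "p > 0" "g \<in> Lp p" and f [measurable]: "f \<in> borel_measurable borel"
    and le: "AE x in lborel. norm (f x) \<le> norm (g x)"
  shows "f \<in> Lp p" "Lp_norm p f \<le> Lp_norm p g"
proof -
  note [measurable] = assms(2)
  have le': "AE x in lborel. norm (f x) powr p \<le> norm (g x) powr p"
    using le by eventually_elim (use \<open>p > 0\<close> in \<open>auto intro!: powr_mono2\<close>)
  have i: "integrable lborel (\<lambda>x. norm (f x) powr p)"
    by (rule Bochner_Integration.integrable_bound[OF Lp_integrable[OF assms(2)]]) (use le' in auto)
  then show "f \<in> Lp p" by (simp add: Lp_iff)
  show "Lp_norm p f \<le> Lp_norm p g"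
    unfolding Lp_norm_def using \<open>p > 0\<close>
    by (intro powr_mono2 integral_mono_AE i Lp_integrable assms le') auto
qed

lemma Lp_norm_zero [simp]: "Lp_norm p (\<lambda>x. 0) = 0"
  by (simp add: Lp_norm_def)

lemma Lp_zero [simp]: "(\<lambda>x. 0) \<in> Lp p"
  by (simp add: Lp_iff)

lemma Lp_norm_eq_0_iff:
  assumes "p > 0" "f \<in> Lp p"
  shows "Lp_norm p f = 0 \<longleftrightarrow> (AE x in lborel. f x = 0)"
proof -
  have "Lp_norm p f = 0 \<longleftrightarrow> (\<integral>x. norm (f x) powr p \<partial>lborel) = 0"
    by (simp add: Lp_norm_def)
  also have "\<dots> \<longleftrightarrow> (AE x in lborel. norm (f x) powr p = 0)"
    by (rule integral_nonneg_eq_0_iff_AE) (auto intro: Lp_integrable assms)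
  finally show ?thesis by simp
qed

lemma Lp_cmult:
  fixes f :: "'a::euclidean_space \<Rightarrow> complex"
  assumes "p > 0" "f \<in> Lp p"
  shows "(\<lambda>x. c * f x) \<in> Lp p" "Lp_norm p (\<lambda>x. c * f x) = norm c * Lp_norm p f"
proof -
  note [measurable] = assms(2)
  have eq: "norm (c * f x) powr p = norm c powr p * norm (f x) powr p" for x
    by (simp add: norm_mult powr_mult)
  show "(\<lambda>x. c * f x) \<in> Lp p"
    unfolding Lp_iff eq by (auto intro!: integrable_mult_right Lp_integrable assms)
  show "Lp_norm p (\<lambda>x. c * f x) = norm c * Lp_norm p f"
    unfolding Lp_norm_def eq using assms(1) by (simp add: powr_mult powr_powr)
qed

text \<open>Convexity of the power in tangent form, which can be summed or integrated with weights:
  it yields both Minkowski's inequality and Jensen's inequality for Gaussian averages. At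
  \<open>t = 0\<close> the tangent has the value \<open>(1 - p) * a powr p\<close>, which is not
  positive.\<close>

lemma powr_ge_tangent:
  fixes t a p :: real
  assumes "p \<ge> 1" "a > 0" "t \<ge> 0"
  shows "t powr p \<ge> a powr p + p * a powr (p - 1) * (t - a)"
proof (cases "t = 0")
  case True
  have "a powr p = a powr (p - 1) * a"
    using \<open>a > 0\<close> by (simp add: powr_mult_base powr_diff)
  with True assms show ?thesis by simp
next
  case False
  have "t powr p - a powr p \<ge> (p * a powr (p - 1)) * (t - a)"
    by (rule convex_on_imp_above_tangent[OF powr_convex[OF assms(1)]])
       (use False assms in \<open>auto intro!: derivative_eq_intros simp: interior_open has_field_derivative_at_within\<close>)
  then show ?thesis by simp
qed

text \<open>Both tangents are taken at the combination \<open>c\<close> itself; weighted by \<theta>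
  and \<open>1 - \<theta>\<close>, their linear terms cancel.\<close>

lemma powr_convex_combination:
  fixes a b p \<theta> :: real
  assumes "p \<ge> 1" "a \<ge> 0" "b \<ge> 0" "0 \<le> \<theta>" "\<theta> \<le> 1"
  shows "(\<theta> * a + (1 - \<theta>) * b) powr p \<le> \<theta> * a powr p + (1 - \<theta>) * b powr p"
proof -
  define c where "c = \<theta> * a + (1 - \<theta>) * b"
  have "c \<ge> 0" unfolding c_def using assms by auto
  show ?thesis
  proof (cases "c = 0")
    case True
    then show ?thesis using assms by (simp add: c_def)
  next
    case False
    define d where "d = p * c powr (p - 1)"
    have "\<theta> * (c powr p + d * (a - c)) \<le> \<theta> * a powr p"
      using powr_ge_tangent[OF assms(1), of c a] False \<open>c \<ge> 0\<close> assms
      by (intro mult_left_mono) (auto simp: d_def)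
    moreover have "(1 - \<theta>) * (c powr p + d * (b - c)) \<le> (1 - \<theta>) * b powr p"
      using powr_ge_tangent[OF assms(1), of c b] False \<open>c \<ge> 0\<close> assms
      by (intro mult_left_mono) (auto simp: d_def)
    moreover have "\<theta> * (c powr p + d * (a - c)) + (1 - \<theta>) * (c powr p + d * (b - c))
        = c powr p + d * (\<theta> * a + (1 - \<theta>) * b - c)"
      by (simp add: algebra_simps)
    ultimately show ?thesis unfolding c_def[symmetric] by (simp add: c_def[symmetric])
  qed
qed

text \<open>Minkowski's inequality by normalisation: \<open>key\<close> applies convexity to
  \<open>norm (f x) / A\<close> and \<open>norm (g x) / B\<close> with weights
  \<open>A / (A + B)\<close> and \<open>B / (A + B)\<close>. With \<open>A = B = 1\<close> it gives
  membership; with the two norms as \<open>A\<close> and \<open>B\<close> it integrates to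
  \<open>(A + B) powr p\<close>.\<close>

lemma Lp_add:
  assumes p: "p \<ge> 1" and f: "f \<in> Lp p" and g: "g \<in> Lp p"
  shows "(\<lambda>x. f x + g x) \<in> Lp p" "Lp_norm p (\<lambda>x. f x + g x) \<le> Lp_norm p f + Lp_norm p g"
proof -
  note [measurable] = f g
  have key: "norm (f x + g x) powr p \<le> (A + B) powr p *
      (A / (A + B) * (norm (f x) powr p / A powr p) + B / (A + B) * (norm (g x) powr p / B powr p))"
    if "A > 0" "B > 0" for A B x
  proof -
    have B: "B / (A + B) = 1 - A / (A + B)" using that by (simp add: field_simps)
    define X where "X = A / (A + B) * (norm (f x) / A) + (1 - A / (A + B)) * (norm (g x) / B)"
    have X: "X \<ge> 0" "norm (f x) + norm (g x) = (A + B) * X"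
      using that unfolding X_def B[symmetric] by (auto simp: distrib_left)
    have "norm (f x + g x) powr p \<le> ((A + B) * X) powr p"
      unfolding X(2)[symmetric] using p by (intro powr_mono2 norm_triangle_ineq) auto
    also have "\<dots> = (A + B) powr p * X powr p" by (simp add: powr_mult)
    also have "X powr p \<le> A / (A + B) * (norm (f x) / A) powr p + (1 - A / (A + B)) * (norm (g x) / B) powr p"
      unfolding X_def using that p by (intro powr_convex_combination) auto
    finally show ?thesis unfolding B[symmetric] using that by (simp add: powr_divide mult_left_mono)
  qed
  have int: "integrable lborel (\<lambda>x. (A + B) powr p *
      (A / (A + B) * (norm (f x) powr p / A powr p) + B / (A + B) * (norm (g x) powr p / B powr p)))" for A B
    by (intro integrable_mult_right integrable_add integrable_divide Bochner_Integration.integrable_add Lp_integrable f g)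
  have "integrable lborel (\<lambda>x. norm (f x + g x) powr p)"
    by (rule Bochner_Integration.integrable_bound[OF int[of 1 1]]) (use key[of 1 1] in auto)
  then show mem: "(\<lambda>x. f x + g x) \<in> Lp p" by (simp add: Lp_iff)
  define A where "A = Lp_norm p f"
  define B where "B = Lp_norm p g"
  have p0: "p > 0" using p by simp
  consider "A = 0" | "B = 0" | "A > 0" "B > 0"
    using Lp_norm_nonneg[of p f] Lp_norm_nonneg[of p g] unfolding A_def B_def by linarith
  then show "Lp_norm p (\<lambda>x. f x + g x) \<le> Lp_norm p f + Lp_norm p g"
  proof cases
    case 1
    then have "AE x in lborel. f x = 0"
      using Lp_norm_eq_0_iff[OF p0 f] by (simp add: A_def)
    then have "Lp_norm p (\<lambda>x. f x + g x) = Lp_norm p g"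
      by (intro Lp_norm_cong_AE) auto
    then show ?thesis by simp
  next
    case 2
    then have "AE x in lborel. g x = 0"
      using Lp_norm_eq_0_iff[OF p0 g] by (simp add: B_def)
    then have "Lp_norm p (\<lambda>x. f x + g x) = Lp_norm p f"
      by (intro Lp_norm_cong_AE) auto
    then show ?thesis by simp
  next
    case 3
    have "(\<integral>x. norm (f x + g x) powr p \<partial>lborel) \<le> (\<integral>x. (A + B) powr p *
      (A / (A + B) * (norm (f x) powr p / A powr p) + B / (A + B) * (norm (g x) powr p / B powr p)) \<partial>lborel)"
      by (intro integral_mono int Lp_integrable mem key 3)
    also have "\<dots> = (A + B) powr p * (A / (A + B) * (A powr p / A powr p) + B / (A + B) * (B powr p / B powr p))"
      unfolding A_def B_def Lp_norm_powr[OF p0]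
      by (subst Bochner_Integration.integral_mult_right_zero, subst Bochner_Integration.integral_add)
         (auto intro!: integrable_mult_right integrable_divide Lp_integrable f g)
    also have "\<dots> = (A + B) powr p"
      using 3 by (simp add: add_divide_distrib[symmetric])
    finally show ?thesis
      using 3 by (subst Lp_norm_le_iff[OF p0]) (auto simp: A_def B_def)
  qed
qed

lemma Lp_uminus:
  "f \<in> Lp p \<Longrightarrow> (\<lambda>x. - f x) \<in> Lp p" "Lp_norm p (\<lambda>x. - f x) = Lp_norm p f"
  by (simp_all add: Lp_iff Lp_norm_def)

lemma Lp_diff:
  assumes "p \<ge> 1" "f \<in> Lp p" "g \<in> Lp p"
  shows "(\<lambda>x. f x - g x) \<in> Lp p" "Lp_norm p (\<lambda>x. f x - g x) \<le> Lp_norm p f + Lp_norm p g"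
  using Lp_add[OF assms(1,2) Lp_uminus(1)[OF assms(3)]] by (simp_all add: Lp_uminus)

lemma Lp_norm_minus_commute: "Lp_norm p (\<lambda>x. f x - g x) = Lp_norm p (\<lambda>x. g x - f x)"
  by (simp add: Lp_norm_def norm_minus_commute)

lemma Lp_triangle:
  assumes "p \<ge> 1" "f \<in> Lp p" "g \<in> Lp p" "h \<in> Lp p"
  shows "Lp_norm p (\<lambda>x. f x - h x) \<le> Lp_norm p (\<lambda>x. f x - g x) + Lp_norm p (\<lambda>x. g x - h x)"
  using Lp_add(2)[OF assms(1) Lp_diff(1)[OF assms(1,2,3)] Lp_diff(1)[OF assms(1,3,4)]] by simp

lemma Lp_norm_triangle_sub:
  assumes "p \<ge> 1" "f \<in> Lp p" "g \<in> Lp p"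
  shows "Lp_norm p f \<le> Lp_norm p g + Lp_norm p (\<lambda>x. f x - g x)"
  using Lp_add(2)[OF assms(1,3) Lp_diff(1)[OF assms(1,2,3)]] by simp

section \<open>Convergence in L^p, completeness and Hoelder's inequality\<close>

lemma Lp_norm_tendsto_0_iff:
  assumes "p > 0"
  shows "(\<lambda>k. Lp_norm p (F k)) \<longlonglongrightarrow> 0 \<longleftrightarrow> (\<lambda>k. \<integral>x. norm (F k x) powr p \<partial>lborel) \<longlonglongrightarrow> 0"
proof
  assume "(\<lambda>k. Lp_norm p (F k)) \<longlonglongrightarrow> 0"
  then have "(\<lambda>k. Lp_norm p (F k) powr p) \<longlonglongrightarrow> 0 powr p"
    by (intro tendsto_powr2 tendsto_const) (use assms in auto)
  then show "(\<lambda>k. \<integral>x. norm (F k x) powr p \<partial>lborel) \<longlonglongrightarrow> 0"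
    by (simp add: Lp_norm_powr[OF assms])
next
  assume "(\<lambda>k. \<integral>x. norm (F k x) powr p \<partial>lborel) \<longlonglongrightarrow> 0"
  then have "(\<lambda>k. (\<integral>x. norm (F k x) powr p \<partial>lborel) powr (1 / p)) \<longlonglongrightarrow> 0 powr (1 / p)"
    by (intro tendsto_powr2 tendsto_const) (use assms in auto)
  then show "(\<lambda>k. Lp_norm p (F k)) \<longlonglongrightarrow> 0"
    by (simp add: Lp_norm_def)
qed

lemma Lp_tendsto_AE_subseq:
  assumes p: "p > 0" and F: "\<And>k. (\<lambda>x. F k x - f x) \<in> Lp p"
    and lim: "(\<lambda>k. Lp_norm p (\<lambda>x. F k x - f x)) \<longlonglongrightarrow> 0"
  shows "\<exists>r::nat\<Rightarrow>nat. strict_mono r \<and> (AE x in lborel. (\<lambda>k. F (r k) x) \<longlonglongrightarrow> f x)"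
proof -
  have "(\<lambda>k. \<integral>x. norm (norm (F k x - f x) powr p) \<partial>lborel) \<longlonglongrightarrow> 0"
    using lim by (simp add: Lp_norm_tendsto_0_iff[OF p])
  from tendsto_L1_AE_subseq[OF Lp_integrable[OF F] this] obtain r :: "nat \<Rightarrow> nat" where
    r: "strict_mono r" "AE x in lborel. (\<lambda>k. norm (F (r k) x - f x) powr p) \<longlonglongrightarrow> 0" by auto
  have "AE x in lborel. (\<lambda>k. F (r k) x) \<longlonglongrightarrow> f x"
    using r(2)
  proof eventually_elim
    case (elim x)
    then have "(\<lambda>k. (norm (F (r k) x - f x) powr p) powr (1/p)) \<longlonglongrightarrow> 0 powr (1/p)"
      by (intro tendsto_powr2 tendsto_const) (use p in auto)
    then have "(\<lambda>k. norm (F (r k) x - f x)) \<longlonglongrightarrow> 0"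
      using p by (simp add: powr_powr)
    then show ?case
      using LIM_zero_iff tendsto_norm_zero_iff by blast
  qed
  with r(1) show ?thesis by blast
qed

text \<open>Membership of the limit is a conclusion, which is how limits of operators are seen to
  stay in \<open>Lp p\<close>. The bound is asked only eventually because completeness supplies it
  only for late indices.\<close>

lemma Lp_Fatou:
  assumes p: "p > 0" and f [measurable]: "f \<in> borel_measurable borel" and F: "\<And>k. F k \<in> Lp p"
    and lim: "AE x in lborel. (\<lambda>k. F k x) \<longlonglongrightarrow> f x"
    and le: "\<forall>\<^sub>F k in sequentially. Lp_norm p (F k) \<le> M"
  shows "f \<in> Lp p" "Lp_norm p f \<le> M"
proof -
  have M: "M \<ge> 0"
  proof -
    obtain k where "Lp_norm p (F k) \<le> M" using eventually_happens'[OF sequentially_bot le] by blast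
    then show ?thesis using Lp_norm_nonneg[of p "F k"] by linarith
  qed
  note [measurable] = F
  have "(\<integral>\<^sup>+x. ennreal (norm (f x) powr p) \<partial>lborel) = (\<integral>\<^sup>+x. liminf (\<lambda>k. ennreal (norm (F k x) powr p)) \<partial>lborel)"
  proof (rule nn_integral_cong_AE)
    show "AE x in lborel. ennreal (norm (f x) powr p) = liminf (\<lambda>k. ennreal (norm (F k x) powr p))"
      using lim
    proof eventually_elim
      case (elim x)
      have "(\<lambda>k. ennreal (norm (F k x) powr p)) \<longlonglongrightarrow> ennreal (norm (f x) powr p)"
        by (intro tendsto_ennrealI tendsto_powr2 tendsto_norm elim tendsto_const) (use p in auto)
      then show ?case by (intro lim_imp_Liminf[symmetric]) auto
    qed
  qed
  also have "\<dots> \<le> liminf (\<lambda>k. \<integral>\<^sup>+x. ennreal (norm (F k x) powr p) \<partial>lborel)"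
    by (rule nn_integral_liminf) auto
  also have "\<dots> \<le> liminf (\<lambda>k::nat. ennreal (M powr p))"
  proof (rule Liminf_mono)
    show "\<forall>\<^sub>F k in sequentially. (\<integral>\<^sup>+x. ennreal (norm (F k x) powr p) \<partial>lborel) \<le> ennreal (M powr p)"
      using le
    proof eventually_elim
      case (elim k)
      then show ?case
        using Lp_norm_le_iff[OF p M, of "F k"]
        by (subst nn_integral_eq_integral) (auto intro: Lp_integrable F)
    qed
  qed
  also have "\<dots> = ennreal (M powr p)" by (simp add: Liminf_const)
  finally have *: "(\<integral>\<^sup>+x. ennreal (norm (f x) powr p) \<partial>lborel) \<le> ennreal (M powr p)" .
  have i: "integrable lborel (\<lambda>x. norm (f x) powr p)"
    using * by (intro integrableI_bounded) (auto simp: order_le_less_trans)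
  then show "f \<in> Lp p" by (simp add: Lp_iff)
  have "ennreal (\<integral>x. norm (f x) powr p \<partial>lborel) \<le> ennreal (M powr p)"
    using * by (subst (asm) nn_integral_eq_integral[OF i]) auto
  then show "Lp_norm p f \<le> M"
    using Lp_norm_le_iff[OF p M, of f] by (simp add: ennreal_le_iff)
qed

lemma Lp_dominated:
  assumes p: "p \<ge> 1" and g: "g \<in> Lp p" and f [measurable]: "f \<in> borel_measurable borel"
    and F [measurable]: "\<And>k. F k \<in> borel_measurable borel"
    and lim: "AE x in lborel. (\<lambda>k. F k x) \<longlonglongrightarrow> f x"
    and le: "\<And>k. AE x in lborel. norm (F k x) \<le> norm (g x)"
  shows "f \<in> Lp p" "\<And>k. F k \<in> Lp p" "(\<lambda>k. Lp_norm p (\<lambda>x. F k x - f x)) \<longlonglongrightarrow> 0"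
proof -
  have p0: "p > 0" using p by simp
  show Fk: "F k \<in> Lp p" for k by (rule Lp_bound(1)[OF p0 g F le])
  have le': "AE x in lborel. norm (f x) \<le> norm (g x)"
  proof -
    have "AE x in lborel. \<forall>k. norm (F k x) \<le> norm (g x)"
      using le by (simp add: AE_all_countable)
    then show ?thesis using lim
      by eventually_elim (auto intro: LIMSEQ_le_const2 tendsto_norm)
  qed
  show fp: "f \<in> Lp p" by (rule Lp_bound(1)[OF p0 g f le'])
  note [measurable] = g
  have i: "integrable lborel (\<lambda>x. 2 powr p * norm (g x) powr p)"
    by (intro integrable_mult_right Lp_integrable g)
  have "(\<lambda>k. \<integral>x. norm (F k x - f x) powr p \<partial>lborel) \<longlonglongrightarrow> (\<integral>x. 0 \<partial>(lborel::'a measure))"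
  proof (rule integral_dominated_convergence[OF _ _ i])
    show "AE x in lborel. (\<lambda>k. norm (F k x - f x) powr p) \<longlonglongrightarrow> 0"
      using lim
    proof eventually_elim
      case (elim x)
      have "(\<lambda>k. norm (F k x - f x)) \<longlonglongrightarrow> 0"
        using elim by (simp add: LIM_zero tendsto_norm_zero)
      then have "(\<lambda>k. norm (F k x - f x) powr p) \<longlonglongrightarrow> 0 powr p"
        by (intro tendsto_powr2 tendsto_const) (use p in auto)
      then show ?case using p by simp
    qed
    show "AE x in lborel. norm (norm (F k x - f x) powr p) \<le> 2 powr p * norm (g x) powr p" for k
      using le[of k] le'
    proof eventually_elim
      case (elim x)
      have "norm (F k x - f x) \<le> 2 * norm (g x)"
        using norm_triangle_ineq4[of "F k x" "f x"] elim by linarith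
      then have "norm (F k x - f x) powr p \<le> (2 * norm (g x)) powr p"
        using p by (intro powr_mono2) auto
      then show ?case by (simp add: powr_mult)
    qed
  qed auto
  then show "(\<lambda>k. Lp_norm p (\<lambda>x. F k x - f x)) \<longlonglongrightarrow> 0"
    by (simp add: Lp_norm_tendsto_0_iff[OF p0])
qed

text \<open>The rate \<open>(1/4) ^ k\<close> leaves room for a factor \<open>2 ^ k\<close>: the
  p-th powers of the norms of \<open>2 ^ k *\<^sub>R D k x\<close> have integrals at most
  \<open>q ^ k\<close>, so they are summable at almost every point. There
  \<open>norm (D k x)\<close> is eventually at most \<open>(1/2) ^ k\<close>, and the increments are
  summable.\<close>

lemma summable_Lp_norm_imp_AE_convergent:
  fixes F :: "nat \<Rightarrow> 'a::euclidean_space \<Rightarrow> 'b::{banach, second_countable_topology}"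
  assumes p: "p > 0" and F: "\<And>k. (\<lambda>x. F (Suc k) x - F k x) \<in> Lp p"
    and le: "\<And>k. Lp_norm p (\<lambda>x. F (Suc k) x - F k x) \<le> (1/4) ^ k"
  shows "AE x in lborel. convergent (\<lambda>k. F k x)"
proof -
  define D where "D k x = F (Suc k) x - F k x" for k x
  have D: "D k \<in> Lp p" for k using F by (simp add: D_def[abs_def])
  note [measurable] = D
  define q where "q = (1/2) powr p"
  have q: "0 \<le> q" "q < 1" using p powr_less_mono2[of p "1/2" 1] by (auto simp: q_def)
  have bound: "(\<integral>\<^sup>+x. ennreal (norm (2 ^ k *\<^sub>R D k x) powr p) \<partial>lborel) \<le> ennreal (q ^ k)" for k
  proof -
    have "(\<integral>\<^sup>+x. ennreal (norm (2 ^ k *\<^sub>R D k x) powr p) \<partial>lborel)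
        = ennreal (\<integral>x. (2 ^ k) powr p * norm (D k x) powr p \<partial>lborel)"
      by (subst nn_integral_eq_integral[symmetric])
         (auto simp: powr_mult intro!: integrable_mult_right Lp_integrable D)
    also have "(\<integral>x. (2 ^ k) powr p * norm (D k x) powr p \<partial>lborel) = (2 ^ k) powr p * Lp_norm p (D k) powr p"
      by (simp add: Lp_norm_powr[OF p])
    also have "\<dots> \<le> (2 ^ k) powr p * ((1/4) ^ k) powr p"
      using le[of k] p by (intro mult_left_mono powr_mono2) (auto simp: D_def[abs_def])
    also have "\<dots> = ((1/2) ^ k) powr p"
      by (subst powr_mult[symmetric]) (auto simp: power_mult_distrib[symmetric])
    also have "\<dots> = q ^ k"
      by (simp add: q_def powr_power powr_powr powr_realpow[symmetric] mult.commute)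
    finally show ?thesis by (simp add: ennreal_leI)
  qed
  have "(\<integral>\<^sup>+x. (\<Sum>k. ennreal (norm (2 ^ k *\<^sub>R D k x) powr p)) \<partial>lborel)
      = (\<Sum>k. \<integral>\<^sup>+x. ennreal (norm (2 ^ k *\<^sub>R D k x) powr p) \<partial>lborel)"
    by (rule nn_integral_suminf) auto
  also have "\<dots> \<le> (\<Sum>k. ennreal (q ^ k))"
    by (intro suminf_le bound) auto
  also have "\<dots> = ennreal (\<Sum>k. q ^ k)"
    using q by (intro suminf_ennreal2) (auto intro: summable_geometric)
  also have "\<dots> < \<infinity>" by simp
  finally have "AE x in lborel. (\<Sum>k. ennreal (norm (2 ^ k *\<^sub>R D k x) powr p)) \<noteq> \<infinity>"
    by (intro nn_integral_PInf_AE) auto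
  then show ?thesis
  proof eventually_elim
    case (elim x)
    have "summable (\<lambda>k. norm (2 ^ k *\<^sub>R D k x) powr p)"
      using elim by (intro summable_suminf_not_top) (auto simp: top_ennreal_def infinity_ennreal_def)
    then have "(\<lambda>k. norm (2 ^ k *\<^sub>R D k x) powr p) \<longlonglongrightarrow> 0"
      by (rule summable_LIMSEQ_zero)
    then have "\<forall>\<^sub>F k in sequentially. norm (2 ^ k *\<^sub>R D k x) powr p < 1"
      by (rule order_tendstoD) simp
    then have "\<forall>\<^sub>F k in sequentially. norm (D k x) \<le> (1/2) ^ k"
    proof eventually_elim
      case (elim k)
      have "norm (2 ^ k *\<^sub>R D k x) \<le> 1"
      proof (rule ccontr)
        assume "\<not> ?thesis"
        then have "1 powr p \<le> norm (2 ^ k *\<^sub>R D k x) powr p"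
          using p by (intro powr_mono2) auto
        with elim show False by simp
      qed
      then show ?case by (simp add: field_simps)
    qed
    then have "summable (\<lambda>k. D k x)"
      by (rule summable_comparison_test_ev) (rule summable_geometric, simp)
    then have "convergent (\<lambda>n. \<Sum>k<n. D k x)"
      by (simp add: summable_iff_convergent)
    moreover have "(\<Sum>k<n. D k x) = F n x - F 0 x" for n
      by (induction n) (simp_all add: D_def)
    ultimately have "convergent (\<lambda>n. F n x - F 0 x)" by simp
    then have "convergent (\<lambda>n. (F n x - F 0 x) + F 0 x)"
      by (intro convergent_add convergent_const)
    then show ?case by simp
  qed
qed

lemma Lp_complete:
  fixes F :: "nat \<Rightarrow> 'a::euclidean_space \<Rightarrow> 'b::{banach, second_countable_topology}"
  assumes p: "p \<ge> 1" and F: "\<And>k. F k \<in> Lp p"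
    and Cauchy: "\<And>e. e > 0 \<Longrightarrow> \<exists>N. \<forall>m\<ge>N. \<forall>n\<ge>N. Lp_norm p (\<lambda>x. F m x - F n x) \<le> e"
  shows "\<exists>f\<in>Lp p. (\<lambda>k. Lp_norm p (\<lambda>x. F k x - f x)) \<longlonglongrightarrow> 0"
proof -
  have p0: "p > 0" using p by simp
  note [measurable] = F
  have "\<exists>N. \<forall>k. \<forall>m\<ge>N k. \<forall>n\<ge>N k. Lp_norm p (\<lambda>x. F m x - F n x) \<le> (1/4) ^ k"
    by (intro choice allI Cauchy) auto
  then obtain N where N: "\<And>k m n. m \<ge> N k \<Longrightarrow> n \<ge> N k \<Longrightarrow> Lp_norm p (\<lambda>x. F m x - F n x) \<le> (1/4) ^ k"
    by blast
  \<comment> \<open>The cumulative sum makes \<open>r\<close> monotone with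
    \<open>r k \<ge> N k\<close>; the added \<open>k\<close> makes it unbounded, so that
    \<open>r k\<close> eventually passes any index.\<close>
  define r where "r k = k + (\<Sum>j\<le>k. N j)" for k
  have r: "r k \<ge> N k" for k
    unfolding r_def using member_le_sum[of k "{..k}" N] by simp
  have r': "r (Suc k) \<ge> r k" for k by (simp add: r_def)
  have r'': "r k \<ge> k" for k by (simp add: r_def)
  have conv: "AE x in lborel. convergent (\<lambda>k. F (r k) x)"
  proof (rule summable_Lp_norm_imp_AE_convergent[OF p0])
    show "(\<lambda>x. F (r (Suc k)) x - F (r k) x) \<in> Lp p" for k by (rule Lp_diff(1)[OF p F F])
    show "Lp_norm p (\<lambda>x. F (r (Suc k)) x - F (r k) x) \<le> (1/4) ^ k" for k
      using r[of k] r'[of k] by (intro N) auto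
  qed
  define f where "f x = lim (\<lambda>k. F (r k) x)" for x
  have [measurable]: "f \<in> borel_measurable borel" unfolding f_def[abs_def] by measurable
  have lim: "AE x in lborel. (\<lambda>k. F (r k) x) \<longlonglongrightarrow> f x"
    using conv by eventually_elim (simp add: f_def convergent_LIMSEQ_iff)
  have main: "\<exists>K. \<forall>n\<ge>K. (\<lambda>x. F n x - f x) \<in> Lp p \<and> Lp_norm p (\<lambda>x. F n x - f x) \<le> e" if e: "e > 0" for e
  proof -
    obtain K where K: "\<And>m n. m \<ge> K \<Longrightarrow> n \<ge> K \<Longrightarrow> Lp_norm p (\<lambda>x. F m x - F n x) \<le> e"
      using Cauchy[OF e] by blast
    have "(\<lambda>x. F n x - f x) \<in> Lp p \<and> Lp_norm p (\<lambda>x. F n x - f x) \<le> e" if n: "n \<ge> K" for n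
    proof -
      have l: "AE x in lborel. (\<lambda>k. F n x - F (r k) x) \<longlonglongrightarrow> F n x - f x"
        using lim by eventually_elim (auto intro: tendsto_intros)
      have ev: "\<forall>\<^sub>F k in sequentially. Lp_norm p (\<lambda>x. F n x - F (r k) x) \<le> e"
        using eventually_ge_at_top[of K]
        by eventually_elim (rule K[OF n order_trans[OF _ r'']])
      show ?thesis
        using Lp_Fatou[OF p0 _ _ l ev] Lp_diff[OF p F F] by auto
    qed
    then show ?thesis by blast
  qed
  obtain K where "(\<lambda>x. F K x - f x) \<in> Lp p"
    using main[of 1] by auto
  from Lp_diff(1)[OF p F[of K] this] have "f \<in> Lp p" by simp
  moreover have "(\<lambda>k. Lp_norm p (\<lambda>x. F k x - f x)) \<longlonglongrightarrow> 0"
  proof (rule LIMSEQ_I)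
    fix e :: real assume "e > 0"
    then obtain K where "\<forall>n\<ge>K. Lp_norm p (\<lambda>x. F n x - f x) \<le> e/2" using main[of "e/2"] by auto
    with \<open>e > 0\<close> show "\<exists>no. \<forall>n\<ge>no. norm (Lp_norm p (\<lambda>x. F n x - f x) - 0) < e"
      by (intro exI[of _ K]) force
  qed
  ultimately show ?thesis by blast
qed

lemma Lp_limit_unique:
  assumes p: "p \<ge> 1" and "f \<in> Lp p" "g \<in> Lp p" "\<And>k. F k \<in> Lp p"
    and "(\<lambda>k. Lp_norm p (\<lambda>x. F k x - f x)) \<longlonglongrightarrow> 0" "(\<lambda>k. Lp_norm p (\<lambda>x. F k x - g x)) \<longlonglongrightarrow> 0"
  shows "AE x in lborel. f x = g x"
proof -
  have "(\<lambda>k. Lp_norm p (\<lambda>x. F k x - f x) + Lp_norm p (\<lambda>x. F k x - g x)) \<longlonglongrightarrow> 0 + 0"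
    by (intro tendsto_add assms)
  moreover have "Lp_norm p (\<lambda>x. f x - g x) \<le> Lp_norm p (\<lambda>x. F k x - f x) + Lp_norm p (\<lambda>x. F k x - g x)" for k
    using Lp_triangle[OF p assms(2,4,3), of k] by (simp add: Lp_norm_minus_commute[of p f])
  ultimately have "Lp_norm p (\<lambda>x. f x - g x) \<le> 0"
    by (intro LIMSEQ_le_const[of _ 0]) auto
  then have "Lp_norm p (\<lambda>x. f x - g x) = 0" using Lp_norm_nonneg order_antisym by blast
  then show ?thesis
    using Lp_norm_eq_0_iff[of p "\<lambda>x. f x - g x"] Lp_diff(1)[OF assms(1,2,3)] p by simp
qed

text \<open>Hoelder's inequality for the p-th powers with exponents
  \<open>\<alpha> / (\<alpha> - 1)\<close> and \<alpha>, again by normalising, now with Young's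
  inequality in place of convexity. The left side has the shape in which a difference of two values
  of the nonlinearity is bounded: a power of one function times the difference.\<close>

lemma Lp_weighted_Hoelder:
  fixes u :: "'a::euclidean_space \<Rightarrow> 'b::{banach, second_countable_topology}"
    and w :: "'a::euclidean_space \<Rightarrow> 'c::{banach, second_countable_topology}"
  assumes p: "p > 0" and \<alpha>: "\<alpha> > 1" and u: "u \<in> Lp (\<alpha> * p)" and w: "w \<in> Lp (\<alpha> * p)"
  shows "(\<lambda>x. norm (u x) powr (\<alpha> - 1) * norm (w x)) \<in> Lp p"
    "Lp_norm p (\<lambda>x. norm (u x) powr (\<alpha> - 1) * norm (w x))
       \<le> Lp_norm (\<alpha> * p) u powr (\<alpha> - 1) * Lp_norm (\<alpha> * p) w"
proof -
  note [measurable] = u w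
  have ap: "\<alpha> * p > 0" using p \<alpha> by simp
  have young: "(X powr (\<alpha> - 1) * Y) powr p \<le> (1 - 1/\<alpha>) * X powr (\<alpha> * p) + (1/\<alpha>) * Y powr (\<alpha> * p)"
    if "X \<ge> 0" "Y \<ge> 0" for X Y
  proof (cases "X = 0 \<or> Y = 0")
    case False
    have "(X powr (\<alpha> * p)) powr (1 - 1/\<alpha>) * (Y powr (\<alpha> * p)) powr (1/\<alpha>)
       \<le> (1 - 1/\<alpha>) * X powr (\<alpha> * p) + (1/\<alpha>) * Y powr (\<alpha> * p)"
      using \<alpha> False that by (intro Youngs_inequality_0) auto
    moreover have "\<alpha> * p * (1 - 1/\<alpha>) = (\<alpha> - 1) * p" using \<alpha> by (simp add: field_simps)
    ultimately show ?thesis using that \<alpha> by (simp add: powr_mult powr_powr)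
  qed (use \<alpha> in \<open>auto intro!: mult_nonneg_nonneg\<close>)
  have key: "(norm (u x) powr (\<alpha> - 1) * norm (w x)) powr p \<le> (A powr (\<alpha> - 1) * B) powr p *
      ((1 - 1/\<alpha>) * (norm (u x) powr (\<alpha> * p) / A powr (\<alpha> * p)) + (1/\<alpha>) * (norm (w x) powr (\<alpha> * p) / B powr (\<alpha> * p)))"
    if "A > 0" "B > 0" for A B x
  proof -
    have "(norm (u x) powr (\<alpha> - 1) * norm (w x)) powr p =
      (A powr (\<alpha> - 1) * B) powr p * ((norm (u x) / A) powr (\<alpha> - 1) * (norm (w x) / B)) powr p"
      using that by (simp add: powr_divide powr_mult)
    also have "\<dots> \<le> (A powr (\<alpha> - 1) * B) powr p *
      ((1 - 1/\<alpha>) * (norm (u x) / A) powr (\<alpha> * p) + (1/\<alpha>) * (norm (w x) / B) powr (\<alpha> * p))"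
      using that by (intro mult_left_mono young) auto
    finally show ?thesis using that by (simp add: powr_divide)
  qed
  have int: "integrable lborel (\<lambda>x. (A powr (\<alpha> - 1) * B) powr p *
      ((1 - 1/\<alpha>) * (norm (u x) powr (\<alpha> * p) / A powr (\<alpha> * p)) + (1/\<alpha>) * (norm (w x) powr (\<alpha> * p) / B powr (\<alpha> * p))))" for A B
    by (intro integrable_mult_right Bochner_Integration.integrable_add integrable_divide Lp_integrable u w)
  have "integrable lborel (\<lambda>x. norm (norm (u x) powr (\<alpha> - 1) * norm (w x)) powr p)"
  proof (rule Bochner_Integration.integrable_bound[OF int[of 1 1]])
    show "AE x in lborel. norm (norm (norm (u x) powr (\<alpha> - 1) * norm (w x)) powr p) \<le>
      norm ((1 powr (\<alpha> - 1) * 1) powr p * ((1 - 1/\<alpha>) * (norm (u x) powr (\<alpha> * p) / 1 powr (\<alpha> * p)) + (1/\<alpha>) * (norm (w x) powr (\<alpha> * p) / 1 powr (\<alpha> * p))))"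
      by (intro AE_I2, unfold real_norm_def, rule order_trans[OF _ abs_ge_self], use key[of 1 1] in \<open>simp add: abs_mult\<close>)
  qed auto
  then show mem: "(\<lambda>x. norm (u x) powr (\<alpha> - 1) * norm (w x)) \<in> Lp p" by (simp add: Lp_iff)
  define A where "A = Lp_norm (\<alpha> * p) u"
  define B where "B = Lp_norm (\<alpha> * p) w"
  consider "A = 0 \<or> B = 0" | "A > 0" "B > 0"
    using Lp_norm_nonneg[of "\<alpha> * p" u] Lp_norm_nonneg[of "\<alpha> * p" w] unfolding A_def B_def by linarith
  then show "Lp_norm p (\<lambda>x. norm (u x) powr (\<alpha> - 1) * norm (w x))
       \<le> Lp_norm (\<alpha> * p) u powr (\<alpha> - 1) * Lp_norm (\<alpha> * p) w"
  proof cases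
    case 1
    then have "(AE x in lborel. u x = 0) \<or> (AE x in lborel. w x = 0)"
      using Lp_norm_eq_0_iff[OF ap u] Lp_norm_eq_0_iff[OF ap w] by (auto simp: A_def B_def)
    then have "AE x in lborel. norm (u x) powr (\<alpha> - 1) * norm (w x) = 0"
      by auto
    then have "Lp_norm p (\<lambda>x. norm (u x) powr (\<alpha> - 1) * norm (w x)) = 0"
      using Lp_norm_eq_0_iff[OF p mem] by simp
    then show ?thesis by simp
  next
    case 2
    have "(\<integral>x. norm (norm (u x) powr (\<alpha> - 1) * norm (w x)) powr p \<partial>lborel) \<le> (\<integral>x. (A powr (\<alpha> - 1) * B) powr p *
      ((1 - 1/\<alpha>) * (norm (u x) powr (\<alpha> * p) / A powr (\<alpha> * p)) + (1/\<alpha>) * (norm (w x) powr (\<alpha> * p) / B powr (\<alpha> * p))) \<partial>lborel)"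
      using key[OF 2] by (intro integral_mono int Lp_integrable mem) auto
    also have "\<dots> = (A powr (\<alpha> - 1) * B) powr p *
      ((1 - 1/\<alpha>) * (A powr (\<alpha> * p) / A powr (\<alpha> * p)) + (1/\<alpha>) * (B powr (\<alpha> * p) / B powr (\<alpha> * p)))"
      unfolding A_def B_def Lp_norm_powr[OF ap]
      by (subst Bochner_Integration.integral_mult_right_zero, subst Bochner_Integration.integral_add)
         (auto intro!: integrable_mult_right integrable_divide Lp_integrable u w)
    also have "\<dots> = (A powr (\<alpha> - 1) * B) powr p"
      using 2 \<alpha> by simp
    finally show ?thesis
      using 2 by (subst Lp_norm_le_iff[OF p]) (auto simp: A_def B_def)
  qed
qed

text \<open>Membership in \<open>Lp p\<close> is carried along separately, and it matters: for a
  difference whose p-th power is not integrable the integral has the default value \<open>0\<close>,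
  and so has the norm.\<close>

definition Lp_tendsto ::
    "real \<Rightarrow> (nat \<Rightarrow> 'a::euclidean_space \<Rightarrow> 'b::{banach, second_countable_topology}) \<Rightarrow> ('a \<Rightarrow> 'b) \<Rightarrow> bool" where
  "Lp_tendsto p F f \<longleftrightarrow> (\<lambda>k. Lp_norm p (\<lambda>x. F k x - f x)) \<longlonglongrightarrow> 0"

lemma Lp_tendsto_const: "Lp_tendsto p (\<lambda>k. f) f"
  by (simp add: Lp_tendsto_def)

lemma Lp_tendsto_squeeze:
  assumes "\<And>k. Lp_norm p (\<lambda>x. F k x - f x) \<le> e k" "e \<longlonglongrightarrow> 0"
  shows "Lp_tendsto p F f"
  unfolding Lp_tendsto_def
  by (rule tendsto_sandwich[OF _ _ tendsto_const assms(2)]) (auto simp: assms(1))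

lemma Lp_tendsto_add:
  assumes "p \<ge> 1" "\<And>k. F k \<in> Lp p" "f \<in> Lp p" "\<And>k. G k \<in> Lp p" "g \<in> Lp p"
    and "Lp_tendsto p F f" "Lp_tendsto p G g"
  shows "Lp_tendsto p (\<lambda>k x. F k x + G k x) (\<lambda>x. f x + g x)"
proof (rule Lp_tendsto_squeeze)
  fix k
  show "Lp_norm p (\<lambda>x. F k x + G k x - (f x + g x)) \<le> Lp_norm p (\<lambda>x. F k x - f x) + Lp_norm p (\<lambda>x. G k x - g x)"
    using Lp_add(2)[OF assms(1) Lp_diff(1)[OF assms(1,2,3), of k] Lp_diff(1)[OF assms(1,4,5), of k]]
    by (simp add: algebra_simps)
  show "(\<lambda>k. Lp_norm p (\<lambda>x. F k x - f x) + Lp_norm p (\<lambda>x. G k x - g x)) \<longlonglongrightarrow> 0"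
    using tendsto_add[of _ 0 sequentially _ 0] assms(6,7) by (fastforce simp: Lp_tendsto_def)
qed

lemma Lp_tendsto_cmult:
  fixes F :: "nat \<Rightarrow> 'a::euclidean_space \<Rightarrow> complex"
  assumes "p \<ge> 1" "\<And>k. F k \<in> Lp p" "f \<in> Lp p" "Lp_tendsto p F f"
  shows "Lp_tendsto p (\<lambda>k x. c * F k x) (\<lambda>x. c * f x)"
proof (rule Lp_tendsto_squeeze)
  show "Lp_norm p (\<lambda>x. c * F k x - c * f x) \<le> norm c * Lp_norm p (\<lambda>x. F k x - f x)" for k
    using Lp_cmult(2)[OF _ Lp_diff(1)[OF assms(1,2,3)], of c k] assms(1) by (simp add: right_diff_distrib)
  show "(\<lambda>k. norm c * Lp_norm p (\<lambda>x. F k x - f x)) \<longlonglongrightarrow> 0"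
    using assms(4) by (auto simp: Lp_tendsto_def intro: tendsto_mult_right_zero)
qed

lemma Lp_tendsto_cong_AE:
  assumes "\<And>k. F k \<in> borel_measurable borel" "\<And>k. G k \<in> borel_measurable borel"
    and "f \<in> borel_measurable borel" "g \<in> borel_measurable borel"
    and "\<And>k. AE x in lborel. F k x = G k x" "AE x in lborel. f x = g x" "Lp_tendsto p F f"
  shows "Lp_tendsto p G g"
proof -
  note [measurable] = assms(1-4)
  have "Lp_norm p (\<lambda>x. G k x - g x) = Lp_norm p (\<lambda>x. F k x - f x)" for k
    by (rule Lp_norm_cong_AE) (use assms(5)[of k] assms(6) in auto)
  then show ?thesis using assms(7) by (simp add: Lp_tendsto_def)
qed

lemma Lp_tendsto_norm:
  assumes "p \<ge> 1" "\<And>k. F k \<in> Lp p" "f \<in> Lp p" "Lp_tendsto p F f"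
  shows "(\<lambda>k. Lp_norm p (F k)) \<longlonglongrightarrow> Lp_norm p f"
proof (rule LIM_zero_cancel, rule Lim_null_comparison)
  show "\<forall>\<^sub>F k in sequentially. norm (Lp_norm p (F k) - Lp_norm p f) \<le> Lp_norm p (\<lambda>x. F k x - f x)"
    using Lp_norm_triangle_sub[OF assms(1) assms(2,3)] Lp_norm_triangle_sub[OF assms(1) assms(3,2)]
    by (intro always_eventually allI) (auto simp: Lp_norm_minus_commute[of p f] abs_le_iff algebra_simps)
qed (use assms(4) in \<open>simp add: Lp_tendsto_def\<close>)

lemma Lp_tendsto_unique:
  assumes "p \<ge> 1" "f \<in> Lp p" "g \<in> Lp p" "\<And>k. F k \<in> Lp p" "Lp_tendsto p F f" "Lp_tendsto p F g"
  shows "AE x in lborel. f x = g x"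
  using Lp_limit_unique[OF assms(1-4)] assms(5,6) by (simp add: Lp_tendsto_def)

text \<open>Cutting off domain and values at once puts every truncation in all spaces
  \<open>Lp q\<close>, hence in the domain of every operator to be extended. The cut depends only on
  the norms of \<open>x\<close> and \<open>f x\<close>, so real radial functions stay such.\<close>

definition trunc :: "nat \<Rightarrow> ('a::euclidean_space \<Rightarrow> complex) \<Rightarrow> 'a \<Rightarrow> complex" where
  "trunc k f x = (if norm x \<le> real k \<and> norm (f x) \<le> real k then f x else 0)"

lemma trunc_measurable [measurable]:
  assumes [measurable]: "f \<in> borel_measurable borel"
  shows "trunc k f \<in> borel_measurable borel"
  unfolding trunc_def[abs_def] by measurable

lemma norm_trunc_le: "norm (trunc k f x) \<le> norm (f x)" "norm (trunc k f x) \<le> real k"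
  by (auto simp: trunc_def)

lemma trunc_tendsto: "(\<lambda>k. trunc k f x) \<longlonglongrightarrow> f x"
proof (rule tendsto_eventually)
  show "\<forall>\<^sub>F k in sequentially. trunc k f x = f x"
    using eventually_ge_at_top[of "nat \<lceil>max (norm x) (norm (f x))\<rceil>"]
    by eventually_elim (auto simp: trunc_def nat_ceiling_le_eq)
qed

lemma bounded_support_in_Lp:
  fixes f :: "'a::euclidean_space \<Rightarrow> 'b::{banach, second_countable_topology}"
  assumes q: "q > 0" and [measurable]: "f \<in> borel_measurable borel"
    and "\<And>x. norm (f x) \<le> B" "\<And>x. norm x > R \<Longrightarrow> f x = 0"
  shows "f \<in> Lp q"
proof -
  have B: "B \<ge> 0" using assms(3)[of 0] norm_ge_zero order_trans by blast
  have "integrable lborel (\<lambda>x. B powr q * indicator (cball (0::'a) R) x)"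
    by (intro integrable_mult_right integrable_real_indicator) (use emeasure_lborel_cball_finite[of "0::'a" R] in auto)
  then have "integrable lborel (\<lambda>x. norm (f x) powr q)"
  proof (rule Bochner_Integration.integrable_bound)
    show "AE x in lborel. norm (norm (f x) powr q) \<le> norm (B powr q * indicator (cball (0::'a) R) x)"
      using assms(3,4) B q by (intro AE_I2) (auto simp: indicator_def not_le intro!: powr_mono2)
  qed simp
  then show ?thesis by (simp add: Lp_iff)
qed

lemma trunc_in_Lp: "q > 0 \<Longrightarrow> f \<in> borel_measurable borel \<Longrightarrow> trunc k f \<in> Lp q"
  by (rule bounded_support_in_Lp[where B = "real k" and R = "real k"]) (auto simp: norm_trunc_le trunc_def)

lemma trunc_Lp_tendsto:
  assumes "p \<ge> 1" "f \<in> Lp p"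
  shows "Lp_tendsto p (\<lambda>k. trunc k f) f"
  unfolding Lp_tendsto_def
proof (rule Lp_dominated(3)[OF assms])
  show "f \<in> borel_measurable borel" "trunc k f \<in> borel_measurable borel" for k
    using assms(2) by measurable
qed (auto simp: trunc_tendsto norm_trunc_le)

section \<open>Bounded operators on L^p and their extension from dense classes\<close>

context
  fixes p :: real and B :: "('a::euclidean_space \<Rightarrow> complex) \<Rightarrow> 'a \<Rightarrow> complex"
  assumes p: "p \<ge> 1" and B: "bounded_linear_Lp p B"
begin

lemma bounded_linear_Lp_mem: "f \<in> Lp p \<Longrightarrow> B f \<in> Lp p"
  using B by (simp add: bounded_linear_Lp_def)

lemma bounded_linear_Lp_add: "f \<in> Lp p \<Longrightarrow> g \<in> Lp p \<Longrightarrow> AE x in lborel. B (\<lambda>y. f y + g y) x = B f x + B g x"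
  using B by (simp add: bounded_linear_Lp_def)

lemma bounded_linear_Lp_cmult: "f \<in> Lp p \<Longrightarrow> AE x in lborel. B (\<lambda>y. c * f y) x = c * B f x"
  using B by (simp add: bounded_linear_Lp_def)

lemma bounded_linear_Lp_diff:
  assumes "f \<in> Lp p" "g \<in> Lp p"
  shows "AE x in lborel. B (\<lambda>y. f y - g y) x = B f x - B g x"
  using bounded_linear_Lp_add[OF assms(1) Lp_uminus(1)[OF assms(2)]] bounded_linear_Lp_cmult[OF assms(2), of "-1"]
  by auto

lemma bounded_linear_Lp_bound: "\<exists>K\<ge>0. \<forall>f\<in>Lp p. Lp_norm p (B f) \<le> K * Lp_norm p f"
proof -
  obtain K where K: "\<forall>f\<in>Lp p. Lp_norm p (B f) \<le> K * Lp_norm p f"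
    using B by (auto simp: bounded_linear_Lp_def)
  have "K * Lp_norm p f \<le> max K 0 * Lp_norm p f" for f :: "'a \<Rightarrow> complex"
    by (intro mult_right_mono) auto
  with K show ?thesis by (intro exI[of _ "max K 0"]) (auto intro: order_trans)
qed

lemma bounded_linear_Lp_diff_norm:
  assumes "f \<in> Lp p" "g \<in> Lp p"
  shows "Lp_norm p (\<lambda>x. B f x - B g x) = Lp_norm p (B (\<lambda>x. f x - g x))"
proof -
  note [measurable] = bounded_linear_Lp_mem[OF assms(1)] bounded_linear_Lp_mem[OF assms(2)]
    bounded_linear_Lp_mem[OF Lp_diff(1)[OF p assms]]
  show ?thesis
    by (rule Lp_norm_cong_AE) (use bounded_linear_Lp_diff[OF assms] in auto)
qed

lemma bounded_linear_Lp_tendsto: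
  assumes "\<And>k. F k \<in> Lp p" "f \<in> Lp p" "Lp_tendsto p F f"
  shows "Lp_tendsto p (\<lambda>k. B (F k)) (B f)"
proof -
  obtain K where K: "\<And>f. f \<in> Lp p \<Longrightarrow> Lp_norm p (B f) \<le> K * Lp_norm p f"
    using bounded_linear_Lp_bound by blast
  show ?thesis
  proof (rule Lp_tendsto_squeeze)
    show "Lp_norm p (\<lambda>x. B (F k) x - B f x) \<le> K * Lp_norm p (\<lambda>x. F k x - f x)" for k
      unfolding bounded_linear_Lp_diff_norm[OF assms(1,2)] by (intro K Lp_diff p assms)
    show "(\<lambda>k. K * Lp_norm p (\<lambda>x. F k x - f x)) \<longlonglongrightarrow> 0"
      using assms(3) by (auto simp: Lp_tendsto_def intro: tendsto_mult_right_zero)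
  qed
qed

lemma bounded_linear_Lp_cong_AE:
  assumes "f \<in> Lp p" "g \<in> Lp p" "AE x in lborel. f x = g x"
  shows "AE x in lborel. B f x = B g x"
proof -
  have p0: "p > 0" using p by simp
  obtain K where K: "\<And>f. f \<in> Lp p \<Longrightarrow> Lp_norm p (B f) \<le> K * Lp_norm p f"
    using bounded_linear_Lp_bound by blast
  have "Lp_norm p (\<lambda>x. f x - g x) = 0"
    using assms(3) by (subst Lp_norm_eq_0_iff[OF p0 Lp_diff(1)[OF p assms(1,2)]]) simp
  with K[OF Lp_diff(1)[OF p assms(1,2)]] Lp_norm_nonneg
  have "Lp_norm p (B (\<lambda>x. f x - g x)) = 0" by (metis mult_zero_right order_antisym)
  then have "Lp_norm p (\<lambda>x. B f x - B g x) = 0"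
    by (simp add: bounded_linear_Lp_diff_norm assms)
  then show ?thesis
    using Lp_norm_eq_0_iff[OF p0 Lp_diff(1)[OF p], of "B f" "B g"] assms by (simp add: bounded_linear_Lp_mem)
qed

end

text \<open>Density of \<open>D\<close> comes from the truncations: \<open>B f\<close> is the limit
  of \<open>A (trunc k f)\<close>, which exists by completeness. As \<open>trunc\<close> is not
  linear, linearity of \<open>B\<close> needs the limit along other sequences in \<open>D\<close> as
  well; that is \<open>lim\<close>.\<close>

lemma bounded_extension_exists:
  fixes A :: "('a::euclidean_space \<Rightarrow> complex) \<Rightarrow> 'a \<Rightarrow> complex"
  assumes p: "p \<ge> 1" and D: "D \<subseteq> Lp p" and tr: "\<And>f k. f \<in> Lp p \<Longrightarrow> trunc k f \<in> D"
    and D_add: "\<And>f g. f \<in> D \<Longrightarrow> g \<in> D \<Longrightarrow> (\<lambda>x. f x + g x) \<in> D"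
    and D_cmult: "\<And>f c. f \<in> D \<Longrightarrow> (\<lambda>x. c * f x) \<in> D"
    and A_mem: "\<And>f. f \<in> D \<Longrightarrow> A f \<in> Lp p"
    and A_add: "\<And>f g. f \<in> D \<Longrightarrow> g \<in> D \<Longrightarrow> AE x in lborel. A (\<lambda>y. f y + g y) x = A f x + A g x"
    and A_cmult: "\<And>f c. f \<in> D \<Longrightarrow> AE x in lborel. A (\<lambda>y. c * f y) x = c * A f x"
    and A_bound: "\<And>f. f \<in> D \<Longrightarrow> Lp_norm p (A f) \<le> K * Lp_norm p f"
  shows "\<exists>B. bounded_extension p D A B"
proof -
  have p0: "p > 0" using p by simp
  have DL: "f \<in> D \<Longrightarrow> f \<in> Lp p" for f using D by blast
  have D_diff: "(\<lambda>x. f x - g x) \<in> D" if "f \<in> D" "g \<in> D" for f g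
    using D_add[OF that(1) D_cmult[OF that(2), of "-1"]] by simp
  have A_diff: "Lp_norm p (\<lambda>x. A f x - A g x) \<le> K * Lp_norm p (\<lambda>x. f x - g x)" if fg: "f \<in> D" "g \<in> D" for f g
  proof -
    note [measurable] = A_mem[OF fg(1)] A_mem[OF fg(2)] A_mem[OF D_diff[OF fg]]
    have "AE x in lborel. A (\<lambda>x. f x - g x) x = A f x - A g x"
      using A_add[OF fg(1) D_cmult[OF fg(2), of "-1"]] A_cmult[OF fg(2), of "-1"] by auto
    then have "Lp_norm p (\<lambda>x. A f x - A g x) = Lp_norm p (A (\<lambda>x. f x - g x))"
      by (intro Lp_norm_cong_AE) auto
    then show ?thesis using A_bound[OF D_diff[OF fg]] by simp
  qed
  have ex: "\<exists>h\<in>Lp p. Lp_tendsto p (\<lambda>k. A (trunc k f)) h" if f: "f \<in> Lp p" for f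
    unfolding Lp_tendsto_def
  proof (rule Lp_complete[OF p])
    show "A (trunc k f) \<in> Lp p" for k by (intro A_mem tr f)
    fix e :: real assume e: "e > 0"
    \<comment> \<open>\<open>K\<close> may be zero or negative; \<open>M\<close> is a positive bound
      that can be divided by.\<close>
    define M where "M = max K 1"
    have M: "M > 0" "K \<le> M" by (auto simp: M_def)
    have "\<forall>\<^sub>F k in sequentially. Lp_norm p (\<lambda>x. trunc k f x - f x) < e / (2 * M)"
      using trunc_Lp_tendsto[OF p f] e M unfolding Lp_tendsto_def by (intro order_tendstoD) auto
    then obtain N where N: "\<And>k. k \<ge> N \<Longrightarrow> Lp_norm p (\<lambda>x. trunc k f x - f x) < e / (2 * M)"
      by (auto simp: eventually_sequentially)
    have "Lp_norm p (\<lambda>x. A (trunc m f) x - A (trunc n f) x) \<le> e" if "m \<ge> N" "n \<ge> N" for m n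
    proof -
      have "Lp_norm p (\<lambda>x. A (trunc m f) x - A (trunc n f) x) \<le> K * Lp_norm p (\<lambda>x. trunc m f x - trunc n f x)"
        by (intro A_diff tr f)
      also have "\<dots> \<le> M * Lp_norm p (\<lambda>x. trunc m f x - trunc n f x)"
        by (intro mult_right_mono M) auto
      also have "\<dots> \<le> M * (e / (2 * M) + e / (2 * M))"
      proof (intro mult_left_mono)
        have "Lp_norm p (\<lambda>x. trunc m f x - trunc n f x)
          \<le> Lp_norm p (\<lambda>x. trunc m f x - f x) + Lp_norm p (\<lambda>x. f x - trunc n f x)"
          by (intro Lp_triangle p f trunc_in_Lp p0 Lp_measurable[OF f])
        then show "Lp_norm p (\<lambda>x. trunc m f x - trunc n f x) \<le> e / (2 * M) + e / (2 * M)"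
          using N[OF that(1)] N[OF that(2)] by (simp add: Lp_norm_minus_commute[of p f])
      qed (use M in simp)
      also have "\<dots> = e" using M by (simp add: field_simps)
      finally show ?thesis .
    qed
    then show "\<exists>N. \<forall>m\<ge>N. \<forall>n\<ge>N. Lp_norm p (\<lambda>x. A (trunc m f) x - A (trunc n f) x) \<le> e" by blast
  qed
  then obtain B where B: "\<And>f. f \<in> Lp p \<Longrightarrow> B f \<in> Lp p"
      "\<And>f. f \<in> Lp p \<Longrightarrow> Lp_tendsto p (\<lambda>k. A (trunc k f)) (B f)"
    by metis
  \<comment> \<open>Every sequence in \<open>D\<close> converging to \<open>f\<close> gives the same
    limit as the truncations of \<open>f\<close>. Sums and multiples of truncations are such
    sequences, and so is a constant sequence, which gives \<open>B f = A f\<close> on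
    \<open>D\<close>.\<close>
  have lim: "Lp_tendsto p (\<lambda>k. A (F k)) (B f)" if F: "\<And>k. F k \<in> D" and f: "f \<in> Lp p" and l: "Lp_tendsto p F f" for F f
  proof (rule Lp_tendsto_squeeze)
    have AL: "A (F k) \<in> Lp p" "A (trunc k f) \<in> Lp p" for k
      using A_mem F tr f by blast+
    show "Lp_norm p (\<lambda>x. A (F k) x - B f x) \<le> \<bar>K\<bar> * (Lp_norm p (\<lambda>x. F k x - f x) + Lp_norm p (\<lambda>x. trunc k f x - f x))
        + Lp_norm p (\<lambda>x. A (trunc k f) x - B f x)" for k
    proof -
      have "Lp_norm p (\<lambda>x. A (F k) x - A (trunc k f) x) \<le> K * Lp_norm p (\<lambda>x. F k x - trunc k f x)"
        by (intro A_diff F tr f)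
      also have "\<dots> \<le> \<bar>K\<bar> * Lp_norm p (\<lambda>x. F k x - trunc k f x)" by (intro mult_right_mono) auto
      also have "\<dots> \<le> \<bar>K\<bar> * (Lp_norm p (\<lambda>x. F k x - f x) + Lp_norm p (\<lambda>x. f x - trunc k f x))"
        by (intro mult_left_mono Lp_triangle p DL F tr f) auto
      finally show ?thesis
        using Lp_triangle[OF p AL B(1)[OF f], of k k] by (simp add: Lp_norm_minus_commute[of p f])
    qed
    show "(\<lambda>k. \<bar>K\<bar> * (Lp_norm p (\<lambda>x. F k x - f x) + Lp_norm p (\<lambda>x. trunc k f x - f x))
        + Lp_norm p (\<lambda>x. A (trunc k f) x - B f x)) \<longlonglongrightarrow> 0"
      using l trunc_Lp_tendsto[OF p f] B(2)[OF f] unfolding Lp_tendsto_def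
      by (auto intro!: tendsto_eq_intros)
  qed
  have trL: "f \<in> Lp p \<Longrightarrow> trunc k f \<in> Lp p" for f :: "'a \<Rightarrow> complex" and k using DL tr by blast
  have B_add: "AE x in lborel. B (\<lambda>y. f y + g y) x = B f x + B g x" if fg: "f \<in> Lp p" "g \<in> Lp p" for f g
  proof (rule Lp_tendsto_unique[OF p])
    let ?F = "\<lambda>k x. trunc k f x + trunc k g x"
    have FD: "?F k \<in> D" for k by (intro D_add tr fg)
    show "Lp_tendsto p (\<lambda>k. A (?F k)) (B (\<lambda>y. f y + g y))"
      by (intro lim FD Lp_add p fg Lp_tendsto_add trL trunc_Lp_tendsto)
    show "A (?F k) \<in> Lp p" for k using FD A_mem by blast
    show "Lp_tendsto p (\<lambda>k. A (?F k)) (\<lambda>x. B f x + B g x)"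
    proof (rule Lp_tendsto_cong_AE)
      show "Lp_tendsto p (\<lambda>k x. A (trunc k f) x + A (trunc k g) x) (\<lambda>x. B f x + B g x)"
        by (intro Lp_tendsto_add p A_mem tr fg B)
      show "AE x in lborel. A (trunc k f) x + A (trunc k g) x = A (?F k) x" for k
        using A_add[OF tr[OF fg(1)] tr[OF fg(2)], of k k] by auto
      show "A (?F k) \<in> borel_measurable borel" for k by (intro Lp_measurable[of _ p] A_mem FD)
      show "(\<lambda>x. A (trunc k f) x + A (trunc k g) x) \<in> borel_measurable borel" for k
        by (intro borel_measurable_add Lp_measurable[of _ p] A_mem tr fg)
    qed (intro AE_I2 refl borel_measurable_add Lp_measurable[of _ p] B fg)+
  qed (auto intro!: B Lp_add p fg)
  have B_cmult: "AE x in lborel. B (\<lambda>y. c * f y) x = c * B f x" if f: "f \<in> Lp p" for f c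
  proof (rule Lp_tendsto_unique[OF p])
    let ?F = "\<lambda>k x. c * trunc k f x"
    have FD: "?F k \<in> D" for k by (intro D_cmult tr f)
    show "Lp_tendsto p (\<lambda>k. A (?F k)) (B (\<lambda>y. c * f y))"
      by (intro lim FD Lp_cmult p0 f Lp_tendsto_cmult p trL trunc_Lp_tendsto)
    show "A (?F k) \<in> Lp p" for k using FD A_mem by blast
    show "Lp_tendsto p (\<lambda>k. A (?F k)) (\<lambda>x. c * B f x)"
    proof (rule Lp_tendsto_cong_AE)
      show "Lp_tendsto p (\<lambda>k x. c * A (trunc k f) x) (\<lambda>x. c * B f x)"
        by (intro Lp_tendsto_cmult p A_mem tr f B)
      show "AE x in lborel. c * A (trunc k f) x = A (?F k) x" for k
        using A_cmult[OF tr[OF f], of c k] by auto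
      show "A (?F k) \<in> borel_measurable borel" for k by (intro Lp_measurable[of _ p] A_mem FD)
      show "(\<lambda>x. c * A (trunc k f) x) \<in> borel_measurable borel" for k
        by (intro borel_measurable_times borel_measurable_const Lp_measurable[of _ p] A_mem tr f)
    qed (intro AE_I2 refl borel_measurable_times borel_measurable_const Lp_measurable[of _ p] B f)+
  qed (auto intro!: B Lp_cmult p0 f)
  have B_bound: "Lp_norm p (B f) \<le> K * Lp_norm p f" if f: "f \<in> Lp p" for f
  proof (rule LIMSEQ_le)
    show "(\<lambda>k. Lp_norm p (A (trunc k f))) \<longlonglongrightarrow> Lp_norm p (B f)"
      by (intro Lp_tendsto_norm p A_mem tr f B)
    show "(\<lambda>k. K * Lp_norm p (trunc k f)) \<longlonglongrightarrow> K * Lp_norm p f"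
      by (intro tendsto_mult tendsto_const Lp_tendsto_norm p trL f trunc_Lp_tendsto)
    show "\<exists>N. \<forall>k\<ge>N. Lp_norm p (A (trunc k f)) \<le> K * Lp_norm p (trunc k f)"
      using A_bound[OF tr[OF f]] by auto
  qed
  have "AE x in lborel. B f x = A f x" if f: "f \<in> D" for f
    by (rule Lp_tendsto_unique[OF p _ _ _ lim[of "\<lambda>k. f"] Lp_tendsto_const])
       (auto intro: B A_mem f DL Lp_tendsto_const)
  then have "bounded_extension p D A B"
    unfolding bounded_extension_def bounded_linear_Lp_def
    using B(1) B_add B_cmult B_bound by blast
  then show ?thesis by blast
qed

lemma integrable_iff_Lp1: "integrable lborel f \<longleftrightarrow> f \<in> Lp 1"
  by (auto simp: Lp_iff integrable_norm_iff)

section \<open>Affine changes of variables in Lebesgue integrals\<close>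

lemma lborel_affine_integral:
  fixes f :: "'a::euclidean_space \<Rightarrow> 'b::{banach, second_countable_topology}"
  assumes [measurable]: "f \<in> borel_measurable borel" and c: "c \<noteq> 0"
  shows "(\<integral>x. f x \<partial>lborel) = \<bar>c\<bar> ^ DIM('a) *\<^sub>R (\<integral>x. f (t + c *\<^sub>R x) \<partial>lborel)"
  by (subst lborel_affine[OF c, of t]) (simp add: integral_density integral_distr)

lemma lborel_affine_integrable:
  fixes f :: "'a::euclidean_space \<Rightarrow> 'b::{banach, second_countable_topology}"
  assumes [measurable]: "f \<in> borel_measurable borel" and c: "c \<noteq> 0"
  shows "integrable lborel (\<lambda>x. f (t + c *\<^sub>R x)) \<longleftrightarrow> integrable lborel f"
proof -
  have "integrable lborel f \<longleftrightarrow> integrable lborel (\<lambda>x. \<bar>c\<bar> ^ DIM('a) *\<^sub>R f (t + c *\<^sub>R x))"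
    by (subst lborel_affine[OF c, of t]) (simp add: integrable_density integrable_distr_eq)
  then show ?thesis
    using c integrable_scaleR_right[of "1 / \<bar>c\<bar> ^ DIM('a)" lborel "\<lambda>x. \<bar>c\<bar> ^ DIM('a) *\<^sub>R f (t + c *\<^sub>R x)"]
    by auto
qed

lemma
  fixes f :: "'a::euclidean_space \<Rightarrow> 'b::{banach, second_countable_topology}"
  assumes [measurable]: "f \<in> borel_measurable borel"
  shows lborel_integral_reflect: "(\<integral>x. f (t - x) \<partial>lborel) = (\<integral>x. f x \<partial>lborel)"
    and lborel_integrable_reflect: "integrable lborel (\<lambda>x. f (t - x)) \<longleftrightarrow> integrable lborel f"
    and lborel_integral_shift: "(\<integral>x. f (x - t) \<partial>lborel) = (\<integral>x. f x \<partial>lborel)"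
    and lborel_integrable_shift: "integrable lborel (\<lambda>x. f (x - t)) \<longleftrightarrow> integrable lborel f"
  using lborel_affine_integral[of f "-1" t] lborel_affine_integrable[of f "-1" t]
    lborel_affine_integral[of f 1 "-t"] lborel_affine_integrable[of f 1 "-t"] by auto

section \<open>Gaussians\<close>

text \<open>Up to the substitution \<open>y = sqrt t * x\<close> this is the characteristic function
  of the standard normal law.\<close>

lemma Gaussian_integral_real:
  assumes t: "t > 0"
  shows "integrable lborel (\<lambda>x::real. exp (\<i> * of_real (u * x)) * of_real (exp (- t * x\<^sup>2 / 2)))" (is ?I)
    and "(\<integral>x. exp (\<i> * of_real (u * x)) * of_real (exp (- t * x\<^sup>2 / 2)) \<partial>(lborel :: real measure))
        = of_real (sqrt (2 * pi / t) * exp (- u\<^sup>2 / (2 * t)))" (is ?E)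
proof -
  define s where "s = u / sqrt t"
  define f where "f y = iexp (s * y) * of_real (exp (- y\<^sup>2 / 2))" for y :: real
  have [measurable]: "f \<in> borel_measurable borel" unfolding f_def[abs_def] by measurable
  have f: "f y = of_real (sqrt (2 * pi)) * (std_normal_density y *\<^sub>R iexp (s * y))" for y
    by (simp add: f_def std_normal_density_def scaleR_conv_of_real)
  have "integrable lborel (\<lambda>y. std_normal_density y *\<^sub>R iexp (s * y))"
    by (rule Bochner_Integration.integrable_bound[of _ std_normal_density]) auto
  then have If: "integrable lborel f" unfolding f by (intro integrable_mult_right)
  have "(\<integral>y. std_normal_density y *\<^sub>R iexp (s * y) \<partial>lborel) = char std_normal_distribution s"
    unfolding char_def by (subst integral_density) (auto simp: mult.commute)
  also have "\<dots> = of_real (exp (- s\<^sup>2 / 2))"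
    by (simp add: char_std_normal_distribution)
  finally have Ef: "(\<integral>y. f y \<partial>lborel) = of_real (sqrt (2 * pi) * exp (- s\<^sup>2 / 2))"
    by (simp only: f integral_mult_right_zero of_real_mult)
  have fx: "f (0 + sqrt t *\<^sub>R x) = exp (\<i> * of_real (u * x)) * of_real (exp (- t * x\<^sup>2 / 2))" for x
    using t by (simp add: f_def s_def power_mult_distrib)
  show ?I
    using lborel_affine_integrable[of f "sqrt t" 0] If t unfolding fx by simp
  have "of_real (sqrt (2 * pi) * exp (- s\<^sup>2 / 2)) =
     sqrt t *\<^sub>R (\<integral>x. exp (\<i> * of_real (u * x)) * of_real (exp (- t * x\<^sup>2 / 2)) \<partial>(lborel :: real measure))"
    using lborel_affine_integral[of f "sqrt t" 0] t unfolding fx Ef by simp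
  moreover have "s\<^sup>2 = u\<^sup>2 / t" using t by (simp add: s_def power_divide)
  ultimately show ?E
    using t by (simp add: scaleR_conv_of_real real_sqrt_divide field_simps)
qed

text \<open>Symbol of the heat semigroup at time \<open>t / 2\<close>. The factor 1/2 makes
  \<open>gauss t\<close> the density of the centred normal law with variance \<open>t\<close> in
  each coordinate, and \<open>gsym t\<close> its characteristic function.\<close>

definition gsym :: "real \<Rightarrow> 'a::euclidean_space \<Rightarrow> real" where
  "gsym t \<xi> = exp (- t * (norm \<xi>)\<^sup>2 / 2)"

definition gauss :: "real \<Rightarrow> 'a::euclidean_space \<Rightarrow> real" where
  "gauss t x = (2 * pi * t) powr (- real DIM('a) / 2) * gsym (1 / t) x"

lemma gsym_measurable [measurable]: "gsym t \<in> borel_measurable borel"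
  unfolding gsym_def[abs_def] by measurable

lemma gauss_measurable [measurable]: "gauss t \<in> borel_measurable borel"
  unfolding gauss_def[abs_def] by measurable

lemma gsym_pos [simp]: "gsym t x > 0"
  by (simp add: gsym_def)

lemma gsym_le_1: "t \<ge> 0 \<Longrightarrow> gsym t x \<le> 1"
  by (simp add: gsym_def)

lemma gauss_nonneg [simp]: "gauss t x \<ge> 0"
  by (simp add: gauss_def less_imp_le)

lemma gauss_minus_commute: "gauss t (x - y) = gauss t (y - x)"
  by (simp add: gauss_def gsym_def norm_minus_commute)

lemma gauss_le: "t > 0 \<Longrightarrow> gauss t (x :: 'a::euclidean_space) \<le> (2 * pi * t) powr (- real DIM('a) / 2)"
  using gsym_le_1[of "1/t" x] by (simp add: gauss_def mult_left_le)

text \<open>Phase and Gaussian are both products over the coordinates, so the integral over the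
  product measure splits into one-dimensional ones.\<close>

lemma gsym_Fourier:
  fixes x :: "'a::euclidean_space"
  assumes t: "t > 0"
  shows "integrable lborel (\<lambda>\<xi>. exp (\<i> * of_real (x \<bullet> \<xi>)) * of_real (gsym t \<xi>))" (is ?I)
    and "(\<integral>\<xi>. exp (\<i> * of_real (x \<bullet> \<xi>)) * of_real (gsym t \<xi>) \<partial>lborel)
          = of_real ((2 * pi / t) powr (real DIM('a) / 2) * gsym (1 / t) x)" (is ?E)
proof -
  interpret product_sigma_finite "\<lambda>b::'a. lborel :: real measure" by standard
  define h where "h b y = exp (\<i> * of_real ((x \<bullet> b) * y)) * complex_of_real (exp (- t * y\<^sup>2 / 2))" for b :: 'a and y :: real
  define G where "G \<xi> = exp (\<i> * of_real (x \<bullet> \<xi>)) * complex_of_real (gsym t \<xi>)" for \<xi> :: 'a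
  have [measurable]: "G \<in> borel_measurable borel" unfolding G_def[abs_def] by measurable
  have G: "G (\<Sum>b\<in>Basis. f b *\<^sub>R b) = (\<Prod>b\<in>Basis. h b (f b))" for f :: "'a \<Rightarrow> real"
  proof -
    have "(norm (\<Sum>b\<in>Basis. f b *\<^sub>R b))\<^sup>2 = (\<Sum>b\<in>Basis. (f b)\<^sup>2)"
      by (subst power2_norm_eq_inner, subst euclidean_inner)
         (auto simp: power2_eq_square inner_sum_left_Basis intro!: sum.cong)
    then have "gsym t (\<Sum>b\<in>Basis. f b *\<^sub>R b) = (\<Prod>b\<in>Basis. exp (- t * (f b)\<^sup>2 / 2))"
      by (simp add: gsym_def exp_sum[symmetric] sum_distrib_left sum_negf sum_divide_distrib)
    moreover have "exp (\<i> * of_real (x \<bullet> (\<Sum>b\<in>Basis. f b *\<^sub>R b))) = (\<Prod>b\<in>Basis. exp (\<i> * of_real ((x \<bullet> b) * f b)))"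
      by (simp add: inner_sum_right exp_sum[symmetric] sum_distrib_left mult.commute mult.left_commute)
    ultimately show ?thesis unfolding G_def h_def by (simp add: prod.distrib)
  qed
  have Ih: "integrable lborel (h b)" and
    Eh: "integral\<^sup>L lborel (h b) = of_real (sqrt (2 * pi / t) * exp (- (x \<bullet> b)\<^sup>2 / (2 * t)))" for b
    using Gaussian_integral_real[OF t, of "x \<bullet> b"] by (simp_all add: h_def[abs_def])
  have meas: "(\<lambda>f. \<Sum>b\<in>Basis. f b *\<^sub>R b) \<in> (\<Pi>\<^sub>M b\<in>Basis. lborel) \<rightarrow>\<^sub>M (borel :: 'a measure)"
    by measurable
  have "integrable lborel G"
    by (subst lborel_eq, subst integrable_distr_eq[OF meas])
       (auto simp: G intro!: product_integrable_prod Ih)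
  then show ?I by (simp add: G_def[abs_def])
  have "integral\<^sup>L lborel G = (\<Prod>b\<in>Basis. integral\<^sup>L lborel (h b))"
    by (subst lborel_eq, subst integral_distr[OF meas])
       (auto simp: G intro!: product_integral_prod Ih)
  also have "\<dots> = of_real (\<Prod>b\<in>(Basis::'a set). sqrt (2 * pi / t) * exp (- (x \<bullet> b)\<^sup>2 / (2 * t)))"
    by (simp add: Eh)
  also have "(\<Prod>b\<in>(Basis::'a set). sqrt (2 * pi / t) * exp (- (x \<bullet> b)\<^sup>2 / (2 * t)))
     = sqrt (2 * pi / t) ^ DIM('a) * exp (\<Sum>b\<in>Basis. - (x \<bullet> b)\<^sup>2 / (2 * t))"
    by (simp add: prod.distrib exp_sum)
  also have "(\<Sum>b\<in>Basis. - (x \<bullet> b)\<^sup>2 / (2 * t)) = - (1 / t) * (norm x)\<^sup>2 / 2"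
    unfolding power2_norm_eq_inner euclidean_inner[of x x]
    by (simp add: power2_eq_square sum_divide_distrib sum_negf mult.commute)
  also have "sqrt (2 * pi / t) ^ DIM('a) = (2 * pi / t) powr (real DIM('a) / 2)"
    using t by (simp add: powr_half_sqrt[symmetric] powr_powr powr_realpow[symmetric])
  finally show ?E by (simp add: G_def[abs_def] gsym_def)
qed

lemma gsym_integrable:
  assumes "t > 0"
  shows "integrable lborel (gsym t :: 'a::euclidean_space \<Rightarrow> real)"
  using integrable_norm[OF gsym_Fourier(1)[OF assms, of 0]] by (simp add: abs_of_pos[OF gsym_pos])

lemma gsym_Fourier_gauss:
  fixes x :: "'a::euclidean_space"
  assumes t: "t > 0"
  shows "(\<integral>\<xi>. exp (\<i> * of_real (x \<bullet> \<xi>)) * of_real (gsym t \<xi>) \<partial>lborel) = of_real ((2 * pi) powr real DIM('a) * gauss t x)"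
proof -
  have "(2 * pi / t) powr (real DIM('a) / 2) = (2 * pi) powr real DIM('a) * (2 * pi * t) powr (- real DIM('a) / 2)"
  proof -
    have "(c / t) powr a = c powr (2 * a) * (c * t) powr - a" if "c > 0" for c a :: real
    proof -
      have "c powr (2 * a) * (c powr - a * t powr - a) = c powr a * t powr - a"
        by (simp add: powr_add[symmetric] mult.assoc[symmetric])
      moreover have "(c * t) powr - a = c powr - a * t powr - a" "(c / t) powr a = c powr a * t powr - a"
        using t that by (simp_all only: powr_mult powr_divide powr_minus divide_inverse inverse_mult_distrib inverse_powr)
      ultimately show ?thesis by (simp only:)
    qed
    from this[of "2 * pi" "real DIM('a) / 2"] show ?thesis by simp
  qed
  then show ?thesis by (simp add: gsym_Fourier(2)[OF t] gauss_def)
qed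

lemma
  assumes t: "t > 0"
  shows gauss_integrable: "integrable lborel (gauss t :: 'a::euclidean_space \<Rightarrow> real)"
    and gauss_integral: "(\<integral>x. gauss t x \<partial>(lborel :: 'a measure)) = 1"
proof -
  show "integrable lborel (gauss t :: 'a \<Rightarrow> real)"
    unfolding gauss_def[abs_def] using t by (intro integrable_mult_right gsym_integrable) simp
  have "complex_of_real (\<integral>x. gsym (1/t) x \<partial>(lborel :: 'a measure)) = of_real ((2 * pi * t) powr (real DIM('a) / 2))"
    using gsym_Fourier(2)[of "1/t" "0::'a"] t by (simp add: gsym_def)
  then have "(\<integral>x. gsym (1/t) x \<partial>(lborel :: 'a measure)) = (2 * pi * t) powr (real DIM('a) / 2)"
    using of_real_eq_iff by blast
  then show "(\<integral>x. gauss t x \<partial>(lborel :: 'a measure)) = 1"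
    unfolding gauss_def[abs_def] using t by (simp add: powr_minus)
qed

lemma
  assumes "t > 0"
  shows gauss_integrable_reflect: "integrable lborel (\<lambda>y. gauss t (x - y))"
    and gauss_integral_reflect: "(\<integral>y. gauss t (x - y) \<partial>lborel) = 1"
    and gauss_integrable_shift: "integrable lborel (\<lambda>y. gauss t (y - x))"
    and gauss_integral_shift: "(\<integral>y. gauss t (y - x) \<partial>lborel) = 1"
  using assms by (simp_all add: lborel_integral_reflect lborel_integrable_reflect lborel_integral_shift
    lborel_integrable_shift gauss_integrable gauss_integral)

section \<open>Convolution with Gaussian kernels\<close>

definition gconv :: "real \<Rightarrow> ('a::euclidean_space \<Rightarrow> 'b::{banach, second_countable_topology}) \<Rightarrow> 'a \<Rightarrow> 'b" where
  "gconv t f x = (\<integral>y. gauss t (x - y) *\<^sub>R f y \<partial>lborel)"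

lemma gconv_measurable [measurable]:
  assumes [measurable]: "f \<in> borel_measurable borel"
  shows "gconv t f \<in> borel_measurable borel"
  unfolding gconv_def[abs_def] by measurable

lemma gauss_mult_integrable:
  fixes f :: "'a::euclidean_space \<Rightarrow> 'b::{banach, second_countable_topology}"
  assumes t: "t > 0" and f: "integrable lborel f"
  shows "integrable lborel (\<lambda>y. gauss t (x - y) *\<^sub>R f y)"
proof (rule Bochner_Integration.integrable_bound)
  show "integrable lborel (\<lambda>y. (2 * pi * t) powr (- real DIM('a) / 2) *\<^sub>R f y)"
    using f by (intro integrable_scaleR_right)
  show "AE y in lborel. norm (gauss t (x - y) *\<^sub>R f y) \<le> norm ((2 * pi * t) powr (- real DIM('a) / 2) *\<^sub>R f y)"
    using gauss_le[OF t] by (intro AE_I2) (auto intro!: mult_right_mono)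
  show "(\<lambda>y. gauss t (x - y) *\<^sub>R f y) \<in> borel_measurable lborel"
    using borel_measurable_integrable[OF f] by measurable
qed

text \<open>Fubini, the kernel having total mass 1 in \<open>x\<close> as well as in
  \<open>y\<close>. Applied to \<open>norm (f y) powr p\<close>, this turns the pointwise bound that
  follows into contractivity on \<open>Lp p\<close>.\<close>

lemma gconv_integral:
  fixes f :: "'a::euclidean_space \<Rightarrow> 'b::{banach, second_countable_topology}"
  assumes t: "t > 0" and f: "integrable lborel f"
  shows "integrable lborel (gconv t f)" "(\<integral>x. gconv t f x \<partial>lborel) = (\<integral>x. f x \<partial>lborel)"
proof -
  have [measurable]: "f \<in> borel_measurable borel" using borel_measurable_integrable[OF f] by simp
  have I: "integrable (lborel \<Otimes>\<^sub>M lborel) (\<lambda>(y, x). gauss t (x - y) *\<^sub>R f y)"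
  proof (rule lborel_pair.Fubini_integrable)
    have "(\<lambda>y. \<integral>x. norm (case (y, x) of (y, x) \<Rightarrow> gauss t (x - y) *\<^sub>R f y) \<partial>lborel) = (\<lambda>y. norm (f y))"
      using t by (simp add: gauss_integral_shift)
    then show "integrable lborel (\<lambda>y. \<integral>x. norm (case (y, x) of (y, x) \<Rightarrow> gauss t (x - y) *\<^sub>R f y) \<partial>lborel)"
      using f by simp
    show "AE y in lborel. integrable lborel (\<lambda>x. case (y, x) of (y, x) \<Rightarrow> gauss t (x - y) *\<^sub>R f y)"
      using t by (intro AE_I2) (simp add: gauss_integrable_shift)
  qed measurable
  have "integrable lborel (\<lambda>x. \<integral>y. gauss t (x - y) *\<^sub>R f y \<partial>lborel)"
    using lborel_pair.integrable_snd[OF I] .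
  then show "integrable lborel (gconv t f)" by (simp add: gconv_def[abs_def])
  show "(\<integral>x. gconv t f x \<partial>lborel) = (\<integral>x. f x \<partial>lborel)"
    unfolding gconv_def using lborel_pair.Fubini_integral[OF I] t
    by (simp add: gauss_integral_shift gauss_integrable_shift)
qed

text \<open>Jensen's inequality for the probability density \<open>gauss t (x - y)\<close> in
  \<open>y\<close>: the tangent to the power at \<open>a\<close>, the mean of the norm of
  \<open>f\<close>, is integrated against it. Integrability of \<open>f\<close> makes this mean
  finite.\<close>

lemma gconv_norm_powr_le:
  fixes f :: "'a::euclidean_space \<Rightarrow> 'b::{banach, second_countable_topology}"
  assumes t: "t > 0" and p: "p \<ge> 1" and f: "integrable lborel f" and fp: "f \<in> Lp p"
  shows "norm (gconv t f x) powr p \<le> gconv t (\<lambda>y. norm (f y) powr p) x"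
proof -
  define a where "a = (\<integral>y. gauss t (x - y) * norm (f y) \<partial>lborel)"
  have a0: "a \<ge> 0" unfolding a_def by (rule integral_nonneg_AE) auto
  have Ia: "integrable lborel (\<lambda>y. gauss t (x - y) * norm (f y))"
    using gauss_mult_integrable[OF t integrable_norm[OF f], of x] by simp
  have Ip: "integrable lborel (\<lambda>y. gauss t (x - y) * norm (f y) powr p)"
    using gauss_mult_integrable[OF t Lp_integrable[OF fp], of x] by simp
  have "norm (gconv t f x) \<le> a"
    unfolding gconv_def a_def by (rule order_trans[OF integral_norm_bound]) simp
  then have "norm (gconv t f x) powr p \<le> a powr p" using p by (intro powr_mono2) auto
  also have "\<dots> \<le> (\<integral>y. gauss t (x - y) * norm (f y) powr p \<partial>lborel)"
  proof (cases "a = 0")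
    case True
    then show ?thesis using p by (auto intro!: integral_nonneg_AE)
  next
    case False
    then have a: "a > 0" using a0 by simp
    define d where "d = p * a powr (p - 1)"
    have Il: "integrable lborel (\<lambda>y. (a powr p - d * a) * gauss t (x - y) + d * (gauss t (x - y) * norm (f y)))"
      by (intro Bochner_Integration.integrable_add integrable_mult_right Ia gauss_integrable_reflect t)
    have "(\<integral>y. (a powr p - d * a) * gauss t (x - y) + d * (gauss t (x - y) * norm (f y)) \<partial>lborel) = a powr p"
      using t by (subst Bochner_Integration.integral_add)
        (auto intro!: integrable_mult_right Ia gauss_integrable_reflect simp: gauss_integral_reflect a_def[symmetric])
    moreover have "(\<integral>y. (a powr p - d * a) * gauss t (x - y) + d * (gauss t (x - y) * norm (f y)) \<partial>lborel)
      \<le> (\<integral>y. gauss t (x - y) * norm (f y) powr p \<partial>lborel)"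
    proof (rule integral_mono[OF Il Ip])
      fix y
      have "gauss t (x - y) * (a powr p + d * (norm (f y) - a)) \<le> gauss t (x - y) * norm (f y) powr p"
        using powr_ge_tangent[OF p a, of "norm (f y)"] by (intro mult_left_mono) (auto simp: d_def)
      then show "(a powr p - d * a) * gauss t (x - y) + d * (gauss t (x - y) * norm (f y))
          \<le> gauss t (x - y) * norm (f y) powr p"
        by (simp add: algebra_simps)
    qed
    ultimately show ?thesis by simp
  qed
  finally show ?thesis by (simp add: gconv_def)
qed

lemma gconv_Lp:
  fixes f :: "'a::euclidean_space \<Rightarrow> 'b::{banach, second_countable_topology}"
  assumes t: "t > 0" and p: "p \<ge> 1" and f: "integrable lborel f" and fp: "f \<in> Lp p"
  shows "gconv t f \<in> Lp p" "Lp_norm p (gconv t f) \<le> Lp_norm p f"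
proof -
  note [measurable] = fp
  have J: "integrable lborel (gconv t (\<lambda>y. norm (f y) powr p))"
    by (rule gconv_integral(1)[OF t Lp_integrable[OF fp]])
  have I: "integrable lborel (\<lambda>x. norm (gconv t f x) powr p)"
    by (rule Bochner_Integration.integrable_bound[OF J])
       (auto intro!: AE_I2 order_trans[OF _ abs_ge_self] gconv_norm_powr_le[OF t p f fp])
  then show "gconv t f \<in> Lp p" by (simp add: Lp_iff)
  have "(\<integral>x. norm (gconv t f x) powr p \<partial>lborel) \<le> (\<integral>x. gconv t (\<lambda>y. norm (f y) powr p) x \<partial>lborel)"
    by (intro integral_mono I J gconv_norm_powr_le[OF t p f fp])
  also have "\<dots> = (\<integral>x. norm (f x) powr p \<partial>lborel)"
    by (rule gconv_integral(2)[OF t Lp_integrable[OF fp]])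
  finally show "Lp_norm p (gconv t f) \<le> Lp_norm p f"
    using p by (subst Lp_norm_le_iff) (auto simp: Lp_norm_powr)
qed

text \<open>The substitution \<open>y = x - sqrt s *\<^sub>R z\<close> moves the parameter from the
  kernel into the argument of \<open>f\<close>; with the kernel fixed, continuity and boundedness of
  \<open>f\<close> allow dominated convergence.\<close>

lemma gconv_tendsto:
  fixes f :: "'a::euclidean_space \<Rightarrow> 'b::{banach, second_countable_topology}"
  assumes cont: "continuous_on UNIV f" and bd: "\<And>x. norm (f x) \<le> B"
    and t: "\<And>k. t k > 0" "t \<longlonglongrightarrow> 0"
  shows "(\<lambda>k. gconv (t k) f x) \<longlonglongrightarrow> f x"
proof -
  have [measurable]: "f \<in> borel_measurable borel"
    by (rule borel_measurable_continuous_onI[OF cont])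
  have eq: "gconv s f x = (\<integral>z. gauss 1 z *\<^sub>R f (x + - sqrt s *\<^sub>R z) \<partial>lborel)" if s: "s > 0" for s
  proof -
    have "gconv s f x = sqrt s ^ DIM('a) *\<^sub>R (\<integral>z. gauss s (sqrt s *\<^sub>R z) *\<^sub>R f (x + - sqrt s *\<^sub>R z) \<partial>lborel)"
      unfolding gconv_def using s by (subst lborel_affine_integral[of _ "- sqrt s" x]) auto
    also have "\<dots> = (\<integral>z. (sqrt s ^ DIM('a) * gauss s (sqrt s *\<^sub>R z)) *\<^sub>R f (x + - sqrt s *\<^sub>R z) \<partial>lborel)"
      by (simp flip: integral_scaleR_right scaleR_scaleR)
    also have "(\<lambda>z::'a. sqrt s ^ DIM('a) * gauss s (sqrt s *\<^sub>R z)) = gauss 1"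
    proof
      fix z :: 'a
      have "sqrt s ^ DIM('a) = s powr (real DIM('a) / 2)"
        using s by (simp add: powr_half_sqrt[symmetric] powr_powr powr_realpow[symmetric])
      then show "sqrt s ^ DIM('a) * gauss s (sqrt s *\<^sub>R z) = gauss 1 z"
        using s by (simp add: gauss_def gsym_def power_mult_distrib powr_mult powr_minus)
    qed
    finally show ?thesis .
  qed
  have I: "integrable lborel (\<lambda>z::'a. B * gauss 1 z)"
    by (intro integrable_mult_right gauss_integrable) simp
  have "(\<lambda>k. \<integral>z. gauss 1 z *\<^sub>R f (x + - sqrt (t k) *\<^sub>R z) \<partial>lborel) \<longlonglongrightarrow> (\<integral>z. gauss 1 z *\<^sub>R f x \<partial>(lborel :: 'a measure))"
  proof (rule integral_dominated_convergence[where w = "\<lambda>z. B * gauss 1 z"])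
    show "AE z in lborel. (\<lambda>k. gauss 1 z *\<^sub>R f (x + - sqrt (t k) *\<^sub>R z)) \<longlonglongrightarrow> gauss 1 z *\<^sub>R f x"
    proof (intro AE_I2 tendsto_scaleR tendsto_const)
      fix z
      have "(\<lambda>k. x + - sqrt (t k) *\<^sub>R z) \<longlonglongrightarrow> x + - sqrt 0 *\<^sub>R z"
        by (intro tendsto_intros t)
      then have l: "(\<lambda>k. x + - sqrt (t k) *\<^sub>R z) \<longlonglongrightarrow> x" by simp
      show "(\<lambda>k. f (x + - sqrt (t k) *\<^sub>R z)) \<longlonglongrightarrow> f x"
        using cont by (intro isCont_tendsto_compose[OF _ l]) (simp add: continuous_on_eq_continuous_at)
    qed
    show "AE z in lborel. norm (gauss 1 z *\<^sub>R f (x + - sqrt (t k) *\<^sub>R z)) \<le> B * gauss 1 z" for k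
    proof (rule AE_I2)
      fix z
      show "norm (gauss 1 z *\<^sub>R f (x + - sqrt (t k) *\<^sub>R z)) \<le> B * gauss 1 z"
        using mult_right_mono[OF bd[of "x + - sqrt (t k) *\<^sub>R z"] gauss_nonneg[of 1 z]] by (simp add: mult.commute)
    qed
  qed (use I in auto)
  moreover have "(\<integral>z. gauss 1 z *\<^sub>R f x \<partial>(lborel :: 'a measure)) = f x"
    by (subst integral_scaleR_left) (simp_all add: gauss_integrable gauss_integral)
  ultimately show ?thesis using t by (simp add: eq)
qed

section \<open>The Fourier transform on $L^2$\<close>

text \<open>Both signs of the phase are treated at once: \<open>s = -1\<close> gives the transform and \<open>s = 1\<close> its inverse.\<close>

definition fint :: "real \<Rightarrow> ('a::euclidean_space \<Rightarrow> complex) \<Rightarrow> 'a \<Rightarrow> complex" where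
  "fint s f \<xi> = of_real ((2 * pi) powr (- real DIM('a) / 2)) * (\<integral>x. exp (\<i> * of_real (s * (x \<bullet> \<xi>))) * f x \<partial>lborel)"

lemma fourier_integral_eq: "fourier_integral = fint (-1)"
  by (intro ext) (simp add: fourier_integral_def fint_def)

lemma inverse_fourier_integral_eq: "inverse_fourier_integral = fint 1"
  by (intro ext) (simp add: inverse_fourier_integral_def fint_def inner_commute)

lemma cnj_measurable [measurable]: "cnj \<in> borel_measurable borel"
  by (intro borel_measurable_continuous_onI continuous_intros)

lemma phase_mult_integrable:
  assumes "integrable lborel f"
  shows "integrable lborel (\<lambda>x. exp (\<i> * of_real (s * (x \<bullet> \<xi>))) * f x)"
proof (rule Bochner_Integration.integrable_bound[OF assms])
  show "(\<lambda>x. exp (\<i> * of_real (s * (x \<bullet> \<xi>))) * f x) \<in> borel_measurable lborel"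
    using borel_measurable_integrable[OF assms] by measurable
qed (auto simp: norm_mult)

lemma fint_measurable [measurable]:
  assumes [measurable]: "f \<in> borel_measurable borel"
  shows "fint s f \<in> borel_measurable borel"
  unfolding fint_def[abs_def] by measurable

lemma fint_bound:
  fixes f :: "'a::euclidean_space \<Rightarrow> complex"
  shows "norm (fint s f \<xi>) \<le> (2 * pi) powr (- real DIM('a) / 2) * (\<integral>x. norm (f x) \<partial>lborel)"
proof -
  have "norm (\<integral>x. exp (\<i> * of_real (s * (x \<bullet> \<xi>))) * f x \<partial>lborel) \<le> (\<integral>x. norm (f x) \<partial>lborel)"
    by (rule order_trans[OF integral_norm_bound]) (simp add: norm_mult)
  then show ?thesis unfolding fint_def by (simp add: norm_mult mult_left_mono)
qed

lemma integrable_mult_bounded: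
  fixes g h :: "'a::euclidean_space \<Rightarrow> complex"
  assumes "integrable lborel g" and [measurable]: "h \<in> borel_measurable borel" and "\<And>x. norm (h x) \<le> B"
  shows "integrable lborel (\<lambda>x. g x * h x)"
proof (rule Bochner_Integration.integrable_bound)
  show "integrable lborel (\<lambda>x. of_real B * g x)" using assms(1) by (intro integrable_mult_right)
  show "(\<lambda>x. g x * h x) \<in> borel_measurable lborel"
    using borel_measurable_integrable[OF assms(1)] by measurable
  have "norm (g x) * norm (h x) \<le> \<bar>B\<bar> * norm (g x)" for x
    using mult_left_mono[OF order_trans[OF assms(3)[of x] abs_ge_self], of "norm (g x)"] by (simp add: mult.commute)
  then show "AE x in lborel. norm (g x * h x) \<le> norm (of_real B * g x)"
    by (auto simp: norm_mult)
qed

text \<open>By Fubini, since the phase is symmetric in the two variables. It moves the transform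
  onto whichever factor has a known one.\<close>

lemma fint_multiplication_formula:
  fixes f g :: "'a::euclidean_space \<Rightarrow> complex"
  assumes f: "integrable lborel f" and g: "integrable lborel g"
  shows "(\<integral>\<xi>. g \<xi> * fint s f \<xi> \<partial>lborel) = (\<integral>y. f y * fint s g y \<partial>lborel)"
proof -
  have [measurable]: "f \<in> borel_measurable borel" "g \<in> borel_measurable borel"
    using borel_measurable_integrable[OF f] borel_measurable_integrable[OF g] by simp_all
  define K where "K \<xi> y = g \<xi> * (exp (\<i> * of_real (s * (y \<bullet> \<xi>))) * f y)" for \<xi> y :: 'a
  have I: "integrable (lborel \<Otimes>\<^sub>M lborel) (\<lambda>(\<xi>, y). K \<xi> y)"
  proof (rule lborel_pair.Fubini_integrable)
    show "integrable lborel (\<lambda>\<xi>. \<integral>y. norm (case (\<xi>, y) of (\<xi>, y) \<Rightarrow> K \<xi> y) \<partial>lborel)"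
      using g by (simp add: K_def norm_mult)
    show "AE \<xi> in lborel. integrable lborel (\<lambda>y. case (\<xi>, y) of (\<xi>, y) \<Rightarrow> K \<xi> y)"
      by (intro AE_I2) (simp only: K_def prod.case integrable_mult_right phase_mult_integrable[OF f])
    show "(\<lambda>(\<xi>, y). K \<xi> y) \<in> borel_measurable (lborel \<Otimes>\<^sub>M lborel)"
      unfolding K_def by measurable
  qed
  define c where "c = complex_of_real ((2 * pi) powr (- real DIM('a) / 2))"
  have "(\<integral>\<xi>. g \<xi> * fint s f \<xi> \<partial>lborel) = (\<integral>\<xi>. c * (\<integral>y. K \<xi> y \<partial>lborel) \<partial>lborel)"
    by (simp add: fint_def K_def c_def mult.left_commute)
  also have "\<dots> = c * (\<integral>y. \<integral>\<xi>. K \<xi> y \<partial>lborel \<partial>lborel)"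
    by (simp add: lborel_pair.Fubini_integral[OF I])
  also have "\<dots> = (\<integral>y. c * (\<integral>\<xi>. f y * (exp (\<i> * of_real (s * (\<xi> \<bullet> y))) * g \<xi>) \<partial>lborel) \<partial>lborel)"
    by (simp add: K_def inner_commute mult_ac)
  also have "\<dots> = (\<integral>y. f y * fint s g y \<partial>lborel)"
    by (simp add: fint_def c_def mult.left_commute)
  finally show ?thesis .
qed

lemma norm_gsym_mult_le: "t \<ge> 0 \<Longrightarrow> norm (of_real (gsym t \<xi>) * z :: complex) \<le> norm z"
  using gsym_le_1[of t \<xi>] by (simp add: norm_mult abs_of_pos[OF gsym_pos] mult_left_le_one_le less_imp_le)

lemma gsym_integrable_complex: "t > 0 \<Longrightarrow> integrable lborel (\<lambda>\<xi>. complex_of_real (gsym t \<xi>))"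
  by (intro integrable_of_real gsym_integrable)

text \<open>The Gaussian factor makes the inversion integral absolutely convergent. For fixed
  \<open>x\<close>, \<open>g\<close> is a Gaussian modulated by the phase at \<open>x\<close>, so
  after the multiplication formula its transform is a Gaussian kernel centred at
  \<open>x\<close>.\<close>

lemma fint_gsym_fint:
  fixes f :: "'a::euclidean_space \<Rightarrow> complex"
  assumes t: "t > 0" and s: "s * s = 1" and f: "integrable lborel f"
  shows "fint (-s) (\<lambda>\<xi>. of_real (gsym t \<xi>) * fint s f \<xi>) x = gconv t f x"
proof -
  define c where "c = (2 * pi) powr (- real DIM('a) / 2)"
  define g where "g \<xi> = exp (\<i> * of_real (- s * (\<xi> \<bullet> x))) * complex_of_real (gsym t \<xi>)" for \<xi>
  have g: "integrable lborel g"
    unfolding g_def[abs_def] by (intro phase_mult_integrable gsym_integrable_complex t)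
  have cc: "c * (c * (2 * pi) powr real DIM('a)) = 1"
    unfolding c_def by (simp add: powr_add[symmetric] flip: mult.assoc)
  have Fg: "fint s g y = of_real (c * ((2 * pi) powr real DIM('a) * gauss t (x - y)))" for y
  proof -
    have "exp (\<i> * of_real (s * (\<xi> \<bullet> y))) * g \<xi> = exp (\<i> * of_real ((s *\<^sub>R (y - x)) \<bullet> \<xi>)) * of_real (gsym t \<xi>)" for \<xi>
      by (simp add: g_def exp_add[symmetric] inner_diff_left inner_commute algebra_simps flip: mult.assoc)
    then have "fint s g y = of_real c * of_real ((2 * pi) powr real DIM('a) * gauss t (s *\<^sub>R (y - x)))"
      unfolding fint_def by (simp only: gsym_Fourier_gauss[OF t] c_def)
    moreover have "s = 1 \<or> s = -1" using s by (simp add: square_eq_1_iff)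
    then have "gauss t (s *\<^sub>R (y - x)) = gauss t (x - y)"
      by (auto simp: gauss_minus_commute)
    ultimately show ?thesis by simp
  qed
  have "fint (-s) (\<lambda>\<xi>. of_real (gsym t \<xi>) * fint s f \<xi>) x = of_real c * (\<integral>\<xi>. g \<xi> * fint s f \<xi> \<partial>lborel)"
    by (simp add: fint_def[of "-s"] g_def c_def mult.assoc)
  also have "\<dots> = of_real c * (\<integral>y. f y * fint s g y \<partial>lborel)"
    by (simp add: fint_multiplication_formula[OF f g])
  also have "\<dots> = (\<integral>y. of_real (c * (c * (2 * pi) powr real DIM('a))) * (gauss t (x - y) *\<^sub>R f y) \<partial>lborel)"
    unfolding Fg by (simp add: scaleR_conv_of_real mult_ac flip: integral_mult_right_zero)
  also have "\<dots> = gconv t f x" by (simp add: cc gconv_def)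
  finally show ?thesis .
qed

lemma cnj_fint: "cnj (fint s f \<xi>) = fint (-s) (\<lambda>x. cnj (f x)) \<xi>"
  unfolding fint_def complex_cnj_mult Bochner_Integration.integral_cnj[symmetric]
  by (simp add: exp_cnj del: Bochner_Integration.integral_cnj)

lemma gsym_mult: "gsym s x * gsym t x = gsym (s + t) x"
  by (simp add: gsym_def exp_add[symmetric] algebra_simps add_divide_distrib)

lemma square_integral_Lp2:
  fixes f :: "'a::euclidean_space \<Rightarrow> complex"
  assumes "f \<in> Lp 2"
  shows "integrable lborel (\<lambda>x. (norm (f x))\<^sup>2)" "(\<integral>x. (norm (f x))\<^sup>2 \<partial>lborel) = (Lp_norm 2 f)\<^sup>2"
  using Lp_integrable[OF assms] Lp_norm_powr[of 2 f] by simp_all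

text \<open>Plancherel as an inequality, by damping. The squared modulus of the transform damped by
  \<open>gsym t\<close> carries \<open>gsym (2 * t)\<close>, and its integral pairs the conjugate of
  \<open>f\<close> with \<open>gconv (2 * t) f\<close>; as the convolution contracts
  \<open>Lp 2\<close>, this is at most the squared norm of \<open>f\<close>. Letting
  \<open>t\<close> tend to \<open>0\<close>, Fatou removes the damping.\<close>

lemma fint_L2_bound:
  fixes f :: "'a::euclidean_space \<Rightarrow> complex"
  assumes s: "s * s = 1" and f: "f \<in> Lp 1 \<inter> Lp 2"
  shows "fint s f \<in> Lp 2" "Lp_norm 2 (fint s f) \<le> Lp_norm 2 f"
proof -
  have f1: "integrable lborel f" and f2: "f \<in> Lp 2" using f by (simp_all add: integrable_iff_Lp1)
  note [measurable] = f2
  have damped: "(\<lambda>\<xi>. of_real (gsym t \<xi>) * fint s f \<xi>) \<in> Lp 2 \<and>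
      Lp_norm 2 (\<lambda>\<xi>. of_real (gsym t \<xi>) * fint s f \<xi>) \<le> Lp_norm 2 f" if t: "t > 0" for t
  proof -
    have t2: "2 * t > 0" using t by simp
    define g where "g \<xi> = of_real (gsym (2 * t) \<xi>) * fint s f \<xi>" for \<xi>
    have g: "integrable lborel g"
      unfolding g_def[abs_def]
      by (rule integrable_mult_bounded[OF gsym_integrable_complex[OF t2] _ fint_bound]) measurable
    have sq: "complex_of_real ((norm (of_real (gsym t \<xi>) * fint s f \<xi>))\<^sup>2) = g \<xi> * cnj (fint s f \<xi>)" for \<xi>
    proof -
      have "complex_of_real ((norm (of_real (gsym t \<xi>) * fint s f \<xi>))\<^sup>2)
        = (of_real (gsym t \<xi>) * fint s f \<xi>) * cnj (of_real (gsym t \<xi>) * fint s f \<xi>)"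
        by (rule complex_norm_square)
      also have "\<dots> = of_real (gsym t \<xi> * gsym t \<xi>) * fint s f \<xi> * cnj (fint s f \<xi>)"
        by (simp add: mult_ac)
      finally show ?thesis unfolding gsym_mult g_def by simp
    qed
    have "integrable lborel (\<lambda>\<xi>. g \<xi> * cnj (fint s f \<xi>))"
      by (rule integrable_mult_bounded[OF g]) (measurable, simp only: complex_mod_cnj, rule fint_bound)
    then have "integrable lborel (\<lambda>\<xi>. complex_of_real ((norm (of_real (gsym t \<xi>) * fint s f \<xi>))\<^sup>2))"
      unfolding sq .
    from integrable_Re[OF this] have I: "integrable lborel (\<lambda>\<xi>. (norm (of_real (gsym t \<xi>) * fint s f \<xi>))\<^sup>2)"
      by simp
    then have mem: "(\<lambda>\<xi>. of_real (gsym t \<xi>) * fint s f \<xi>) \<in> Lp 2"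
      by (simp add: Lp_iff)
    have fc: "integrable lborel (\<lambda>x. cnj (f x))" using f1 by simp
    have h: "gconv (2 * t) f \<in> Lp 2" "Lp_norm 2 (gconv (2 * t) f) \<le> Lp_norm 2 f"
      by (auto intro!: gconv_Lp t2 f1 f2)
    have "complex_of_real ((Lp_norm 2 (\<lambda>\<xi>. of_real (gsym t \<xi>) * fint s f \<xi>))\<^sup>2)
      = (\<integral>\<xi>. g \<xi> * fint (-s) (\<lambda>x. cnj (f x)) \<xi> \<partial>lborel)"
      unfolding square_integral_Lp2(2)[OF mem, symmetric] cnj_fint[symmetric] sq[symmetric]
      by (rule integral_complex_of_real[symmetric])
    also have "\<dots> = (\<integral>y. cnj (f y) * fint (-s) g y \<partial>lborel)"
      by (rule fint_multiplication_formula[OF fc g])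
    also have "\<dots> = (\<integral>y. cnj (f y) * gconv (2 * t) f y \<partial>lborel)"
      unfolding g_def[abs_def] fint_gsym_fint[OF t2 s f1] ..
    finally have "(Lp_norm 2 (\<lambda>\<xi>. of_real (gsym t \<xi>) * fint s f \<xi>))\<^sup>2
        = norm (\<integral>y. cnj (f y) * gconv (2 * t) f y \<partial>lborel)"
      by (metis norm_of_real abs_of_nonneg zero_le_power2)
    also have "\<dots> \<le> (\<integral>y. ((norm (f y))\<^sup>2 + (norm (gconv (2 * t) f y))\<^sup>2) / 2 \<partial>lborel)"
    proof (rule Bochner_Integration.integral_norm_bound_integral)
      show Ib: "integrable lborel (\<lambda>y. ((norm (f y))\<^sup>2 + (norm (gconv (2 * t) f y))\<^sup>2) / 2)"
        by (intro integrable_divide Bochner_Integration.integrable_add square_integral_Lp2 f2 h)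
      have le: "norm (cnj (f y) * gconv (2 * t) f y) \<le> ((norm (f y))\<^sup>2 + (norm (gconv (2 * t) f y))\<^sup>2) / 2" for y
        using sum_squares_bound[of "norm (f y)" "norm (gconv (2 * t) f y)"] by (simp add: norm_mult)
      then show "\<And>y. y \<in> space lborel \<Longrightarrow> norm (cnj (f y) * gconv (2 * t) f y) \<le> ((norm (f y))\<^sup>2 + (norm (gconv (2 * t) f y))\<^sup>2) / 2" .
      show "integrable lborel (\<lambda>y. cnj (f y) * gconv (2 * t) f y)"
        by (rule Bochner_Integration.integrable_bound[OF Ib])
           (use le in \<open>auto intro!: AE_I2 order_trans[OF _ abs_ge_self]\<close>)
    qed
    also have "\<dots> = ((Lp_norm 2 f)\<^sup>2 + (Lp_norm 2 (gconv (2 * t) f))\<^sup>2) / 2"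
      by (simp add: square_integral_Lp2 f2 h)
    also have "\<dots> \<le> (Lp_norm 2 f)\<^sup>2"
      using power_mono[OF h(2), of 2] by simp
    finally show ?thesis using mem by (simp add: power2_le_iff_abs_le)
  qed
  have lim: "(\<lambda>k. of_real (gsym (1 / real (Suc k)) \<xi>) * fint s f \<xi>) \<longlonglongrightarrow> fint s f \<xi>" for \<xi>
  proof -
    have "(\<lambda>k. gsym (inverse (real (Suc k))) \<xi>) \<longlonglongrightarrow> exp (- 0 * (norm \<xi>)\<^sup>2 / 2)"
      unfolding gsym_def by (intro tendsto_intros LIMSEQ_inverse_real_of_nat) simp
    then have "(\<lambda>k. of_real (gsym (inverse (real (Suc k))) \<xi>) * fint s f \<xi>) \<longlonglongrightarrow> of_real 1 * fint s f \<xi>"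
      by (intro tendsto_intros) simp
    then show ?thesis by (simp add: inverse_eq_divide)
  qed
  have "fint s f \<in> Lp 2 \<and> Lp_norm 2 (fint s f) \<le> Lp_norm 2 f"
    by (intro conjI; rule Lp_Fatou[where F = "\<lambda>k \<xi>. of_real (gsym (1 / real (Suc k)) \<xi>) * fint s f \<xi>"
          and M = "Lp_norm 2 f"])
       (use damped lim in simp_all)
  then show "fint s f \<in> Lp 2" "Lp_norm 2 (fint s f) \<le> Lp_norm 2 f" by auto
qed

section \<open>The extended transforms and Fourier inversion\<close>

definition fourier :: "real \<Rightarrow> ('a::euclidean_space \<Rightarrow> complex) \<Rightarrow> 'a \<Rightarrow> complex" where
  "fourier s = (SOME B. bounded_extension 2 (Lp 1 \<inter> Lp 2) (fint s) B)"

lemma fourier_L2_eq: "fourier_L2 = fourier (-1)"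
  by (simp add: fourier_L2_def fourier_def fourier_integral_eq)

lemma inverse_fourier_L2_eq: "inverse_fourier_L2 = fourier 1"
  by (simp add: inverse_fourier_L2_def fourier_def inverse_fourier_integral_eq)

context
  fixes s :: real
  assumes s: "s * s = 1"
begin

lemma fourier_extension: "bounded_extension 2 (Lp 1 \<inter> Lp 2) (fint s) (fourier s :: ('a::euclidean_space \<Rightarrow> complex) \<Rightarrow> _)"
  unfolding fourier_def
proof (rule someI_ex[where P = "bounded_extension 2 (Lp 1 \<inter> Lp 2) (fint s)"], rule bounded_extension_exists)
  fix f g :: "'a \<Rightarrow> complex" and c
  assume fg: "f \<in> Lp 1 \<inter> Lp 2" "g \<in> Lp 1 \<inter> Lp 2"
  then have f1: "integrable lborel f" and g1: "integrable lborel g" by (simp_all add: integrable_iff_Lp1)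
  have "fint s (\<lambda>y. f y + g y) x = fint s f x + fint s g x" for x
    using phase_mult_integrable[OF f1, of s x] phase_mult_integrable[OF g1, of s x]
    unfolding fint_def distrib_left by (subst Bochner_Integration.integral_add) (simp_all add: distrib_left)
  then show "AE x in lborel. fint s (\<lambda>y. f y + g y) x = fint s f x + fint s g x" by simp
  show "(\<lambda>x. f x + g x) \<in> Lp 1 \<inter> Lp 2" using fg by (auto intro: Lp_add)
next
  fix f :: "'a \<Rightarrow> complex" and c
  assume f: "f \<in> Lp 1 \<inter> Lp 2"
  have "fint s (\<lambda>y. c * f y) x = c * fint s f x" for x
    by (simp add: fint_def mult.left_commute)
  then show "AE x in lborel. fint s (\<lambda>y. c * f y) x = c * fint s f x" by simp
  show "(\<lambda>x. c * f x) \<in> Lp 1 \<inter> Lp 2" using f by (auto intro: Lp_cmult)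
  show "fint s f \<in> Lp 2" "Lp_norm 2 (fint s f) \<le> 1 * Lp_norm 2 f"
    using fint_L2_bound[OF s f] by simp_all
next
  fix f :: "'a \<Rightarrow> complex" and k
  assume "f \<in> Lp 2"
  then show "trunc k f \<in> Lp 1 \<inter> Lp 2"
    by (auto intro!: trunc_in_Lp Lp_measurable[of f 2])
qed auto

lemma fourier_bounded_linear: "bounded_linear_Lp 2 (fourier s)"
  by (rule conjunct1[OF fourier_extension[unfolded bounded_extension_def]])

lemma fourier_eq_fint: "f \<in> Lp 1 \<Longrightarrow> f \<in> Lp 2 \<Longrightarrow> AE x in lborel. fourier s f x = fint s f x"
  using conjunct2[OF fourier_extension[unfolded bounded_extension_def]] by blast

lemmas fourier_mem = bounded_linear_Lp_mem[OF one_le_numeral fourier_bounded_linear]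
lemmas fourier_add = bounded_linear_Lp_add[OF one_le_numeral fourier_bounded_linear]
lemmas fourier_cmult = bounded_linear_Lp_cmult[OF one_le_numeral fourier_bounded_linear]
lemmas fourier_tendsto = bounded_linear_Lp_tendsto[OF one_le_numeral fourier_bounded_linear]
lemmas fourier_cong_AE = bounded_linear_Lp_cong_AE[OF one_le_numeral fourier_bounded_linear]

end

text \<open>The damped transform lies in \<open>Lp 1\<close> as well as in \<open>Lp 2\<close>, so
  the extended inverse transform agrees there with the integral, for which the identity is
  known.\<close>

lemma fourier_damped:
  fixes f :: "'a::euclidean_space \<Rightarrow> complex"
  assumes s: "s * s = 1" and f: "f \<in> Lp 1" "f \<in> Lp 2" and t: "t > 0"
  shows "AE x in lborel. fourier (-s) (\<lambda>\<xi>. of_real (gsym t \<xi>) * fourier s f \<xi>) x = gconv t f x"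
proof -
  have s': "- s * - s = 1" using s by simp
  have f1: "integrable lborel f" using f by (simp add: integrable_iff_Lp1)
  have F: "fint s f \<in> Lp 2" using fint_L2_bound[OF s, of f] f by simp
  let ?g = "\<lambda>\<xi>. of_real (gsym t \<xi>) * fint s f \<xi>"
  let ?h = "\<lambda>\<xi>. of_real (gsym t \<xi>) * fourier s f \<xi>"
  note [measurable] = F f(2) fourier_mem[OF s f(2)]
  have "integrable lborel ?g"
    by (rule integrable_mult_bounded[OF gsym_integrable_complex[OF t] _ fint_bound]) measurable
  then have g1: "?g \<in> Lp 1" by (simp add: integrable_iff_Lp1)
  have g2: "?g \<in> Lp 2"
    by (rule Lp_bound(1)[OF _ F]) (use t in \<open>auto intro!: norm_gsym_mult_le\<close>)
  have h2: "?h \<in> Lp 2"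
    by (rule Lp_bound(1)[OF _ fourier_mem[OF s f(2)]]) (use t in \<open>auto intro!: norm_gsym_mult_le\<close>)
  have "AE x in lborel. ?h x = ?g x"
    using fourier_eq_fint[OF s f] by auto
  then have "AE x in lborel. fourier (-s) ?h x = fourier (-s) ?g x"
    by (intro fourier_cong_AE s' g2 h2)
  then show ?thesis
    using fourier_eq_fint[OF s' g1 g2]
    by eventually_elim (simp add: fint_gsym_fint[OF t s f1])
qed

text \<open>Both sides depend continuously on \<open>f\<close> in L^2, so inversion passes to
  limits. It is used twice: from continuous functions to truncations, and from truncations to all of
  \<open>Lp 2\<close>.\<close>

lemma fourier_inversion_closed:
  fixes f :: "'a::euclidean_space \<Rightarrow> complex"
  assumes s: "s * s = 1" and F: "\<And>k. F k \<in> Lp 2" "f \<in> Lp 2" "Lp_tendsto 2 F f"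
    and inv: "\<And>k. AE x in lborel. fourier (-s) (fourier s (F k)) x = F k x"
  shows "AE x in lborel. fourier (-s) (fourier s f) x = f x"
proof (rule Lp_tendsto_unique)
  have s': "- s * - s = 1" using s by simp
  show "Lp_tendsto 2 F (fourier (-s) (fourier s f))"
  proof (rule Lp_tendsto_cong_AE[where F = "\<lambda>k. fourier (-s) (fourier s (F k))"])
    show "Lp_tendsto 2 (\<lambda>k. fourier (-s) (fourier s (F k))) (fourier (-s) (fourier s f))"
      by (intro fourier_tendsto fourier_mem s s' F)
  qed (intro Lp_measurable[of _ 2] fourier_mem s s' F inv AE_I2 refl)+
  show "fourier (-s) (fourier s f) \<in> Lp 2"
    by (intro fourier_mem s s' F)
qed (use F in auto)

text \<open>The damped transforms \<open>g k\<close> tend to that of \<open>f\<close>, so their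
  inverse transforms converge in L^2 to the double transform. They are also Gaussian convolutions of
  \<open>f\<close>, which by continuity converge to \<open>f\<close> at every point. A subsequence
  converging a.e. identifies the two limits.\<close>

lemma fourier_inversion_continuous:
  fixes f :: "'a::euclidean_space \<Rightarrow> complex"
  assumes s: "s * s = 1" and f: "f \<in> Lp 1" "f \<in> Lp 2"
    and cont: "continuous_on UNIV f" and bd: "\<And>x. norm (f x) \<le> B"
  shows "AE x in lborel. fourier (-s) (fourier s f) x = f x"
proof -
  have s': "- s * - s = 1" using s by simp
  define t where "t k = inverse (real (Suc k))" for k
  have t: "t k > 0" "t \<longlonglongrightarrow> 0" for k
    unfolding t_def by (simp, rule LIMSEQ_inverse_real_of_nat)
  have Ff: "fourier s f \<in> Lp 2" by (intro fourier_mem s f)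
  note [measurable] = Ff
  define g where "g k \<xi> = of_real (gsym (t k) \<xi>) * fourier s f \<xi>" for k \<xi>
  have [measurable]: "g k \<in> borel_measurable borel" for k
    unfolding g_def[abs_def] by measurable
  have lim: "(\<lambda>k. g k \<xi>) \<longlonglongrightarrow> fourier s f \<xi>" for \<xi>
  proof -
    have "(\<lambda>k. gsym (t k) \<xi>) \<longlonglongrightarrow> exp (- 0 * (norm \<xi>)\<^sup>2 / 2)"
      unfolding gsym_def by (intro tendsto_intros t) simp
    then have "(\<lambda>k. of_real (gsym (t k) \<xi>) * fourier s f \<xi>) \<longlonglongrightarrow> of_real 1 * fourier s f \<xi>"
      by (intro tendsto_intros) simp
    then show ?thesis by (simp add: g_def)
  qed
  have le: "norm (g k \<xi>) \<le> norm (fourier s f \<xi>)" for k \<xi>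
    using norm_gsym_mult_le[of "t k"] t(1)[of k] by (simp add: g_def)
  have g: "\<And>k. g k \<in> Lp 2"
    by (rule Lp_bound(1)[OF _ Ff]) (use le in auto)
  have g_lim: "Lp_tendsto 2 g (fourier s f)"
    unfolding Lp_tendsto_def by (rule Lp_dominated(3)[OF one_le_numeral Ff]) (use lim le in auto)
  have inv: "AE x in lborel. fourier (-s) (g k) x = gconv (t k) f x" for k
    using fourier_damped[OF s f t(1)] by (simp add: g_def[abs_def])
  have Fg: "fourier (-s) (g k) \<in> Lp 2" "fourier (-s) (fourier s f) \<in> Lp 2" for k
    by (intro fourier_mem s' g Ff)+
  have "Lp_tendsto 2 (\<lambda>k. fourier (-s) (g k)) (fourier (-s) (fourier s f))"
    by (intro fourier_tendsto s' g g_lim Ff)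
  then obtain r :: "nat \<Rightarrow> nat" where r: "strict_mono r"
    "AE x in lborel. (\<lambda>k. fourier (-s) (g (r k)) x) \<longlonglongrightarrow> fourier (-s) (fourier s f) x"
    using Lp_tendsto_AE_subseq[of 2 "\<lambda>k. fourier (-s) (g k)" "fourier (-s) (fourier s f)"]
      Lp_diff(1)[OF one_le_numeral Fg] by (auto simp: Lp_tendsto_def)
  have "AE x in lborel. \<forall>k. fourier (-s) (g k) x = gconv (t k) f x"
    using inv by (simp add: AE_all_countable)
  with r(2) show ?thesis
  proof eventually_elim
    case (elim x)
    have "(\<lambda>k. gconv (t (r k)) f x) \<longlonglongrightarrow> f x"
      using LIMSEQ_subseq_LIMSEQ[OF gconv_tendsto[OF cont bd t] r(1)] by (simp add: o_def)
    then show ?case using elim LIMSEQ_unique by fastforce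
  qed
qed

text \<open>A measurable function is a.e. a limit of continuous functions \<open>g n\<close>, but
  without any domination. Clipping the values by \<open>cl\<close> and the support by
  \<open>cut\<close> keeps continuity, leaves \<open>f\<close> itself unchanged, and supplies a
  majorant in L^2.\<close>

lemma Lp2_approx_continuous:
  fixes f :: "'a::euclidean_space \<Rightarrow> complex"
  assumes [measurable]: "f \<in> borel_measurable borel"
    and B: "\<And>x. norm (f x) \<le> B" and R: "\<And>x. norm x > R \<Longrightarrow> f x = 0"
  obtains G where "\<And>k. continuous_on UNIV (G k)" "\<And>k x. norm (G k x) \<le> B + 1"
    "\<And>k q. q > 0 \<Longrightarrow> G k \<in> Lp q" "Lp_tendsto 2 G f"
proof -
  have "f \<in> borel_measurable lebesgue" by (rule measurable_completion) simp
  then have "f measurable_on UNIV"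
    using measurable_on_iff_borel_measurable[of UNIV f] by simp
  then obtain N g where N: "negligible N" and g: "\<And>n. continuous_on UNIV (g n)"
    and lim: "\<And>x. x \<notin> N \<Longrightarrow> (\<lambda>n. g n x) \<longlonglongrightarrow> f x"
    by (auto simp: measurable_on_def)
  have B0: "B \<ge> 0" using B[of 0] norm_ge_zero order_trans by blast
  \<comment> \<open>\<open>B\<close> may be \<open>0\<close>; the added \<open>1\<close> keeps the
    denominator \<open>max D (norm z)\<close> positive.\<close>
  define D where "D = B + 1"
  have D: "D > 0" using B0 by (simp add: D_def)
  define cut where "cut x = max 0 (1 - max 0 (norm x - R))" for x :: 'a
  define cl where "cl z = (D / max D (norm z)) *\<^sub>R z" for z :: complex
  define G where "G k x = cut x *\<^sub>R cl (g k x)" for k x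
  have chi: "0 \<le> cut x" "cut x \<le> 1" for x by (auto simp: cut_def)
  have "max D (norm z) \<noteq> 0" for z :: complex using D by auto
  then have cont_cl: "continuous_on UNIV cl"
    unfolding cl_def[abs_def] by (intro continuous_intros) auto
  have contG: "continuous_on UNIV (G k)" for k
    unfolding G_def[abs_def] cut_def
    by (intro continuous_intros continuous_on_compose2[OF cont_cl g]) auto
  have [measurable]: "G k \<in> borel_measurable borel" for k
    by (rule borel_measurable_continuous_onI[OF contG])
  have ncl: "norm (cl z) \<le> D" for z
    using D by (auto simp: cl_def field_simps max_def)
  have nG: "norm (G k x) \<le> D" for k x
    using mult_mono[OF chi(2)[of x] ncl[of "g k x"]] chi[of x] D by (simp add: G_def)
  have zG: "norm x > R + 1 \<Longrightarrow> G k x = 0" for k x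
    by (simp add: G_def cut_def)
  have LG: "G k \<in> Lp q" if "q > 0" for k q
    by (rule bounded_support_in_Lp[OF that _ nG zG]) simp_all
  have "N \<in> null_sets lebesgue" using N by (simp add: negligible_iff_null_sets)
  then have "AE x in lebesgue. x \<notin> N" by (rule AE_not_in)
  then have "AE x in lebesgue. (\<lambda>k. G k x) \<longlonglongrightarrow> f x"
  proof eventually_elim
    case (elim x)
    have "(\<lambda>k. cl (g k x)) \<longlonglongrightarrow> cl (f x)"
      using cont_cl by (intro isCont_tendsto_compose[OF _ lim[OF elim]]) (simp add: continuous_on_eq_continuous_at)
    then have "(\<lambda>k. G k x) \<longlonglongrightarrow> cut x *\<^sub>R cl (f x)"
      unfolding G_def by (intro tendsto_intros)
    moreover have "cl (f x) = f x"
      using B[of x] B0 by (simp add: cl_def D_def max_def)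
    moreover have "cut x *\<^sub>R f x = f x"
      using R[of x] by (cases "norm x > R") (auto simp: cut_def)
    ultimately show ?case by simp
  qed
  then have limG: "AE x in lborel. (\<lambda>k. G k x) \<longlonglongrightarrow> f x"
    by (simp only: AE_completion_iff)
  have w: "(\<lambda>x::'a. D * indicator (cball 0 (R + 1)) x) \<in> Lp (2::real)"
    by (rule bounded_support_in_Lp[where B = D and R = "R + 1"]) (use D in \<open>auto simp: indicator_def\<close>)
  have "Lp_tendsto 2 G f"
    unfolding Lp_tendsto_def
  proof (rule Lp_dominated(3)[OF one_le_numeral w _ _ limG])
    show "AE x in lborel. norm (G k x) \<le> norm (D * indicator (cball 0 (R + 1)) x)" for k
      using nG zG D by (intro AE_I2) (auto simp: indicator_def not_le)
  qed simp_all
  with that contG nG LG show ?thesis unfolding D_def by blast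
qed

lemma fourier_inversion:
  fixes f :: "'a::euclidean_space \<Rightarrow> complex"
  assumes s: "s * s = 1" and f: "f \<in> Lp 2"
  shows "AE x in lborel. fourier (-s) (fourier s f) x = f x"
proof (rule fourier_inversion_closed[OF s _ f trunc_Lp_tendsto[OF one_le_numeral f]])
  have m: "f \<in> borel_measurable borel" using f by (simp add: Lp_iff)
  show t: "trunc k f \<in> Lp 2" for k
    by (rule trunc_in_Lp[OF _ m]) simp
  show "AE x in lborel. fourier (-s) (fourier s (trunc k f)) x = trunc k f x" for k
  proof -
    have tm: "trunc k f \<in> borel_measurable borel" using m by measurable
    have R: "norm x > real k \<Longrightarrow> trunc k f x = 0" for x by (simp add: trunc_def)
    obtain G where G: "\<And>j. continuous_on UNIV (G j)" "\<And>j x. norm (G j x) \<le> real k + 1"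
      "\<And>j q. q > 0 \<Longrightarrow> G j \<in> Lp q" "Lp_tendsto 2 G (trunc k f)"
      using Lp2_approx_continuous[OF tm norm_trunc_le(2) R] by blast
    have "AE x in lborel. fourier (-s) (fourier s (G j)) x = G j x" for j
      by (rule fourier_inversion_continuous[OF s _ _ G(1) G(2)]) (simp_all add: G(3))
    with G(3) show ?thesis
      by (intro fourier_inversion_closed[OF s _ t G(4)]) simp_all
  qed
qed

section \<open>Real radial functions\<close>

text \<open>Real and radial are tracked as a single property: the iteration has to preserve both,
  and on real values \<open>power_nonlinearity\<close> is the nonlinearity of the equation.\<close>

definition radial_real :: "('a::euclidean_space \<Rightarrow> complex) \<Rightarrow> bool" where
  "radial_real u \<longleftrightarrow> (\<exists>\<phi>::real \<Rightarrow> real. AE x in lborel. u x = complex_of_real (\<phi> (norm x)))"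

lemma radial_realI: "AE x in lborel. u x = complex_of_real (\<phi> (norm x)) \<Longrightarrow> radial_real u"
  unfolding radial_real_def by blast

lemma radial_real_imp_spherically_symmetric: "radial_real u \<Longrightarrow> spherically_symmetric u"
  by (auto simp: radial_real_def spherically_symmetric_def intro: exI[of _ "\<lambda>r. complex_of_real (\<phi> r)" for \<phi>])

lemma radial_real_cong_AE:
  assumes "radial_real f" "AE x in lborel. f x = g x"
  shows "radial_real g"
proof -
  obtain \<phi> where "AE x in lborel. f x = complex_of_real (\<phi> (norm x))"
    using assms(1) by (auto simp: radial_real_def)
  with assms(2) have "AE x in lborel. g x = complex_of_real (\<phi> (norm x))" by eventually_elim simp
  then show ?thesis by (rule radial_realI)
qed

lemma radial_real_add:
  assumes "radial_real f" "radial_real g"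
  shows "radial_real (\<lambda>x. f x + g x)"
proof -
  obtain \<phi> \<psi> where "AE x in lborel. f x = complex_of_real (\<phi> (norm x))" "AE x in lborel. g x = complex_of_real (\<psi> (norm x))"
    using assms by (auto simp: radial_real_def)
  then have "AE x in lborel. f x + g x = complex_of_real (\<phi> (norm x) + \<psi> (norm x))" by eventually_elim simp
  then show ?thesis by (rule radial_realI[where \<phi> = "\<lambda>r. \<phi> r + \<psi> r"])
qed

lemma radial_real_cmult:
  assumes "radial_real f"
  shows "radial_real (\<lambda>x. of_real c * f x)"
proof -
  obtain \<phi> where "AE x in lborel. f x = complex_of_real (\<phi> (norm x))"
    using assms by (auto simp: radial_real_def)
  then have "AE x in lborel. of_real c * f x = complex_of_real (c * \<phi> (norm x))" by eventually_elim simp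
  then show ?thesis by (rule radial_realI[where \<phi> = "\<lambda>r. c * \<phi> r"])
qed

lemma radial_real_diff: "radial_real f \<Longrightarrow> radial_real g \<Longrightarrow> radial_real (\<lambda>x. f x - g x)"
  using radial_real_add[of f "\<lambda>x. of_real (-1) * g x"] radial_real_cmult[of g "-1"] by simp

lemma radial_real_trunc:
  assumes "radial_real f"
  shows "radial_real (trunc k f)"
proof -
  obtain \<phi> where "AE x in lborel. f x = complex_of_real (\<phi> (norm x))"
    using assms by (auto simp: radial_real_def)
  then have "AE x in lborel. trunc k f x = complex_of_real (if norm x \<le> real k \<and> \<bar>\<phi> (norm x)\<bar> \<le> real k then \<phi> (norm x) else 0)"
    by eventually_elim (simp add: trunc_def)
  then show ?thesis
    by (rule radial_realI[where \<phi> = "\<lambda>r. if r \<le> real k \<and> \<bar>\<phi> r\<bar> \<le> real k then \<phi> r else 0"])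
qed

text \<open>The profile of the limit is the \<open>lim\<close> of the profiles; at radii where they
  diverge it is a default value, which concerns only a null set of points \<open>x\<close>.\<close>

lemma radial_real_limit:
  assumes "\<And>k. radial_real (F k)" "AE x in lborel. (\<lambda>k. F k x) \<longlonglongrightarrow> f x"
  shows "radial_real f"
proof -
  have "\<forall>k. \<exists>\<phi>. AE x in lborel. F k x = complex_of_real (\<phi> (norm x))"
    using assms(1) by (simp add: radial_real_def)
  then obtain \<phi> where \<phi>: "\<And>k. AE x in lborel. F k x = complex_of_real (\<phi> k (norm x))" by metis
  then have "AE x in lborel. \<forall>k. F k x = complex_of_real (\<phi> k (norm x))" by (simp add: AE_all_countable)
  with assms(2) have "AE x in lborel. f x = complex_of_real (lim (\<lambda>k. \<phi> k (norm x)))"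
  proof eventually_elim
    case (elim x)
    then have l: "(\<lambda>k. complex_of_real (\<phi> k (norm x))) \<longlonglongrightarrow> f x" by simp
    from tendsto_Re[OF l] have r: "(\<lambda>k. \<phi> k (norm x)) \<longlonglongrightarrow> Re (f x)" by simp
    from tendsto_Im[OF l] have "(\<lambda>k. 0) \<longlonglongrightarrow> Im (f x)" by simp
    from LIMSEQ_unique[OF this tendsto_const] have "Im (f x) = 0" .
    with limI[OF r] show ?case by (simp add: complex_eq_iff)
  qed
  then show ?thesis by (rule radial_realI[where \<phi> = "\<lambda>r. lim (\<lambda>k. \<phi> k r)"])
qed

section \<open>Invariance of Lebesgue measure under reflections\<close>

lemma lborel_nn_integral_shift:
  fixes h :: "'a::euclidean_space \<Rightarrow> ennreal"
  assumes [measurable]: "h \<in> borel_measurable borel"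
  shows "(\<integral>\<^sup>+x. h (c + x) \<partial>lborel) = (\<integral>\<^sup>+x. h x \<partial>lborel)"
  by (subst (2) lborel_distr_plus[of c, symmetric], subst nn_integral_distr) auto

lemma lborel_nn_integral_shift_diff:
  fixes h :: "'a::euclidean_space \<Rightarrow> ennreal"
  assumes "h \<in> borel_measurable borel"
  shows "(\<integral>\<^sup>+x. h (x - c) \<partial>lborel) = (\<integral>\<^sup>+x. h x \<partial>lborel)"
  using lborel_nn_integral_shift[OF assms, of "- c"] by simp

text \<open>
  The image of Lebesgue measure under an additive isometric involution \<open>R\<close> is translation invariant
  and agrees with Lebesgue measure on the unit ball; comparing the two iterated integrals of
  \<open>1\<^sub>A(R x) 1\<^sub>B(y - R x)\<close> with \<open>B\<close> the unit ball shows that the two measures are equal.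
\<close>

lemma lborel_distr_isometric_involution:
  fixes R :: "'a::euclidean_space \<Rightarrow> 'a"
  assumes [measurable]: "R \<in> borel_measurable borel"
    and add: "\<And>x y. R (x + y) = R x + R y" and inv: "\<And>x. R (R x) = x" and iso: "\<And>x. norm (R x) = norm x"
  shows "distr lborel borel R = lborel"
proof (rule measure_eqI)
  fix A assume "A \<in> sets (distr lborel borel R)"
  then have [measurable]: "A \<in> sets borel" by simp
  define B :: "'a set" where "B = ball 0 1"
  have [measurable]: "B \<in> sets borel" by (simp add: B_def)
  let ?a = "indicator A :: 'a \<Rightarrow> ennreal" and ?b = "indicator B :: 'a \<Rightarrow> ennreal"
  have bR: "?b (- R x) = ?b x" for x by (simp add: B_def indicator_def iso)
  have eA: "(\<integral>\<^sup>+x. ?a (R x) \<partial>lborel) = emeasure (distr lborel borel R) A"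
    by (subst nn_integral_distr[of R lborel borel, symmetric]) (simp_all add: nn_integral_indicator)
  have "emeasure (distr lborel borel R) A * emeasure lborel B
      = (\<integral>\<^sup>+x. \<integral>\<^sup>+y. ?a (R x) * ?b (- R x + y) \<partial>lborel \<partial>lborel)"
    by (simp add: nn_integral_cmult lborel_nn_integral_shift_diff nn_integral_multc eA)
  also have "\<dots> = (\<integral>\<^sup>+y. \<integral>\<^sup>+x. ?a (R x) * ?b (- R x + y) \<partial>lborel \<partial>lborel)"
    by (rule lborel_pair.Fubini') measurable
  \<comment> \<open>Translating \<open>x\<close> by \<open>R y\<close> turns the arguments into
    \<open>y + R x\<close> and \<open>- R x\<close>: the indicator of \<open>A\<close> is now the
    one translated by \<open>y\<close>, and that of \<open>B\<close> depends on \<open>x\<close>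
    alone, because the ball is symmetric and \<open>R\<close> isometric.\<close>
  also have "\<dots> = (\<integral>\<^sup>+y. \<integral>\<^sup>+x. ?a (R (R y + x)) * ?b (- R (R y + x) + y) \<partial>lborel \<partial>lborel)"
    by (subst lborel_nn_integral_shift) simp_all
  also have "\<dots> = (\<integral>\<^sup>+y. \<integral>\<^sup>+x. ?b x * ?a (R x + y) \<partial>lborel \<partial>lborel)"
    by (simp add: add inv bR mult.commute add.commute)
  also have "\<dots> = (\<integral>\<^sup>+x. \<integral>\<^sup>+y. ?b x * ?a (R x + y) \<partial>lborel \<partial>lborel)"
    by (rule lborel_pair.Fubini') measurable
  also have "\<dots> = emeasure lborel A * emeasure lborel B"
    by (simp add: nn_integral_cmult lborel_nn_integral_shift nn_integral_multc mult.commute)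
  finally have "emeasure (distr lborel borel R) A * emeasure lborel B = emeasure lborel A * emeasure lborel B" .
  moreover have fin: "emeasure lborel B = ennreal (measure lborel B)"
    using emeasure_lborel_ball_finite[of "0::'a" 1]
    by (intro emeasure_eq_ennreal_measure) (simp add: B_def less_top)
  moreover have "emeasure lborel B \<noteq> 0"
  proof
    assume "emeasure lborel B = 0"
    then have "B \<in> null_sets lborel" by (simp add: null_sets_def)
    then have "negligible B" by (simp add: negligible_iff_null_sets null_sets_completionI)
    then show False using open_not_negligible[of B] by (simp add: B_def)
  qed
  ultimately show "emeasure (distr lborel borel R) A = emeasure lborel A"
    unfolding fin mult_right_ennreal_cancel by (simp add: measure_le_0_iff)
qed simp

text \<open>Reflection in the hyperplane orthogonal to \<open>v\<close>. For \<open>v = 0\<close>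
  division by zero makes it the identity, so the laws that follow hold for every \<open>v\<close>.
  Reflections carry any point to any other of the same norm, so invariance under them already forces
  a function to be radial.\<close>

definition reflect :: "'a::euclidean_space \<Rightarrow> 'a \<Rightarrow> 'a" where
  "reflect v z = z - (2 * (z \<bullet> v) / (v \<bullet> v)) *\<^sub>R v"

lemma
  fixes v :: "'a::euclidean_space"
  shows reflect_add: "reflect v (x + y) = reflect v x + reflect v y"
    and reflect_diff: "reflect v (x - y) = reflect v x - reflect v y"
    and reflect_involution: "reflect v (reflect v x) = x"
    and norm_reflect: "norm (reflect v x) = norm x"
    and reflect_measurable [measurable]: "reflect v \<in> borel_measurable borel"
    and reflect_swap: "norm x = norm y \<Longrightarrow> reflect (x - y) x = y"
proof -
  show "reflect v (x + y) = reflect v x + reflect v y" "reflect v (x - y) = reflect v x - reflect v y"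
    by (simp_all add: reflect_def inner_add_left inner_diff_left algebra_simps add_divide_distrib diff_divide_distrib)
  show "reflect v (reflect v x) = x"
    by (cases "v = 0") (simp_all add: reflect_def inner_diff_left field_simps)
  have "reflect v x \<bullet> reflect v x = x \<bullet> x"
    by (cases "v = 0") (simp_all add: reflect_def inner_diff_left inner_diff_right inner_commute field_simps)
  then show "norm (reflect v x) = norm x" by (simp add: norm_eq_sqrt_inner)
  show "reflect v \<in> borel_measurable borel" unfolding reflect_def[abs_def] by measurable
  show "reflect (x - y) x = y" if "norm x = norm y"
  proof (cases "x = y")
    case False
    have "x \<bullet> x = y \<bullet> y" using that by (simp add: norm_eq)
    then have "2 * (x \<bullet> (x - y)) = (x - y) \<bullet> (x - y)"
      by (simp add: inner_diff_left inner_diff_right inner_commute)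
    with False show ?thesis by (simp add: reflect_def)
  qed (simp add: reflect_def)
qed

lemma lborel_distr_reflect: "distr lborel borel (reflect v) = lborel"
  by (rule lborel_distr_isometric_involution)
     (simp_all add: reflect_add reflect_involution norm_reflect)

text \<open>The kernel depends only on a norm and reflections preserve the measure. Since
  \<open>gconv t f\<close> is defined by an integral at each point, its invariance holds everywhere
  and gives a genuine profile, although \<open>f\<close> is radial only a.e.\<close>

lemma radial_real_gconv:
  fixes f :: "'a::euclidean_space \<Rightarrow> complex"
  assumes t: "t > 0" and [measurable]: "f \<in> borel_measurable borel" and f: "radial_real f"
  shows "radial_real (gconv t f)"
proof -
  obtain \<phi> where \<phi>: "AE x in lborel. f x = complex_of_real (\<phi> (norm x))"
    using f by (auto simp: radial_real_def)
  have inv: "gconv t f (reflect v x) = gconv t f x" for v x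
  proof -
    have "gconv t f (reflect v x) = (\<integral>y. gauss t (reflect v x - y) *\<^sub>R f y \<partial>distr lborel borel (reflect v))"
      by (simp add: gconv_def lborel_distr_reflect)
    also have "\<dots> = (\<integral>y. gauss t (reflect v x - reflect v y) *\<^sub>R f (reflect v y) \<partial>lborel)"
      by (rule integral_distr) simp_all
    also have "\<dots> = (\<integral>y. gauss t (x - y) *\<^sub>R f y \<partial>lborel)"
    proof (rule integral_cong_AE)
      have "AE y in distr lborel borel (reflect v). f y = complex_of_real (\<phi> (norm y))"
        using \<phi> by (simp only: lborel_distr_reflect)
      then have "AE y in lborel. f (reflect v y) = complex_of_real (\<phi> (norm (reflect v y)))"
        by (intro AE_distrD[of _ lborel borel]) simp_all
      with \<phi> show "AE y in lborel. gauss t (reflect v x - reflect v y) *\<^sub>R f (reflect v y) = gauss t (x - y) *\<^sub>R f y"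
        by eventually_elim (simp add: norm_reflect gauss_def gsym_def flip: reflect_diff)
    qed measurable
    finally show ?thesis by (simp add: gconv_def)
  qed
  have real: "gconv t f x = complex_of_real (\<integral>y. gauss t (x - y) * Re (f y) \<partial>lborel)" for x
  proof -
    have "gconv t f x = (\<integral>y. complex_of_real (gauss t (x - y) * Re (f y)) \<partial>lborel)"
      unfolding gconv_def using \<phi> by (intro integral_cong_AE) (auto simp: scaleR_conv_of_real)
    then show ?thesis by (simp only: integral_complex_of_real)
  qed
  \<comment> \<open>Any fixed unit vector gives the profile: the reflection along
    \<open>x - norm x *\<^sub>R e\<close> carries \<open>x\<close> to
    \<open>norm x *\<^sub>R e\<close>.\<close>
  obtain e :: 'a where e: "e \<in> Basis" using nonempty_Basis by blast
  have "gconv t f x = complex_of_real (Re (gconv t f (norm x *\<^sub>R e)))" for x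
  proof -
    have "norm x = norm (norm x *\<^sub>R e)" using e by simp
    from reflect_swap[OF this] inv[of "x - norm x *\<^sub>R e" x]
    have "gconv t f (norm x *\<^sub>R e) = gconv t f x" by simp
    then show ?thesis using real[of x] by simp
  qed
  then show ?thesis by (intro radial_realI[where \<phi> = "\<lambda>r. Re (gconv t f (r *\<^sub>R e))"] AE_I2)
qed

section \<open>Fourier multipliers\<close>

lemma multiplier_eq: "fourier_multiplier_L2 \<mu> f = fourier 1 (\<lambda>\<xi>. of_real (\<mu> \<xi>) * fourier (-1) f \<xi>)"
  by (simp add: fourier_multiplier_L2_def fourier_L2_eq inverse_fourier_L2_eq)

lemmas fourier_mem' = fourier_mem[of 1, simplified] fourier_mem[of "-1", simplified]

lemma symbol_mult_mem:
  fixes g :: "'a::euclidean_space \<Rightarrow> complex"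
  assumes [measurable]: "\<mu> \<in> borel_measurable borel" and "\<And>\<xi>. \<bar>\<mu> \<xi>\<bar> \<le> M" and g: "g \<in> Lp 2"
  shows "(\<lambda>\<xi>. of_real (\<mu> \<xi>) * g \<xi>) \<in> Lp 2"
proof (rule Lp_bound(1))
  note [measurable] = g
  show "(\<lambda>\<xi>. of_real M * g \<xi>) \<in> Lp 2" by (intro Lp_cmult g) simp
  show "AE \<xi> in lborel. norm (of_real (\<mu> \<xi>) * g \<xi>) \<le> norm (of_real M * g \<xi>)"
    using assms(2) by (intro AE_I2) (auto simp: norm_mult intro!: mult_right_mono order_trans[OF assms(2) abs_ge_self])
  show "(\<lambda>\<xi>. of_real (\<mu> \<xi>) * g \<xi>) \<in> borel_measurable borel" by measurable
qed simp

lemma Lp_tendsto_symbol_mult: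
  fixes g :: "'a::euclidean_space \<Rightarrow> complex"
  assumes [measurable]: "\<mu> \<in> borel_measurable borel" and "\<And>\<xi>. \<bar>\<mu> \<xi>\<bar> \<le> M"
    and F: "\<And>k. F k \<in> Lp 2" "g \<in> Lp 2" "Lp_tendsto 2 F g"
  shows "Lp_tendsto 2 (\<lambda>k \<xi>. of_real (\<mu> \<xi>) * F k \<xi>) (\<lambda>\<xi>. of_real (\<mu> \<xi>) * g \<xi>)"
proof (rule Lp_tendsto_squeeze)
  fix k
  note [measurable] = F(1)[of k] F(2)
  have d: "(\<lambda>\<xi>. F k \<xi> - g \<xi>) \<in> Lp 2" by (intro Lp_diff F) simp
  have "Lp_norm 2 (\<lambda>\<xi>. of_real (\<mu> \<xi>) * F k \<xi> - of_real (\<mu> \<xi>) * g \<xi>) \<le> Lp_norm 2 (\<lambda>\<xi>. of_real M * (F k \<xi> - g \<xi>))"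
  proof (rule Lp_bound(2))
    show "(\<lambda>\<xi>. of_real M * (F k \<xi> - g \<xi>)) \<in> Lp 2" by (intro Lp_cmult d) simp
    show "AE \<xi> in lborel. norm (of_real (\<mu> \<xi>) * F k \<xi> - of_real (\<mu> \<xi>) * g \<xi>) \<le> norm (of_real M * (F k \<xi> - g \<xi>))"
      by (intro AE_I2) (auto simp: norm_mult right_diff_distrib[symmetric] intro!: mult_right_mono order_trans[OF assms(2) abs_ge_self])
  qed simp_all
  then show "Lp_norm 2 (\<lambda>\<xi>. of_real (\<mu> \<xi>) * F k \<xi> - of_real (\<mu> \<xi>) * g \<xi>) \<le> \<bar>M\<bar> * Lp_norm 2 (\<lambda>\<xi>. F k \<xi> - g \<xi>)"
    by (simp add: Lp_cmult d)
next
  show "(\<lambda>k. \<bar>M\<bar> * Lp_norm 2 (\<lambda>\<xi>. F k \<xi> - g \<xi>)) \<longlonglongrightarrow> 0"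
    using F(3) by (auto simp: Lp_tendsto_def intro: tendsto_mult_right_zero)
qed

context
  fixes \<mu> :: "'a::euclidean_space \<Rightarrow> real" and M :: real
  assumes \<mu> [measurable]: "\<mu> \<in> borel_measurable borel" and M: "\<And>\<xi>. \<bar>\<mu> \<xi>\<bar> \<le> M"
begin

lemma multiplier_mem: "f \<in> Lp 2 \<Longrightarrow> fourier_multiplier_L2 \<mu> f \<in> Lp 2"
  unfolding multiplier_eq by (intro fourier_mem' symbol_mult_mem[OF \<mu> M])

lemma multiplier_tendsto:
  assumes "\<And>k. F k \<in> Lp 2" "f \<in> Lp 2" "Lp_tendsto 2 F f"
  shows "Lp_tendsto 2 (\<lambda>k. fourier_multiplier_L2 \<mu> (F k)) (fourier_multiplier_L2 \<mu> f)"
  unfolding multiplier_eq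
  by (intro fourier_tendsto Lp_tendsto_symbol_mult[OF \<mu> M] symbol_mult_mem[OF \<mu> M] fourier_mem' assms) simp_all

lemma multiplier_add:
  assumes f: "f \<in> Lp 2" and g: "g \<in> Lp 2"
  shows "AE x in lborel. fourier_multiplier_L2 \<mu> (\<lambda>y. f y + g y) x = fourier_multiplier_L2 \<mu> f x + fourier_multiplier_L2 \<mu> g x"
proof -
  let ?m = "\<lambda>f \<xi>. of_real (\<mu> \<xi>) * fourier (-1) f \<xi>"
  have fg: "(\<lambda>y. f y + g y) \<in> Lp 2" by (intro Lp_add f g) simp
  have m: "?m f \<in> Lp 2" "?m g \<in> Lp 2" "?m (\<lambda>y. f y + g y) \<in> Lp 2"
    by (intro symbol_mult_mem[OF \<mu> M] fourier_mem' f g fg)+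
  have "AE x in lborel. fourier (-1) (\<lambda>y. f y + g y) x = fourier (-1) f x + fourier (-1) g x"
    by (rule fourier_add) (simp_all add: f g)
  then have "AE \<xi> in lborel. ?m (\<lambda>y. f y + g y) \<xi> = ?m f \<xi> + ?m g \<xi>"
    by eventually_elim (simp add: distrib_left)
  then have "AE x in lborel. fourier 1 (?m (\<lambda>y. f y + g y)) x = fourier 1 (\<lambda>\<xi>. ?m f \<xi> + ?m g \<xi>) x"
    by (intro fourier_cong_AE m Lp_add) simp_all
  moreover have "AE x in lborel. fourier 1 (\<lambda>\<xi>. ?m f \<xi> + ?m g \<xi>) x = fourier 1 (?m f) x + fourier 1 (?m g) x"
    by (rule fourier_add) (simp_all add: m)
  ultimately show ?thesis unfolding multiplier_eq by eventually_elim simp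
qed

lemma multiplier_cmult:
  assumes f: "f \<in> Lp 2"
  shows "AE x in lborel. fourier_multiplier_L2 \<mu> (\<lambda>y. c * f y) x = c * fourier_multiplier_L2 \<mu> f x"
proof -
  let ?m = "\<lambda>f \<xi>. of_real (\<mu> \<xi>) * fourier (-1) f \<xi>"
  have fg: "(\<lambda>y. c * f y) \<in> Lp 2" by (intro Lp_cmult f) simp
  have m: "?m f \<in> Lp 2" "?m (\<lambda>y. c * f y) \<in> Lp 2"
    by (intro symbol_mult_mem[OF \<mu> M] fourier_mem' f fg)+
  have "AE x in lborel. fourier (-1) (\<lambda>y. c * f y) x = c * fourier (-1) f x"
    by (rule fourier_cmult) (simp_all add: f)
  then have "AE \<xi> in lborel. ?m (\<lambda>y. c * f y) \<xi> = c * ?m f \<xi>"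
    by eventually_elim (simp add: mult.left_commute)
  then have "AE x in lborel. fourier 1 (?m (\<lambda>y. c * f y)) x = fourier 1 (\<lambda>\<xi>. c * ?m f \<xi>) x"
    by (intro fourier_cong_AE m Lp_cmult) simp_all
  moreover have "AE x in lborel. fourier 1 (\<lambda>\<xi>. c * ?m f \<xi>) x = c * fourier 1 (?m f) x"
    by (rule fourier_cmult) (simp_all add: m)
  ultimately show ?thesis unfolding multiplier_eq by eventually_elim simp
qed

lemma fourier_multiplier:
  assumes f: "f \<in> Lp 2"
  shows "AE \<xi> in lborel. fourier (-1) (fourier_multiplier_L2 \<mu> f) \<xi> = of_real (\<mu> \<xi>) * fourier (-1) f \<xi>"
  unfolding multiplier_eq
  using fourier_inversion[of 1, OF _ symbol_mult_mem[OF \<mu> M fourier_mem'(2)[OF f]]] by simp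

text \<open>By inversion an operator is determined by what it does on the Fourier side. Sums,
  products and constants of symbols are all recognised in this way.\<close>

lemma symbol_AE_eq:
  assumes f: "f \<in> Lp 2" and h: "h \<in> Lp 2"
    and "AE \<xi> in lborel. fourier (-1) h \<xi> = of_real (\<mu> \<xi>) * fourier (-1) f \<xi>"
  shows "AE x in lborel. fourier_multiplier_L2 \<mu> f x = h x"
proof -
  have "AE x in lborel. fourier 1 (fourier (-1) h) x = fourier_multiplier_L2 \<mu> f x"
    unfolding multiplier_eq by (intro fourier_cong_AE symbol_mult_mem[OF \<mu> M] fourier_mem' f h assms) simp
  moreover have "AE x in lborel. fourier 1 (fourier (-1) h) x = h x"
    using fourier_inversion[of "-1", OF _ h] by simp
  ultimately show ?thesis by eventually_elim simp
qed

end

lemma multiplier_compose: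
  assumes \<mu>: "\<mu> \<in> borel_measurable borel" "\<And>\<xi>. \<bar>\<mu> \<xi>\<bar> \<le> A" and \<nu>: "\<nu> \<in> borel_measurable borel" "\<And>\<xi>. \<bar>\<nu> \<xi>\<bar> \<le> B"
    and f: "f \<in> Lp 2"
  shows "AE x in lborel. fourier_multiplier_L2 (\<lambda>\<xi>. \<mu> \<xi> * \<nu> \<xi>) f x = fourier_multiplier_L2 \<mu> (fourier_multiplier_L2 \<nu> f) x"
proof (rule symbol_AE_eq[where M = "A * B"])
  have A0: "A \<ge> 0" using \<mu>(2)[of 0] by linarith
  show "\<bar>\<mu> \<xi> * \<nu> \<xi>\<bar> \<le> A * B" for \<xi>
    using mult_mono[OF \<mu>(2)[of \<xi>] \<nu>(2)[of \<xi>]] A0 by (simp add: abs_mult)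
  show "(\<lambda>\<xi>. \<mu> \<xi> * \<nu> \<xi>) \<in> borel_measurable borel" using \<mu>(1) \<nu>(1) by measurable
  show g: "fourier_multiplier_L2 \<mu> (fourier_multiplier_L2 \<nu> f) \<in> Lp 2"
    by (intro multiplier_mem[OF \<mu>] multiplier_mem[OF \<nu>] f)
  show "AE \<xi> in lborel. fourier (-1) (fourier_multiplier_L2 \<mu> (fourier_multiplier_L2 \<nu> f)) \<xi> = of_real (\<mu> \<xi> * \<nu> \<xi>) * fourier (-1) f \<xi>"
    using fourier_multiplier[OF \<mu> multiplier_mem[OF \<nu> f]] fourier_multiplier[OF \<nu> f] by eventually_elim simp
qed (rule f)

text \<open>One constant bounds both the symbol and the operator. The bound on the symbol makes the
  operator bounded on L^2 and gives dominated convergence when symbols converge; the bound on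
  \<open>Lp p\<close> and the preservation of real radial functions then pass to the limit without
  loss.\<close>

definition Lp_multiplier :: "real \<Rightarrow> real \<Rightarrow> ('a::euclidean_space \<Rightarrow> real) \<Rightarrow> bool" where
  "Lp_multiplier p M \<mu> \<longleftrightarrow> \<mu> \<in> borel_measurable borel \<and> (\<forall>\<xi>. \<bar>\<mu> \<xi>\<bar> \<le> M) \<and>
     (\<forall>f\<in>Lp 2 \<inter> Lp p. fourier_multiplier_L2 \<mu> f \<in> Lp p \<and>
        Lp_norm p (fourier_multiplier_L2 \<mu> f) \<le> M * Lp_norm p f \<and>
        (radial_real f \<longrightarrow> radial_real (fourier_multiplier_L2 \<mu> f)))"

lemma Lp_multiplierD:
  assumes "Lp_multiplier p M \<mu>"
  shows "\<mu> \<in> borel_measurable borel" "\<bar>\<mu> \<xi>\<bar> \<le> M"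
    and "f \<in> Lp 2 \<Longrightarrow> f \<in> Lp p \<Longrightarrow> fourier_multiplier_L2 \<mu> f \<in> Lp p"
    and "f \<in> Lp 2 \<Longrightarrow> f \<in> Lp p \<Longrightarrow> Lp_norm p (fourier_multiplier_L2 \<mu> f) \<le> M * Lp_norm p f"
    and "f \<in> Lp 2 \<Longrightarrow> f \<in> Lp p \<Longrightarrow> radial_real f \<Longrightarrow> radial_real (fourier_multiplier_L2 \<mu> f)"
  using assms unfolding Lp_multiplier_def by blast+

text \<open>The conditions on the image of \<open>f\<close> are invariant under equality a.e., so
  any convenient representative \<open>h\<close> of it will do.\<close>

lemma Lp_multiplierI:
  assumes \<mu>: "\<mu> \<in> borel_measurable borel" and M: "\<And>\<xi>. \<bar>\<mu> \<xi>\<bar> \<le> M"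
    and ex: "\<And>f. f \<in> Lp 2 \<Longrightarrow> f \<in> Lp p \<Longrightarrow>
       \<exists>h. h \<in> Lp p \<and> (AE x in lborel. fourier_multiplier_L2 \<mu> f x = h x) \<and> Lp_norm p h \<le> M * Lp_norm p f \<and>
           (radial_real f \<longrightarrow> radial_real h)"
  shows "Lp_multiplier p M \<mu>"
  unfolding Lp_multiplier_def
proof (intro conjI ballI)
  fix f :: "'a \<Rightarrow> complex" assume "f \<in> Lp 2 \<inter> Lp p"
  then have f: "f \<in> Lp 2" "f \<in> Lp p" by auto
  obtain h where h: "h \<in> Lp p" "AE x in lborel. fourier_multiplier_L2 \<mu> f x = h x" "Lp_norm p h \<le> M * Lp_norm p f"
    "radial_real f \<longrightarrow> radial_real h" using ex[OF f] by blast
  have h': "AE x in lborel. h x = fourier_multiplier_L2 \<mu> f x" using h(2) by eventually_elim simp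
  have m: "fourier_multiplier_L2 \<mu> f \<in> borel_measurable borel"
    using multiplier_mem[OF \<mu> M f(1)] by (simp add: Lp_iff)
  show "fourier_multiplier_L2 \<mu> f \<in> Lp p"
    by (rule Lp_cong_AE[OF h(1) m h'])
  show "Lp_norm p (fourier_multiplier_L2 \<mu> f) \<le> M * Lp_norm p f"
    using Lp_norm_cong_AE[OF m Lp_measurable[OF h(1)] h(2)] h(3) by simp
  show "radial_real f \<longrightarrow> radial_real (fourier_multiplier_L2 \<mu> f)"
    using h(4) radial_real_cong_AE[OF _ h'] by blast
qed (use \<mu> M in auto)

lemma Lp_multiplier_mono:
  assumes "Lp_multiplier p M \<mu>" "M \<le> M'"
  shows "Lp_multiplier p M' \<mu>"
proof (rule Lp_multiplierI)
  fix f :: "'a \<Rightarrow> complex" assume f: "f \<in> Lp 2" "f \<in> Lp p"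
  have "M * Lp_norm p f \<le> M' * Lp_norm p f" using assms(2) by (intro mult_right_mono) auto
  then show "\<exists>h. h \<in> Lp p \<and> (AE x in lborel. fourier_multiplier_L2 \<mu> f x = h x) \<and> Lp_norm p h \<le> M' * Lp_norm p f \<and>
           (radial_real f \<longrightarrow> radial_real h)"
    using Lp_multiplierD(3-5)[OF assms(1) f] by (intro exI[of _ "fourier_multiplier_L2 \<mu> f"]) auto
qed (use Lp_multiplierD(1,2)[OF assms(1)] assms(2) order_trans in blast)+

lemma Lp_multiplier_const:
  fixes c :: real
  assumes p: "p \<ge> 1"
  shows "Lp_multiplier p \<bar>c\<bar> (\<lambda>\<xi>::'a::euclidean_space. c)"
proof (rule Lp_multiplierI)
  fix f :: "'a \<Rightarrow> complex" assume f: "f \<in> Lp 2" "f \<in> Lp p"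
  have "AE \<xi> in lborel. fourier (-1) (\<lambda>x. of_real c * f x) \<xi> = of_real c * fourier (-1) f \<xi>"
    by (rule fourier_cmult) (simp_all add: f)
  then have "AE x in lborel. fourier_multiplier_L2 (\<lambda>\<xi>. c) f x = of_real c * f x"
    by (intro symbol_AE_eq[where M = "\<bar>c\<bar>"] f Lp_cmult) simp_all
  then show "\<exists>h. h \<in> Lp p \<and> (AE x in lborel. fourier_multiplier_L2 (\<lambda>\<xi>. c) f x = h x) \<and> Lp_norm p h \<le> \<bar>c\<bar> * Lp_norm p f \<and>
           (radial_real f \<longrightarrow> radial_real h)"
    using Lp_cmult[OF _ f(2), of "of_real c"] p radial_real_cmult[of f c]
    by (intro exI[of _ "\<lambda>x. of_real c * f x"]) auto
qed simp_all

lemma Lp_multiplier_add: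
  assumes p: "p \<ge> 1" and a: "Lp_multiplier p A \<mu>" and b: "Lp_multiplier p B \<nu>"
  shows "Lp_multiplier p (A + B) (\<lambda>\<xi>. \<mu> \<xi> + \<nu> \<xi>)"
proof (rule Lp_multiplierI)
  note \<mu> = Lp_multiplierD(1,2)[OF a] and \<nu> = Lp_multiplierD(1,2)[OF b]
  show m: "(\<lambda>\<xi>. \<mu> \<xi> + \<nu> \<xi>) \<in> borel_measurable borel" using \<mu>(1) \<nu>(1) by measurable
  show M: "\<bar>\<mu> \<xi> + \<nu> \<xi>\<bar> \<le> A + B" for \<xi> using \<mu>(2)[of \<xi>] \<nu>(2)[of \<xi>] by linarith
  fix f :: "'a \<Rightarrow> complex" assume f: "f \<in> Lp 2" "f \<in> Lp p"
  let ?h = "\<lambda>x. fourier_multiplier_L2 \<mu> f x + fourier_multiplier_L2 \<nu> f x"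
  have 2: "fourier_multiplier_L2 \<mu> f \<in> Lp 2" "fourier_multiplier_L2 \<nu> f \<in> Lp 2"
    by (intro multiplier_mem[OF \<mu>] multiplier_mem[OF \<nu>] f)+
  have "AE \<xi> in lborel. fourier (-1) ?h \<xi> = fourier (-1) (fourier_multiplier_L2 \<mu> f) \<xi> + fourier (-1) (fourier_multiplier_L2 \<nu> f) \<xi>"
    by (rule fourier_add) (simp_all add: 2)
  then have "AE \<xi> in lborel. fourier (-1) ?h \<xi> = of_real (\<mu> \<xi> + \<nu> \<xi>) * fourier (-1) f \<xi>"
    using fourier_multiplier[OF \<mu> f(1)] fourier_multiplier[OF \<nu> f(1)]
    by eventually_elim (simp add: distrib_right)
  then have e: "AE x in lborel. fourier_multiplier_L2 (\<lambda>\<xi>. \<mu> \<xi> + \<nu> \<xi>) f x = ?h x"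
    by (intro symbol_AE_eq[OF m M] f Lp_add 2) simp_all
  have "Lp_norm p ?h \<le> (A + B) * Lp_norm p f"
    using Lp_add(2)[OF p Lp_multiplierD(3)[OF a f] Lp_multiplierD(3)[OF b f]]
      Lp_multiplierD(4)[OF a f] Lp_multiplierD(4)[OF b f] by (simp add: distrib_right)
  with e show "\<exists>h. h \<in> Lp p \<and> (AE x in lborel. fourier_multiplier_L2 (\<lambda>\<xi>. \<mu> \<xi> + \<nu> \<xi>) f x = h x) \<and>
      Lp_norm p h \<le> (A + B) * Lp_norm p f \<and> (radial_real f \<longrightarrow> radial_real h)"
    using Lp_add(1)[OF p Lp_multiplierD(3)[OF a f] Lp_multiplierD(3)[OF b f]]
      radial_real_add Lp_multiplierD(5)[OF a f] Lp_multiplierD(5)[OF b f] by blast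
qed

lemma Lp_multiplier_mult:
  assumes a: "Lp_multiplier p A \<mu>" and b: "Lp_multiplier p B \<nu>"
  shows "Lp_multiplier p (A * B) (\<lambda>\<xi>. \<mu> \<xi> * \<nu> \<xi>)"
proof (rule Lp_multiplierI)
  note \<mu> = Lp_multiplierD(1,2)[OF a] and \<nu> = Lp_multiplierD(1,2)[OF b]
  show "(\<lambda>\<xi>. \<mu> \<xi> * \<nu> \<xi>) \<in> borel_measurable borel" using \<mu>(1) \<nu>(1) by measurable
  have A0: "A \<ge> 0" using \<mu>(2)[of 0] by linarith
  show "\<bar>\<mu> \<xi> * \<nu> \<xi>\<bar> \<le> A * B" for \<xi>
    using mult_mono[OF \<mu>(2)[of \<xi>] \<nu>(2)[of \<xi>]] A0 by (simp add: abs_mult)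
  fix f :: "'a \<Rightarrow> complex" assume f: "f \<in> Lp 2" "f \<in> Lp p"
  let ?g = "fourier_multiplier_L2 \<nu> f"
  let ?h = "fourier_multiplier_L2 \<mu> ?g"
  have g: "?g \<in> Lp 2" "?g \<in> Lp p"
    by (intro multiplier_mem[OF \<nu>] Lp_multiplierD(3)[OF b] f)+
  have e: "AE x in lborel. fourier_multiplier_L2 (\<lambda>\<xi>. \<mu> \<xi> * \<nu> \<xi>) f x = ?h x"
    by (rule multiplier_compose[OF \<mu> \<nu> f(1)])
  have "Lp_norm p ?h \<le> A * (B * Lp_norm p f)"
    using Lp_multiplierD(4)[OF a g] mult_left_mono[OF Lp_multiplierD(4)[OF b f] A0] by linarith
  with e show "\<exists>h. h \<in> Lp p \<and> (AE x in lborel. fourier_multiplier_L2 (\<lambda>\<xi>. \<mu> \<xi> * \<nu> \<xi>) f x = h x) \<and>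
      Lp_norm p h \<le> A * B * Lp_norm p f \<and> (radial_real f \<longrightarrow> radial_real h)"
    using Lp_multiplierD(3,5)[OF a g] Lp_multiplierD(5)[OF b f] by (intro exI[of _ ?h]) (simp add: mult.assoc)
qed

text \<open>Dominated convergence on the Fourier side, with \<open>M\<close> times the transform of
  \<open>f\<close> as majorant; continuity of the inverse transform brings it back.\<close>

lemma multiplier_symbol_tendsto:
  assumes \<mu>: "\<And>k. \<mu> k \<in> borel_measurable borel" and M: "\<And>k \<xi>. \<bar>\<mu> k \<xi>\<bar> \<le> M"
    and \<nu>: "\<nu> \<in> borel_measurable borel" and lim: "\<And>\<xi>. (\<lambda>k. \<mu> k \<xi>) \<longlonglongrightarrow> \<nu> \<xi>" and f: "f \<in> Lp 2"
  shows "Lp_tendsto 2 (\<lambda>k. fourier_multiplier_L2 (\<mu> k) f) (fourier_multiplier_L2 \<nu> f)"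
proof -
  have M': "\<bar>\<nu> \<xi>\<bar> \<le> M" for \<xi>
    by (rule LIMSEQ_le_const2[OF tendsto_rabs[OF lim]]) (use M in auto)
  note [measurable] = \<mu> \<nu> fourier_mem'(2)[OF f]
  have w: "(\<lambda>\<xi>. of_real M * fourier (-1) f \<xi>) \<in> Lp 2" by (intro Lp_cmult fourier_mem' f) simp
  have "Lp_tendsto 2 (\<lambda>k \<xi>. of_real (\<mu> k \<xi>) * fourier (-1) f \<xi>) (\<lambda>\<xi>. of_real (\<nu> \<xi>) * fourier (-1) f \<xi>)"
    unfolding Lp_tendsto_def
  proof (rule Lp_dominated(3)[OF one_le_numeral w])
    show "AE \<xi> in lborel. (\<lambda>k. of_real (\<mu> k \<xi>) * fourier (-1) f \<xi>) \<longlonglongrightarrow> of_real (\<nu> \<xi>) * fourier (-1) f \<xi>"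
      by (intro AE_I2 tendsto_intros lim)
    show "AE \<xi> in lborel. norm (of_real (\<mu> k \<xi>) * fourier (-1) f \<xi>) \<le> norm (of_real M * fourier (-1) f \<xi>)" for k
      by (intro AE_I2) (auto simp: norm_mult intro!: mult_right_mono order_trans[OF M abs_ge_self])
  qed measurable
  then show ?thesis
    unfolding multiplier_eq
    by (intro fourier_tendsto symbol_mult_mem[OF \<mu> M] symbol_mult_mem[OF \<nu> M'] fourier_mem' f) simp_all
qed

text \<open>Convergence is available only in L^2, the bound only in \<open>Lp p\<close>. An a.e.
  convergent subsequence connects them, and Fatou carries the bound over.\<close>

lemma Lp_bounded_L2_limit:
  assumes p: "p \<ge> 1" and F: "\<And>k. F k \<in> Lp 2" "\<And>k. F k \<in> Lp p" and h: "h \<in> Lp 2"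
    and lim: "Lp_tendsto 2 F h" and le: "\<And>k. Lp_norm p (F k) \<le> K"
  shows "h \<in> Lp p" "Lp_norm p h \<le> K" "(\<And>k. radial_real (F k)) \<Longrightarrow> radial_real h"
proof -
  obtain r :: "nat \<Rightarrow> nat" where r: "AE x in lborel. (\<lambda>k. F (r k) x) \<longlonglongrightarrow> h x"
    using Lp_tendsto_AE_subseq[of 2 F h] Lp_diff(1)[OF one_le_numeral F(1) h] lim
    by (auto simp: Lp_tendsto_def)
  have p0: "p > 0" using p by simp
  have l: "\<forall>\<^sub>F k in sequentially. Lp_norm p (F (r k)) \<le> K" using le by simp
  show "h \<in> Lp p" "Lp_norm p h \<le> K"
    by (rule Lp_Fatou[OF p0 Lp_measurable[OF h] F(2) r l])+
  show "radial_real h" if "\<And>k. radial_real (F k)"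
    by (rule radial_real_limit[OF that r])
qed

lemma Lp_multiplier_limit:
  assumes p: "p \<ge> 1" and m: "\<And>k. Lp_multiplier p M (\<mu> k)" and lim: "\<And>\<xi>. (\<lambda>k. \<mu> k \<xi>) \<longlonglongrightarrow> \<nu> \<xi>"
  shows "Lp_multiplier p M \<nu>"
proof (rule Lp_multiplierI)
  note \<mu> = Lp_multiplierD(1,2)[OF m]
  show \<nu>: "\<nu> \<in> borel_measurable borel" by (rule borel_measurable_LIMSEQ_real[OF lim \<mu>(1)])
  show M: "\<bar>\<nu> \<xi>\<bar> \<le> M" for \<xi>
    by (rule LIMSEQ_le_const2[OF tendsto_rabs[OF lim]]) (use \<mu> in auto)
  fix f :: "'a \<Rightarrow> complex" assume f: "f \<in> Lp 2" "f \<in> Lp p"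
  note L = Lp_bounded_L2_limit[OF p multiplier_mem[OF \<mu> f(1)] Lp_multiplierD(3)[OF m f] multiplier_mem[OF \<nu> M f(1)]
    multiplier_symbol_tendsto[OF \<mu> \<nu> lim f(1)] Lp_multiplierD(4)[OF m f]]
  show "\<exists>h. h \<in> Lp p \<and> (AE x in lborel. fourier_multiplier_L2 \<nu> f x = h x) \<and> Lp_norm p h \<le> M * Lp_norm p f \<and>
           (radial_real f \<longrightarrow> radial_real h)"
    using L(1,2) L(3)[OF Lp_multiplierD(5)[OF m f]] by (intro exI[of _ "fourier_multiplier_L2 \<nu> f"]) auto
qed

text \<open>Truncations are integrable, and for them the operator is the Gaussian convolution. A
  general \<open>f\<close> in \<open>Lp 2 \<inter> Lp p\<close> is reached through an L^2 limit,
  under the uniform bound by \<open>Lp_norm p f\<close>.\<close>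

lemma Lp_multiplier_gsym:
  assumes p: "p \<ge> 1" and t: "t > 0"
  shows "Lp_multiplier p 1 (gsym t :: 'a::euclidean_space \<Rightarrow> real)"
proof (rule Lp_multiplierI)
  have p0: "p > 0" using p by simp
  show m: "(gsym t :: 'a \<Rightarrow> real) \<in> borel_measurable borel" by simp
  show M: "\<bar>gsym t \<xi>\<bar> \<le> 1" for \<xi> :: 'a using gsym_le_1[of t \<xi>] t by (simp add: abs_of_pos[OF gsym_pos])
  fix f :: "'a \<Rightarrow> complex" assume f: "f \<in> Lp 2" "f \<in> Lp p"
  have fm: "f \<in> borel_measurable borel" using f by (simp add: Lp_iff)
  have tr: "q > 0 \<Longrightarrow> trunc k f \<in> Lp q" for k q using trunc_in_Lp fm by blast
  define F where "F k = gconv t (trunc k f)" for k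
  have F: "F k \<in> Lp 2" "F k \<in> Lp p" "Lp_norm p (F k) \<le> Lp_norm p (trunc k f)" for k
    unfolding F_def using p tr t by (auto intro!: gconv_Lp simp: integrable_iff_Lp1)
  have le: "Lp_norm p (F k) \<le> Lp_norm p f" for k
    using F(3)[of k] Lp_bound(2)[OF p0 f(2) trunc_measurable[OF fm]] norm_trunc_le(1) by (meson AE_I2 order_trans)
  have eq: "AE x in lborel. fourier_multiplier_L2 (gsym t) (trunc k f) x = F k x" for k
    unfolding multiplier_eq F_def using fourier_damped[of "-1" "trunc k f" t] tr t by simp
  have "Lp_tendsto 2 F (fourier_multiplier_L2 (gsym t) f)"
  proof (rule Lp_tendsto_cong_AE)
    show "Lp_tendsto 2 (\<lambda>k. fourier_multiplier_L2 (gsym t) (trunc k f)) (fourier_multiplier_L2 (gsym t) f)"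
      by (intro multiplier_tendsto[OF m M] tr f trunc_Lp_tendsto) simp_all
    show "fourier_multiplier_L2 (gsym t) (trunc k f) \<in> borel_measurable borel" for k
      by (intro Lp_measurable[of _ 2] multiplier_mem[OF m M] tr) simp
    show "fourier_multiplier_L2 (gsym t) f \<in> borel_measurable borel"
      by (intro Lp_measurable[of _ 2] multiplier_mem[OF m M] f)
    then show "fourier_multiplier_L2 (gsym t) f \<in> borel_measurable borel" .
    show "F k \<in> borel_measurable borel" for k by (rule Lp_measurable[OF F(1)])
  qed (use eq in auto)
  note L = Lp_bounded_L2_limit[OF p F(1,2) multiplier_mem[OF m M f(1)] this le]
  have "radial_real (F k)" if "radial_real f" for k
    unfolding F_def by (intro radial_real_gconv t trunc_measurable fm radial_real_trunc that)
  then show "\<exists>h. h \<in> Lp p \<and> (AE x in lborel. fourier_multiplier_L2 (gsym t) f x = h x) \<and> Lp_norm p h \<le> 1 * Lp_norm p f \<and>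
           (radial_real f \<longrightarrow> radial_real h)"
    using L(1,2) L(3) by (intro exI[of _ "fourier_multiplier_L2 (gsym t) f"]) auto
qed

lemma Lp_multiplier_extension_exists:
  assumes p: "p \<ge> 1" and m: "Lp_multiplier p M \<mu>"
  shows "\<exists>B. bounded_extension p (Lp 2 \<inter> Lp p) (fourier_multiplier_L2 \<mu>) B"
proof (rule bounded_extension_exists[OF p])
  note \<mu> = Lp_multiplierD(1,2)[OF m]
  fix f g :: "'a \<Rightarrow> complex" and c
  assume fg: "f \<in> Lp 2 \<inter> Lp p" "g \<in> Lp 2 \<inter> Lp p"
  then show "(\<lambda>x. f x + g x) \<in> Lp 2 \<inter> Lp p" using p by (auto intro: Lp_add)
  show "AE x in lborel. fourier_multiplier_L2 \<mu> (\<lambda>y. f y + g y) x = fourier_multiplier_L2 \<mu> f x + fourier_multiplier_L2 \<mu> g x"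
    using fg by (intro multiplier_add[OF \<mu>]) auto
next
  note \<mu> = Lp_multiplierD(1,2)[OF m]
  fix f :: "'a \<Rightarrow> complex" and c
  assume f: "f \<in> Lp 2 \<inter> Lp p"
  then show "(\<lambda>x. c * f x) \<in> Lp 2 \<inter> Lp p" using p by (auto intro: Lp_cmult)
  show "AE x in lborel. fourier_multiplier_L2 \<mu> (\<lambda>y. c * f y) x = c * fourier_multiplier_L2 \<mu> f x"
    using f by (intro multiplier_cmult[OF \<mu>]) auto
  show "fourier_multiplier_L2 \<mu> f \<in> Lp p" "Lp_norm p (fourier_multiplier_L2 \<mu> f) \<le> M * Lp_norm p f"
    using Lp_multiplierD(3,4)[OF m, of f] f by auto
next
  fix f :: "'a \<Rightarrow> complex" and k assume "f \<in> Lp p"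
  then have "f \<in> borel_measurable borel" by (simp add: Lp_iff)
  then show "trunc k f \<in> Lp 2 \<inter> Lp p" using p by (auto intro!: trunc_in_Lp)
qed auto

text \<open>Preservation of radial functions is known for the multiplier on
  \<open>Lp 2 \<inter> Lp p\<close>; truncations and an a.e. convergent subsequence of their images
  carry it to the extension.\<close>

lemma Lp_multiplier_extension_radial_real:
  fixes f :: "'a::euclidean_space \<Rightarrow> complex"
  assumes p: "p \<ge> 1" and m: "Lp_multiplier p M \<mu>"
    and B: "bounded_extension p (Lp 2 \<inter> Lp p) (fourier_multiplier_L2 \<mu>) B"
    and f: "f \<in> Lp p" "radial_real f"
  shows "radial_real (B f)"
proof -
  have lin: "bounded_linear_Lp p B"
    and eq: "\<And>f. f \<in> Lp 2 \<Longrightarrow> f \<in> Lp p \<Longrightarrow> AE x in lborel. B f x = fourier_multiplier_L2 \<mu> f x"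
    using B by (auto simp: bounded_extension_def)
  have fm: "f \<in> borel_measurable borel" using f by (simp add: Lp_iff)
  have tr: "q > 0 \<Longrightarrow> trunc k f \<in> Lp q" for k q using trunc_in_Lp fm by blast
  have trp: "trunc k f \<in> Lp p" "trunc k f \<in> Lp 2" for k using tr p by auto
  have "radial_real (B (trunc k f))" for k
  proof (rule radial_real_cong_AE)
    show "radial_real (fourier_multiplier_L2 \<mu> (trunc k f))"
      by (intro Lp_multiplierD(5)[OF m] trp radial_real_trunc f)
    show "AE x in lborel. fourier_multiplier_L2 \<mu> (trunc k f) x = B (trunc k f) x"
      using eq[OF trp(2,1), of k] by eventually_elim simp
  qed
  moreover have "Lp_tendsto p (\<lambda>k. B (trunc k f)) (B f)"
    by (intro bounded_linear_Lp_tendsto[OF p lin] trp f trunc_Lp_tendsto p)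
  then obtain r :: "nat \<Rightarrow> nat" where "AE x in lborel. (\<lambda>k. B (trunc (r k) f) x) \<longlonglongrightarrow> B f x"
    using Lp_tendsto_AE_subseq[of p "\<lambda>k. B (trunc k f)" "B f"] p
      Lp_diff(1)[OF p bounded_linear_Lp_mem[OF p lin trp(1)] bounded_linear_Lp_mem[OF p lin f(1)]]
    by (auto simp: Lp_tendsto_def)
  ultimately show ?thesis by (rule radial_real_limit[of "\<lambda>k. B (trunc (r k) f)"])
qed

section \<open>Bessel-type symbols\<close>

lemma Lp_multiplier_cmult:
  assumes "p \<ge> 1" "Lp_multiplier p M \<mu>"
  shows "Lp_multiplier p (\<bar>c\<bar> * M) (\<lambda>\<xi>. c * \<mu> \<xi>)"
  by (intro Lp_multiplier_mult Lp_multiplier_const assms)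

lemma Lp_multiplier_power:
  assumes p: "p \<ge> 1" and m: "Lp_multiplier p M \<mu>"
  shows "Lp_multiplier p (M ^ k) (\<lambda>\<xi>. \<mu> \<xi> ^ k)"
proof (induction k)
  case 0
  show ?case using Lp_multiplier_const[OF p, of 1] by simp
next
  case (Suc k)
  show ?case using Lp_multiplier_mult[OF m Suc] by simp
qed

text \<open>Powers of a contraction are contractions, so the norm of a partial sum is at most the
  sum of its coefficients. Partial sums converge pointwise as symbols, which suffices for the
  limit.\<close>

lemma Lp_multiplier_power_series:
  fixes c :: "nat \<Rightarrow> real"
  assumes p: "p \<ge> 1" and E: "Lp_multiplier p 1 E" and c: "\<And>k. c k \<ge> 0" "\<And>n. (\<Sum>k<n. c k) \<le> 1"
    and sums: "\<And>\<xi>. (\<lambda>k. c k * E \<xi> ^ k) sums \<phi> \<xi>"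
  shows "Lp_multiplier p 1 \<phi>"
proof (rule Lp_multiplier_limit[OF p])
  show "(\<lambda>n. \<Sum>k<n. c k * E \<xi> ^ k) \<longlonglongrightarrow> \<phi> \<xi>" for \<xi>
    using sums by (simp add: sums_def)
  have "Lp_multiplier p (\<Sum>k<n. c k) (\<lambda>\<xi>. \<Sum>k<n. c k * E \<xi> ^ k)" for n
  proof (induction n)
    case 0
    show ?case using Lp_multiplier_const[OF p, of 0] by simp
  next
    case (Suc n)
    have "Lp_multiplier p (c n) (\<lambda>\<xi>. c n * E \<xi> ^ n)"
      using Lp_multiplier_cmult[OF p Lp_multiplier_power[OF p E, of n], of "c n"] c(1)[of n] by simp
    from Lp_multiplier_add[OF p Suc this] show ?case by simp
  qed
  then show "Lp_multiplier p 1 (\<lambda>\<xi>. \<Sum>k<n. c k * E \<xi> ^ k)" for n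
    using c(2)[of n] by (rule Lp_multiplier_mono)
qed

lemma partial_sums_le:
  fixes c :: "nat \<Rightarrow> real"
  assumes "\<And>k. c k \<ge> 0" "c sums s"
  shows "(\<Sum>k<n. c k) \<le> s"
  using sum_le_suminf[of c "{..<n}"] assms by (auto simp: sums_iff)

text \<open>The binomial series with the signs absorbed. For \<open>a \<ge> 0\<close> all
  coefficients are nonnegative, which serves negative powers; for \<open>a\<close> between -1 and 0
  all but the constant one are nonpositive, which serves
  \<open>1 - (1 - z) powr \<theta>\<close>.\<close>

lemma pochhammer_series:
  fixes a z :: real
  assumes "\<bar>z\<bar> < 1"
  shows "(\<lambda>k. pochhammer a k / fact k * z ^ k) sums (1 - z) powr (- a)"
proof -
  have "(- a gchoose k) * (- z) ^ k = pochhammer a k / fact k * z ^ k" for k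
  proof -
    have "(- a gchoose k) * (- z) ^ k = ((-1) ^ k * (-1) ^ k) * (pochhammer a k / fact k * z ^ k)"
      unfolding gbinomial_pochhammer power_minus[of z k] minus_minus by (simp only: mult_ac times_divide_eq_left times_divide_eq_right)
    also have "(-1) ^ k * (-1) ^ k = (1 :: real)" by (simp add: power_add[symmetric])
    finally show ?thesis by simp
  qed
  then show ?thesis using gen_binomial_real[of "- z" "- a"] assms by simp
qed

lemma Lp_multiplier_one_minus_powr:
  assumes p: "p \<ge> 1" and E: "Lp_multiplier p 1 E" and E01: "\<And>\<xi>. 0 \<le> E \<xi>" "\<And>\<xi>. E \<xi> < 1"
    and \<theta>: "0 < \<theta>" "\<theta> < 1"
  shows "Lp_multiplier p 1 (\<lambda>\<xi>. 1 - (1 - E \<xi>) powr \<theta>)"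
proof -
  \<comment> \<open>Subtracting from \<open>1\<close> removes the constant coefficient and reverses
    the other signs, which \<open>\<theta> < 1\<close> then makes nonnegative.\<close>
  define c where "c k = (if k = 0 then 0 else - (pochhammer (- \<theta>) k / fact k))" for k
  have c0: "c k \<ge> 0" for k
  proof (cases k)
    case (Suc j)
    have "pochhammer (1 - \<theta>) j \<ge> 0" using \<theta> by (intro pochhammer_nonneg) simp
    then have "- \<theta> * pochhammer (- \<theta> + 1) j \<le> 0" using \<theta> by (intro mult_nonpos_nonneg) simp_all
    then have "pochhammer (- \<theta>) (Suc j) \<le> 0" by (simp only: pochhammer_rec)
    then show ?thesis using Suc by (simp add: c_def divide_nonpos_pos)
  qed (simp add: c_def)
  have sums: "(\<lambda>k. c k * z ^ k) sums (1 - (1 - z) powr \<theta>)" if "0 \<le> z" "z < 1" for z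
  proof -
    have "(\<lambda>k. (if k = 0 then 1 else 0) - pochhammer (- \<theta>) k / fact k * z ^ k) sums (1 - (1 - z) powr \<theta>)"
      using pochhammer_series[of z "- \<theta>"] that by (intro sums_diff sums_single) simp
    moreover have "(if k = 0 then 1 else 0) - pochhammer (- \<theta>) k / fact k * z ^ k = c k * z ^ k" for k
      by (simp add: c_def)
    ultimately show ?thesis by simp
  qed
  \<comment> \<open>The series is available for \<open>z < 1\<close> only, where each partial sum is
    at most \<open>1 - (1 - z) powr \<theta>\<close>, hence at most 1. As the sum is finite,
    \<open>z\<close> can tend to 1 in it.\<close>
  have "(\<Sum>k<n. c k) \<le> 1" for n
  proof -
    have "((\<lambda>z. \<Sum>k<n. c k * z ^ k) \<longlongrightarrow> (\<Sum>k<n. c k * 1 ^ k)) (at_left 1)"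
      by (intro tendsto_intros)
    moreover have "\<forall>\<^sub>F z in at_left 1. (\<Sum>k<n. c k * z ^ k) \<le> 1"
      using eventually_at_left_real[of 0 1]
    proof (rule eventually_mono)
      fix z :: real assume "z \<in> {0<..<1}"
      then have z: "0 \<le> z" "z < 1" by auto
      have "(\<Sum>k<n. c k * z ^ k) \<le> 1 - (1 - z) powr \<theta>"
        using partial_sums_le[OF _ sums[OF z]] c0 z by simp
      then show "(\<Sum>k<n. c k * z ^ k) \<le> 1" by (smt (verit) powr_ge_zero)
    qed simp
    ultimately show ?thesis using tendsto_upperbound by fastforce
  qed
  then show ?thesis
    by (intro Lp_multiplier_power_series[where c = c, OF p E c0]) (use sums E01 in auto)
qed

text \<open>\<open>exp (- t) * exp (t * \<phi> \<xi>)\<close> is expanded in powers of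
  \<open>\<phi> \<xi>\<close>: the coefficients are Poisson weights, of total 1.\<close>

lemma Lp_multiplier_exp:
  assumes p: "p \<ge> 1" and E: "Lp_multiplier p 1 \<phi>" and t: "t \<ge> 0"
  shows "Lp_multiplier p 1 (\<lambda>\<xi>. exp (- t * (1 - \<phi> \<xi>)))"
proof -
  define c where "c k = exp (- t) * (t ^ k / fact k)" for k
  have c0: "c k \<ge> 0" for k using t by (simp add: c_def)
  have exps: "(\<lambda>k. x ^ k / fact k) sums exp x" for x :: real
    using exp_converges[of x] by (simp add: divide_inverse mult.commute)
  have "(\<lambda>k. c k * \<phi> \<xi> ^ k) sums exp (- t * (1 - \<phi> \<xi>))" for \<xi>
  proof -
    have "(\<lambda>k. exp (- t) * ((t * \<phi> \<xi>) ^ k / fact k)) sums (exp (- t) * exp (t * \<phi> \<xi>))"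
      by (intro sums_mult exps)
    moreover have "exp (- t) * exp (t * \<phi> \<xi>) = exp (- t * (1 - \<phi> \<xi>))"
      by (simp add: exp_add[symmetric] algebra_simps)
    ultimately show ?thesis by (simp add: c_def power_mult_distrib mult_ac)
  qed
  moreover have "c sums (exp (- t) * exp t)" unfolding c_def by (intro sums_mult exps)
  then have "c sums 1" by (simp add: exp_add[symmetric])
  ultimately show ?thesis
    using partial_sums_le[OF c0] by (intro Lp_multiplier_power_series[where c = c, OF p E c0]) auto
qed

text \<open>The left side is affine in the bounded quantity \<open>exp (- (b / r))\<close> with
  \<open>r = Suc k\<close>, and yet approximates \<open>b\<close>, which as a symbol is unbounded.
  This is how functions of an unbounded symbol are reached.\<close>

lemma one_minus_exp_scaled_tendsto:
  fixes b :: real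
  shows "(\<lambda>k. (1 - exp (- (b / real (Suc k)))) * real (Suc k)) \<longlonglongrightarrow> b"
proof (cases "b = 0")
  case False
  have "(\<lambda>k. - b * inverse (real (Suc k))) \<longlonglongrightarrow> - b * 0"
    by (intro tendsto_intros LIMSEQ_inverse_real_of_nat)
  then have "filterlim (\<lambda>k. - b * inverse (real (Suc k))) (at 0) sequentially"
    using False by (simp add: filterlim_at)
  from filterlim_compose[OF lim_exp_minus_1 this]
  have "(\<lambda>k. b * ((exp (- b * inverse (real (Suc k))) - 1) / (- b * inverse (real (Suc k))))) \<longlonglongrightarrow> b * 1"
    by (intro tendsto_intros)
  moreover have "b * ((exp (- b * inverse (real (Suc k))) - 1) / (- b * inverse (real (Suc k))))
      = (1 - exp (- (b / real (Suc k)))) * real (Suc k)" for k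
    using False by (simp add: field_simps)
  ultimately show ?thesis by simp
qed simp

text \<open>
  Subordination without integrals: \<open>1 - (1 - z)\<^sup>\<theta>\<close> and \<open>exp (- t (1 - z))\<close> are power series in \<open>z\<close>
  with nonnegative coefficients of sum at most 1, evaluated here at \<open>z = exp (- h (|\<xi>|\<^sup>2 + m\<^sup>2))\<close> with
  \<open>h\<close> tending to 0.
\<close>

lemma Lp_multiplier_subordinated:
  fixes m \<theta> t :: real
  assumes p: "p \<ge> 1" and m: "m \<noteq> 0" and \<theta>: "0 < \<theta>" "\<theta> < 1" and t: "t \<ge> 0"
  shows "Lp_multiplier p 1 (\<lambda>\<xi>::'a::euclidean_space. exp (- t * ((norm \<xi>)\<^sup>2 + m\<^sup>2) powr \<theta>))"
proof (rule Lp_multiplier_limit[OF p])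
  define b where "b \<xi> = (norm \<xi>)\<^sup>2 + m\<^sup>2" for \<xi> :: 'a
  \<comment> \<open>At \<open>\<xi> = 0\<close> only \<open>m \<noteq> 0\<close> keeps
    \<open>b\<close> positive. This gives \<open>E k \<xi> < 1\<close>, where the series for the
    fractional power converges, and keeps the base of \<open>powr\<close> in the final limit away
    from 0.\<close>
  have b: "b \<xi> > 0" for \<xi> using m by (simp add: b_def add_nonneg_pos)
  define r where "r k = real (Suc k)" for k
  have r: "r k > 0" for k by (simp add: r_def)
  define E where "E k \<xi> = exp (- (b \<xi> / r k))" for k \<xi>
  have E01: "0 \<le> E k \<xi>" "E k \<xi> < 1" for k \<xi> using b[of \<xi>] r[of k] by (simp_all add: E_def)
  have "Lp_multiplier p 1 (E k)" for k
  proof (rule Lp_multiplier_mono)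
    \<comment> \<open>The factor 2 undoes the 1/2 in the exponent of \<open>gsym\<close>.\<close>
    have "Lp_multiplier p (\<bar>exp (- (m\<^sup>2 / r k))\<bar> * 1) (\<lambda>\<xi>::'a. exp (- (m\<^sup>2 / r k)) * gsym (2 / r k) \<xi>)"
      using r[of k] by (intro Lp_multiplier_cmult Lp_multiplier_gsym p) simp
    moreover have "(\<lambda>\<xi>. exp (- (m\<^sup>2 / r k)) * gsym (2 / r k) \<xi>) = E k"
      by (intro ext) (simp add: gsym_def E_def b_def exp_add[symmetric] add_divide_distrib)
    ultimately show "Lp_multiplier p (\<bar>exp (- (m\<^sup>2 / r k))\<bar> * 1) (E k)" by (simp only:)
    show "\<bar>exp (- (m\<^sup>2 / r k))\<bar> * 1 \<le> 1" using r[of k] by simp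
  qed
  then have "Lp_multiplier p 1 (\<lambda>\<xi>. exp (- (t * r k powr \<theta>) * (1 - (1 - (1 - E k \<xi>) powr \<theta>))))" for k
    using t by (intro Lp_multiplier_exp Lp_multiplier_one_minus_powr p E01 \<theta>) simp_all
  moreover have "exp (- (t * r k powr \<theta>) * (1 - (1 - (1 - E k \<xi>) powr \<theta>)))
      = exp (- t * ((1 - exp (- (b \<xi> / r k))) * r k) powr \<theta>)" for k \<xi>
    using E01[of k \<xi>] r[of k] by (simp add: powr_mult E_def mult_ac)
  ultimately show "Lp_multiplier p 1 (\<lambda>\<xi>. exp (- t * ((1 - exp (- (b \<xi> / r k))) * r k) powr \<theta>))" for k
    by (simp only:)
  show "(\<lambda>k. exp (- t * ((1 - exp (- (b \<xi> / r k))) * r k) powr \<theta>)) \<longlonglongrightarrow> exp (- t * ((norm \<xi>)\<^sup>2 + m\<^sup>2) powr \<theta>)" for \<xi>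
    unfolding b_def[symmetric] r_def
    by (intro tendsto_intros one_minus_exp_scaled_tendsto) (use b[of \<xi>] in simp)
qed

text \<open>With \<open>\<tau> * a\<close> replaced by the bounded approximation
  \<open>(1 - E) * r\<close>, the base becomes \<open>(1 + r) * (1 - q * E)\<close> for
  \<open>q = r / (1 + r)\<close>, so its power \<open>- \<sigma>\<close> is
  \<open>(1 - q) powr \<sigma>\<close> times a binomial series in \<open>q * E\<close>. At
  \<open>E = 1\<close> the value is 1, so the nonnegative coefficients have total 1.\<close>

lemma Lp_multiplier_resolvent_powr:
  fixes a :: "'a::euclidean_space \<Rightarrow> real"
  assumes p: "p \<ge> 1" and a: "\<And>\<xi>. a \<xi> \<ge> 0" and heat: "\<And>t. t \<ge> 0 \<Longrightarrow> Lp_multiplier p 1 (\<lambda>\<xi>. exp (- t * a \<xi>))"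
    and \<tau>: "\<tau> \<ge> 0" and \<sigma>: "\<sigma> \<ge> 0"
  shows "Lp_multiplier p 1 (\<lambda>\<xi>. (1 + \<tau> * a \<xi>) powr (- \<sigma>))"
proof (rule Lp_multiplier_limit[OF p])
  define r where "r k = real (Suc k)" for k
  have r: "r k > 0" for k by (simp add: r_def)
  define E where "E k \<xi> = exp (- (\<tau> * a \<xi> / r k))" for k \<xi>
  have E: "Lp_multiplier p 1 (E k)" for k
    using heat[of "\<tau> / r k"] \<tau> r[of k] by (simp add: E_def[abs_def])
  have E01: "0 \<le> E k \<xi>" "E k \<xi> \<le> 1" for k \<xi> using a[of \<xi>] \<tau> r[of k] by (simp_all add: E_def)
  have "Lp_multiplier p 1 (\<lambda>\<xi>. (1 + (1 - E k \<xi>) * r k) powr (- \<sigma>))" for k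
  proof -
    define q where "q = r k / (1 + r k)"
    have q: "0 < q" "q < 1" using r[of k] by (simp_all add: q_def)
    define c where "c j = (1 - q) powr \<sigma> * (pochhammer \<sigma> j / fact j * q ^ j)" for j
    have c0: "c j \<ge> 0" for j
    proof -
      have "pochhammer \<sigma> j \<ge> 0"
        using \<sigma> by (cases "\<sigma> = 0") (auto simp: pochhammer_0_left intro: pochhammer_nonneg)
      then show ?thesis using q by (simp add: c_def)
    qed
    have "c sums ((1 - q) powr \<sigma> * (1 - q) powr (- \<sigma>))"
      unfolding c_def using q by (intro sums_mult pochhammer_series) simp
    then have c1: "c sums 1" using q by (simp add: powr_add[symmetric])
    have "(\<lambda>j. c j * E k \<xi> ^ j) sums (1 + (1 - E k \<xi>) * r k) powr (- \<sigma>)" for \<xi>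
    proof -
      have "q * E k \<xi> \<le> q" by (rule mult_left_le) (use q E01 in auto)
      then have qE: "0 \<le> q * E k \<xi>" "q * E k \<xi> < 1" using q(2) E01[of k \<xi>] by (simp add: q(1) less_imp_le, linarith)
      have "(\<lambda>j. (1 - q) powr \<sigma> * (pochhammer \<sigma> j / fact j * (q * E k \<xi>) ^ j)) sums
          ((1 - q) powr \<sigma> * (1 - q * E k \<xi>) powr (- \<sigma>))"
        using qE by (intro sums_mult pochhammer_series) simp
      moreover have "(1 - q) powr \<sigma> * (1 - q * E k \<xi>) powr (- \<sigma>) = ((1 - q * E k \<xi>) / (1 - q)) powr (- \<sigma>)"
        by (simp add: powr_divide powr_minus_divide)
      moreover have "(1 - q * E k \<xi>) / (1 - q) = 1 + (1 - E k \<xi>) * r k"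
      proof -
        have "1 - q = 1 / (1 + r k)" using r[of k] by (simp add: q_def field_simps)
        then have "(1 - q * E k \<xi>) / (1 - q) = (1 - q * E k \<xi>) * (1 + r k)" by (simp only: divide_divide_eq_right div_by_1)
        also have "\<dots> = (1 + r k) - ((1 + r k) * q) * E k \<xi>"
          by (simp add: algebra_simps)
        also have "(1 + r k) * q = r k" using r[of k] by (simp add: q_def)
        finally show ?thesis by (simp add: algebra_simps)
      qed
      ultimately show ?thesis by (simp add: c_def power_mult_distrib mult_ac)
    qed
    then show ?thesis
      using partial_sums_le[OF c0 c1] by (intro Lp_multiplier_power_series[where c = c, OF p E c0]) auto
  qed
  then show "Lp_multiplier p 1 (\<lambda>\<xi>. (1 + (1 - exp (- (\<tau> * a \<xi> / r k))) * r k) powr (- \<sigma>))" for k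
    by (simp add: E_def)
  have pos: "1 + \<tau> * a \<xi> \<noteq> 0" for \<xi> using a[of \<xi>] \<tau> by (smt (verit) mult_nonneg_nonneg)
  show "(\<lambda>k. (1 + (1 - exp (- (\<tau> * a \<xi> / r k))) * r k) powr (- \<sigma>)) \<longlonglongrightarrow> (1 + \<tau> * a \<xi>) powr (- \<sigma>)" for \<xi>
    unfolding r_def by (intro tendsto_powr tendsto_add tendsto_const one_minus_exp_scaled_tendsto pos)
qed

section \<open>Injectivity\<close>

lemma multiplier_one:
  assumes f: "f \<in> Lp 2"
  shows "AE x in lborel. fourier_multiplier_L2 (\<lambda>\<xi>. 1) f x = f x"
  by (rule symbol_AE_eq[where M = 1]) (simp_all add: f)

text \<open>
  If \<open>B g = 0\<close>, factoring through \<open>\<mu>\<close> shows that the operators with symbols \<open>\<nu> j\<close> map the truncations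
  \<open>t k\<close> of \<open>g\<close> to functions of norm at most that of \<open>t k - g\<close>; letting \<open>j\<close> tend to infinity bounds
  the norm of \<open>t k\<close> itself.
\<close>

lemma Lp_multiplier_extension_injective:
  fixes g :: "'a::euclidean_space \<Rightarrow> complex"
  assumes p: "p \<ge> 1" and m: "Lp_multiplier p M \<mu>"
    and B: "bounded_extension p (Lp 2 \<inter> Lp p) (fourier_multiplier_L2 \<mu>) B"
    and \<nu>: "\<And>j. Lp_multiplier p 1 (\<nu> j)" and H: "\<And>j. Lp_multiplier p (K j) (H j)"
    and factor: "\<And>j \<xi>. \<nu> j \<xi> = H j \<xi> * \<mu> \<xi>" and lim: "\<And>\<xi>. (\<lambda>j. \<nu> j \<xi>) \<longlonglongrightarrow> 1"
    and g: "g \<in> Lp p" and zero: "AE x in lborel. B g x = 0"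
  shows "AE x in lborel. g x = 0"
proof -
  have p0: "p > 0" using p by simp
  have lin: "bounded_linear_Lp p B"
    and eq: "\<And>f. f \<in> Lp 2 \<Longrightarrow> f \<in> Lp p \<Longrightarrow> AE x in lborel. B f x = fourier_multiplier_L2 \<mu> f x"
    using B by (auto simp: bounded_extension_def)
  note \<mu>' = Lp_multiplierD(1,2)[OF m] and \<nu>' = Lp_multiplierD(1,2)[OF \<nu>] and H' = Lp_multiplierD(1,2)[OF H]
  have gm: "g \<in> borel_measurable borel" using g by (simp add: Lp_iff)
  define t where "t k = trunc k g" for k
  have t: "t k \<in> Lp p" "t k \<in> Lp 2" for k
    unfolding t_def using p0 gm by (auto intro: trunc_in_Lp)
  have tg: "Lp_tendsto p t g" unfolding t_def by (rule trunc_Lp_tendsto[OF p g])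
  have Bg: "B g \<in> Lp p" "B (t k) \<in> Lp p" for k
    by (intro bounded_linear_Lp_mem[OF p lin] g t)+
  have "Lp_norm p (B g) = 0" using Lp_norm_eq_0_iff[OF p0 Bg(1)] zero by simp
  then have B0: "(\<lambda>k. Lp_norm p (B (t k))) \<longlonglongrightarrow> 0"
    using Lp_tendsto_norm[OF p Bg(2,1) bounded_linear_Lp_tendsto[OF p lin t(1) g tg]] by simp
  have K0: "K j \<ge> 0" for j using H'(2)[of j 0] by linarith
  have bound: "Lp_norm p (fourier_multiplier_L2 (\<nu> j) (t k)) \<le> K j * Lp_norm p (B (t k))" for j k
  proof -
    have T: "fourier_multiplier_L2 \<mu> (t k) \<in> Lp 2" "fourier_multiplier_L2 \<mu> (t k) \<in> Lp p"
      by (intro multiplier_mem[OF \<mu>'] Lp_multiplierD(3)[OF m] t)+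
    have "AE x in lborel. fourier_multiplier_L2 (\<lambda>\<xi>. H j \<xi> * \<mu> \<xi>) (t k) x = fourier_multiplier_L2 (H j) (fourier_multiplier_L2 \<mu> (t k)) x"
      by (rule multiplier_compose[OF H' \<mu>' t(2)])
    then have "AE x in lborel. fourier_multiplier_L2 (\<nu> j) (t k) x = fourier_multiplier_L2 (H j) (fourier_multiplier_L2 \<mu> (t k)) x"
      by (simp flip: factor)
    then have "Lp_norm p (fourier_multiplier_L2 (\<nu> j) (t k)) = Lp_norm p (fourier_multiplier_L2 (H j) (fourier_multiplier_L2 \<mu> (t k)))"
      by (intro Lp_norm_cong_AE Lp_measurable[of _ 2] multiplier_mem[OF \<nu>'] multiplier_mem[OF H'] T t)
    also have "\<dots> \<le> K j * Lp_norm p (fourier_multiplier_L2 \<mu> (t k))"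
      by (rule Lp_multiplierD(4)[OF H T])
    also have "Lp_norm p (fourier_multiplier_L2 \<mu> (t k)) = Lp_norm p (B (t k))"
      using eq[OF t(2,1), of k] by (intro Lp_norm_cong_AE Lp_measurable[of _ p] T Bg) auto
    finally show ?thesis .
  qed
  have le: "Lp_norm p (fourier_multiplier_L2 (\<nu> j) (t k)) \<le> Lp_norm p (\<lambda>x. t k x - g x)" for j k
  proof -
    let ?T = "fourier_multiplier_L2 (\<nu> j)"
    \<comment> \<open>\<open>K j\<close> may grow with \<open>j\<close>. The index \<open>l\<close>
      is sent to infinity with \<open>j\<close> and \<open>k\<close> fixed, so the term with
      \<open>K j\<close> vanishes before \<open>j\<close> moves.\<close>
    have step: "Lp_norm p (?T (t k)) \<le> K j * Lp_norm p (B (t l)) + (Lp_norm p (\<lambda>x. t k x - g x) + Lp_norm p (\<lambda>x. t l x - g x))" for l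
    proof -
      have d: "(\<lambda>x. t k x - t l x) \<in> Lp 2" "(\<lambda>x. t k x - t l x) \<in> Lp p"
        by (intro Lp_diff t p; simp)+
      have Tp: "?T (t l) \<in> Lp p" "?T (\<lambda>x. t k x - t l x) \<in> Lp p" "?T (t k) \<in> Lp p"
        by (intro Lp_multiplierD(3)[OF \<nu>] t d)+
      have "AE x in lborel. ?T (\<lambda>x. t l x + (t k x - t l x)) x = ?T (t l) x + ?T (\<lambda>x. t k x - t l x) x"
        by (rule multiplier_add[OF \<nu>' t(2) d(1)])
      then have "Lp_norm p (?T (t k)) = Lp_norm p (\<lambda>x. ?T (t l) x + ?T (\<lambda>x. t k x - t l x) x)"
        by (intro Lp_norm_cong_AE Lp_measurable[of _ p] Tp Lp_add p) simp
      also have "\<dots> \<le> Lp_norm p (?T (t l)) + Lp_norm p (?T (\<lambda>x. t k x - t l x))"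
        by (rule Lp_add(2)[OF p Tp(1,2)])
      also have "\<dots> \<le> K j * Lp_norm p (B (t l)) + 1 * Lp_norm p (\<lambda>x. t k x - t l x)"
        by (intro add_mono bound Lp_multiplierD(4)[OF \<nu>] d)
      also have "Lp_norm p (\<lambda>x. t k x - t l x) \<le> Lp_norm p (\<lambda>x. t k x - g x) + Lp_norm p (\<lambda>x. g x - t l x)"
        by (rule Lp_triangle[OF p t(1) g t(1)])
      finally show ?thesis by (simp add: Lp_norm_minus_commute[of p g])
    qed
    have "(\<lambda>l. K j * Lp_norm p (B (t l)) + (Lp_norm p (\<lambda>x. t k x - g x) + Lp_norm p (\<lambda>x. t l x - g x)))
        \<longlonglongrightarrow> K j * 0 + (Lp_norm p (\<lambda>x. t k x - g x) + 0)"
      using tg by (intro tendsto_intros B0) (simp add: Lp_tendsto_def)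
    then show ?thesis using step by (intro LIMSEQ_le_const[where X = "\<lambda>l. K j * Lp_norm p (B (t l)) + (Lp_norm p (\<lambda>x. t k x - g x) + Lp_norm p (\<lambda>x. t l x - g x))"]) auto
  qed
  have "Lp_norm p (t k) \<le> Lp_norm p (\<lambda>x. t k x - g x)" for k
  proof (rule Lp_bounded_L2_limit(2)[OF p _ _ t(2) _ le])
    show T2: "fourier_multiplier_L2 (\<nu> j) (t k) \<in> Lp 2" "fourier_multiplier_L2 (\<nu> j) (t k) \<in> Lp p" for j
      by (intro multiplier_mem[OF \<nu>'] Lp_multiplierD(3)[OF \<nu>] t)+
    have one: "fourier_multiplier_L2 (\<lambda>\<xi>. 1) (t k) \<in> Lp 2"
      by (rule multiplier_mem[where M = 1]) (simp_all add: t)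
    show "Lp_tendsto 2 (\<lambda>j. fourier_multiplier_L2 (\<nu> j) (t k)) (t k)"
    proof (rule Lp_tendsto_cong_AE)
      show "Lp_tendsto 2 (\<lambda>j. fourier_multiplier_L2 (\<nu> j) (t k)) (fourier_multiplier_L2 (\<lambda>\<xi>. 1) (t k))"
        by (rule multiplier_symbol_tendsto[OF \<nu>' _ lim t(2)]) simp
      show "AE x in lborel. fourier_multiplier_L2 (\<lambda>\<xi>. 1) (t k) x = t k x"
        by (rule multiplier_one[OF t(2)])
    qed (use T2(1) one t(2) in \<open>simp_all add: Lp_iff\<close>)
  qed
  then have "Lp_norm p g \<le> 0"
    using Lp_tendsto_norm[OF p t(1) g tg] tg unfolding Lp_tendsto_def by (intro LIMSEQ_le[of _ _ _ 0]) auto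
  then have "Lp_norm p g = 0" using Lp_norm_nonneg[of p g] by linarith
  then show ?thesis using Lp_norm_eq_0_iff[OF p0 g] by simp
qed

section \<open>The operator T_s and its injectivity\<close>

context
  fixes p s \<gamma> m :: real
  assumes p: "p \<ge> 1" and s: "s \<ge> 0" and \<gamma>: "0 < \<gamma>" "\<gamma> < 2" and m: "m \<noteq> 0"
begin

abbreviation (input) bessel_symbol :: "'a::euclidean_space \<Rightarrow> real" where
  "bessel_symbol \<xi> \<equiv> (1 + a_sym \<gamma> m ((norm \<xi>)\<^sup>2)) powr (- s / 2)"

lemma a_sym_heat_multiplier:
  assumes "t \<ge> 0"
  shows "Lp_multiplier p 1 (\<lambda>\<xi>::'a::euclidean_space. exp (- t * a_sym \<gamma> m ((norm \<xi>)\<^sup>2)))"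
  using Lp_multiplier_subordinated[OF p m, of "\<gamma> / 2" t] \<gamma> assms by (simp add: a_sym_def)

lemma a_sym_resolvent_multiplier:
  assumes "\<tau> \<ge> 0" "\<sigma> \<ge> 0"
  shows "Lp_multiplier p 1 (\<lambda>\<xi>::'a::euclidean_space. (1 + \<tau> * a_sym \<gamma> m ((norm \<xi>)\<^sup>2)) powr (- \<sigma>))"
  by (rule Lp_multiplier_resolvent_powr[OF p _ a_sym_heat_multiplier assms]) (simp_all add: a_sym_def)

lemma bessel_multiplier: "Lp_multiplier p 1 (bessel_symbol :: 'a::euclidean_space \<Rightarrow> real)"
  using a_sym_resolvent_multiplier[of 1 "s / 2"] s by simp

lemma T_op_extension:
  "bounded_extension p (Lp 2 \<inter> Lp p) (fourier_multiplier_L2 (bessel_symbol :: 'a::euclidean_space \<Rightarrow> real))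
     (T_op s p (a_sym \<gamma> m))"
  unfolding T_op_def by (rule someI_ex[where P = "bounded_extension p (Lp 2 \<inter> Lp p) (fourier_multiplier_L2 bessel_symbol)"],
      rule Lp_multiplier_extension_exists[OF p bessel_multiplier])

lemma T_op_bounded_linear: "bounded_linear_Lp p (T_op s p (a_sym \<gamma> m))"
  by (rule conjunct1[OF T_op_extension[unfolded bounded_extension_def]])

lemma T_op_radial_real: "g \<in> Lp p \<Longrightarrow> radial_real g \<Longrightarrow> radial_real (T_op s p (a_sym \<gamma> m) g)"
  by (rule Lp_multiplier_extension_radial_real[OF p bessel_multiplier T_op_extension])

text \<open>The inverse of the symbol of \<open>T\<^sub>s\<close> is unbounded, so the symbol is
  divided out only from \<open>(1 + a / J) powr (- n)\<close>, whose decay compensates. The quotient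
  \<open>H\<close> has to be a multiplier for each \<open>J\<close>, with a bound that may depend on
  \<open>J\<close>.\<close>

lemma T_op_zero:
  fixes g :: "'a::euclidean_space \<Rightarrow> complex"
  assumes g: "g \<in> Lp p" and zero: "AE x in lborel. T_op s p (a_sym \<gamma> m) g x = 0"
  shows "AE x in lborel. g x = 0"
proof -
  define a where "a \<xi> = a_sym \<gamma> m ((norm \<xi>)\<^sup>2)" for \<xi> :: 'a
  have a: "a \<xi> \<ge> 0" for \<xi> by (simp add: a_def a_sym_def)
  define J where "J j = real (Suc j)" for j
  have J: "J j \<ge> 1" for j by (simp add: J_def)
  \<comment> \<open>\<open>n \<ge> s / 2\<close> splits \<open>(1 + a) powr (s / 2)\<close> into
    \<open>(1 + a) ^ n\<close> and a factor with the nonpositive exponent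
    \<open>- (n - s / 2)\<close>.\<close>
  define n where "n = nat \<lceil>s / 2\<rceil>"
  have n: "s / 2 \<le> real n" unfolding n_def by (rule real_nat_ceiling_ge)
  define R where "R j \<xi> = (1 + 1 / J j * a \<xi>) powr (- 1)" for j \<xi>
  \<comment> \<open>\<open>J + - (J - 1) * R\<close> equals \<open>(1 + a) / (1 + a / J)\<close>:
    this bounded quotient is affine in the resolvent \<open>R\<close>, hence a multiplier.\<close>
  define H where "H j \<xi> = (1 + 1 * a \<xi>) powr (- (real n - s / 2)) * (J j + - (J j - 1) * R j \<xi>) ^ n" for j \<xi>
  have Rm: "Lp_multiplier p 1 (R j)" for j
    unfolding R_def[abs_def] a_def using J[of j] by (intro a_sym_resolvent_multiplier) auto
  have Hm: "Lp_multiplier p (1 * (\<bar>J j\<bar> + \<bar>- (J j - 1)\<bar> * 1) ^ n) (H j)" for j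
    unfolding H_def[abs_def] a_def using n
    by (intro Lp_multiplier_mult a_sym_resolvent_multiplier Lp_multiplier_power Lp_multiplier_add
        Lp_multiplier_const Lp_multiplier_cmult Rm p) auto
  have \<nu>m: "Lp_multiplier p 1 (\<lambda>\<xi>. (1 + 1 / J j * a \<xi>) powr (- real n))" for j
    unfolding a_def using J[of j] by (intro a_sym_resolvent_multiplier) auto
  show ?thesis
  proof (rule Lp_multiplier_extension_injective[OF p bessel_multiplier T_op_extension \<nu>m Hm _ _ g zero])
    fix j \<xi>
    have d: "1 + 1 / J j * a \<xi> > 0" "1 + a \<xi> > 0" using a[of \<xi>] J[of j] by (simp_all add: add_pos_nonneg)
    have "J j + - (J j - 1) * R j \<xi> = (1 + a \<xi>) * (1 / (1 + 1 / J j * a \<xi>))"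
    proof -
      have "(J j + - (J j - 1) * R j \<xi>) * (1 + 1 / J j * a \<xi>) = J j * (1 + 1 / J j * a \<xi>) - (J j - 1)"
      proof -
        have "R j \<xi> * (1 + 1 / J j * a \<xi>) = 1"
          using d by (simp add: R_def powr_minus)
        then show ?thesis by (simp only: distrib_right mult.assoc) simp
      qed
      also have "\<dots> = 1 + a \<xi>" using J[of j] by (simp add: algebra_simps)
      finally show ?thesis using d by (simp add: field_simps)
    qed
    then have "H j \<xi> = (1 + a \<xi>) powr (- (real n - s / 2)) * ((1 + a \<xi>) powr real n * (1 + 1 / J j * a \<xi>) powr (- real n))"
      unfolding H_def using d by (simp add: power_mult_distrib powr_realpow powr_minus power_divide inverse_eq_divide)
    then have "H j \<xi> * (1 + a \<xi>) powr (- s / 2)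
      = ((1 + a \<xi>) powr (- (real n - s / 2)) * (1 + a \<xi>) powr real n * (1 + a \<xi>) powr (- s / 2)) * (1 + 1 / J j * a \<xi>) powr (- real n)"
      by simp
    also have "\<dots> = (1 + 1 / J j * a \<xi>) powr (- real n)"
      using d by (simp add: powr_add[symmetric])
    finally show "(1 + 1 / J j * a \<xi>) powr (- real n) = H j \<xi> * (1 + a_sym \<gamma> m ((norm \<xi>)\<^sup>2)) powr (- s / 2)"
      by (simp add: a_def)
  next
    fix \<xi>
    have "(\<lambda>j. (1 + inverse (real (Suc j)) * a \<xi>) powr (- real n)) \<longlonglongrightarrow> (1 + 0 * a \<xi>) powr (- real n)"
      by (intro tendsto_intros LIMSEQ_inverse_real_of_nat) simp
    then show "(\<lambda>j. (1 + 1 / J j * a \<xi>) powr (- real n)) \<longlonglongrightarrow> 1"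
      by (simp add: J_def inverse_eq_divide)
  qed
qed

lemma T_op_injective:
  fixes f g :: "'a::euclidean_space \<Rightarrow> complex"
  assumes fg: "f \<in> Lp p" "g \<in> Lp p" and eq: "AE x in lborel. T_op s p (a_sym \<gamma> m) f x = T_op s p (a_sym \<gamma> m) g x"
  shows "AE x in lborel. f x = g x"
proof -
  have "AE x in lborel. T_op s p (a_sym \<gamma> m) (\<lambda>y. f y - g y) x = 0"
    using bounded_linear_Lp_diff[OF p T_op_bounded_linear fg] eq by eventually_elim simp
  from T_op_zero[OF Lp_diff(1)[OF p fg] this] show ?thesis by simp
qed

text \<open>Injectivity makes the choice in \<open>J_op\<close> immaterial up to equality a.e., so
  that the Bessel norm can be computed from any known preimage.\<close>

lemma J_op_T_op:
  fixes g :: "'a::euclidean_space \<Rightarrow> complex"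
  assumes g: "g \<in> Lp p" and u: "AE x in lborel. u x = T_op s p (a_sym \<gamma> m) g x"
  shows "J_op s p (a_sym \<gamma> m) u \<in> Lp p" "AE x in lborel. J_op s p (a_sym \<gamma> m) u x = g x"
    "Hsp_norm s p (a_sym \<gamma> m) u = Lp_norm p g"
proof -
  let ?J = "J_op s p (a_sym \<gamma> m) u"
  have J: "?J \<in> Lp p \<and> (AE x in lborel. u x = T_op s p (a_sym \<gamma> m) ?J x)"
    unfolding J_op_def
    by (rule someI_ex[where P = "\<lambda>g. g \<in> Lp p \<and> (AE x in lborel. u x = T_op s p (a_sym \<gamma> m) g x)"]) (use g u in blast)
  then show "?J \<in> Lp p" by blast
  have "AE x in lborel. T_op s p (a_sym \<gamma> m) ?J x = T_op s p (a_sym \<gamma> m) g x"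
    using J u by auto
  then show e: "AE x in lborel. ?J x = g x"
    by (rule T_op_injective[OF conjunct1[OF J] g])
  then show "Hsp_norm s p (a_sym \<gamma> m) u = Lp_norm p g"
    unfolding Hsp_norm_def using J g by (intro Lp_norm_cong_AE) (auto simp: Lp_iff)
qed

end

section \<open>The fixed point problem\<close>

text \<open>\<open>\<alpha> = 3\<close> gives the cube on real arguments, and
  \<open>\<alpha> = \<beta> + 1\<close> the nonlinearity of the second equation. Up to a coefficient
  the two equations thus become one.\<close>

definition power_nonlinearity :: "real \<Rightarrow> complex \<Rightarrow> complex" where
  "power_nonlinearity \<alpha> z = of_real (norm z powr (\<alpha> - 1)) * z"

lemma power_nonlinearity_measurable [measurable]: "power_nonlinearity \<alpha> \<in> borel_measurable borel"
  unfolding power_nonlinearity_def[abs_def] by measurable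

lemma norm_power_nonlinearity: "norm (power_nonlinearity \<alpha> z) = norm z powr \<alpha>"
proof (cases "z = 0")
  case False
  then have "norm z powr (\<alpha> - 1) * norm z = norm z powr (\<alpha> - 1 + 1)"
    by (subst powr_add) simp
  then show ?thesis by (simp add: power_nonlinearity_def norm_mult)
qed (simp add: power_nonlinearity_def)

lemma power_nonlinearity_of_real:
  "power_nonlinearity \<alpha> (of_real y) = of_real (\<bar>y\<bar> powr (\<alpha> - 1) * y)"
  by (simp add: power_nonlinearity_def)

text \<open>Mean value theorem. For \<open>a < 1\<close> the power is not Lipschitz near 0, and the
  factor \<open>y\<close> compensates: at the intermediate point,
  \<open>x powr (a - 1) * y \<le> x powr a\<close>.\<close>

lemma powr_diff_mult_le:
  fixes a y z :: real
  assumes "a > 0" "0 \<le> y" "y \<le> z"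
  shows "(z powr a - y powr a) * y \<le> a * z powr a * (z - y)"
proof (cases "y = 0 \<or> y = z")
  case False
  then have yz: "0 < y" "y < z" using assms by auto
  have "\<exists>l x. y < x \<and> x < z \<and> DERIV (\<lambda>x. x powr a) x :> l \<and> z powr a - y powr a = (z - y) * l"
    using yz by (intro MVT) (auto intro!: continuous_intros derivative_eq_intros simp: real_differentiable_def
        intro: has_real_derivative_powr)
  then obtain l x where x: "y < x" "x < z" and l: "DERIV (\<lambda>x. x powr a) x :> l"
    and eq: "z powr a - y powr a = (z - y) * l" by blast
  have "l = a * x powr (a - 1)"
    using DERIV_unique[OF l has_real_derivative_powr] x yz by simp
  moreover have "x powr (a - 1) * y \<le> z powr a"
  proof -
    have "x powr (a - 1) * y \<le> x powr (a - 1) * x" using x by (intro mult_left_mono) auto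
    also have "\<dots> = x powr a" using x yz by (simp add: powr_diff)
    also have "\<dots> \<le> z powr a" using x yz assms by (intro powr_mono2) auto
    finally show ?thesis .
  qed
  ultimately show ?thesis
    using mult_left_mono[of "x powr (a - 1) * y" "z powr a" "a * (z - y)"] assms
    unfolding eq by (simp add: mult_ac)
qed (use assms in auto)

text \<open>If \<open>norm w \<le> norm z\<close>, splitting off
  \<open>norm z powr (\<alpha> - 1) * (z - w)\<close> leaves a difference of powers times
  \<open>w\<close>; the two parts contribute the factors \<open>1\<close> and
  \<open>\<alpha> - 1\<close>. The sum of both weights on the right replaces their maximum, which
  makes the bound symmetric and is the origin of the factor 2 in the contraction constant.\<close>

lemma power_nonlinearity_lipschitz:
  assumes \<alpha>: "\<alpha> > 1"
  shows "norm (power_nonlinearity \<alpha> z - power_nonlinearity \<alpha> w)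
    \<le> \<alpha> * (norm z powr (\<alpha> - 1) * norm (z - w) + norm w powr (\<alpha> - 1) * norm (z - w))"
proof -
  have main: "norm (power_nonlinearity \<alpha> z - power_nonlinearity \<alpha> w) \<le> \<alpha> * (norm z powr (\<alpha> - 1) * norm (z - w))"
    if le: "norm w \<le> norm z" for z w
  proof -
    let ?a = "\<alpha> - 1"
    have mono: "norm w powr ?a \<le> norm z powr ?a" using le \<alpha> by (intro powr_mono2) auto
    have "power_nonlinearity \<alpha> z - power_nonlinearity \<alpha> w
        = of_real (norm z powr ?a) * (z - w) + of_real (norm z powr ?a - norm w powr ?a) * w"
      by (simp add: power_nonlinearity_def algebra_simps)
    also have "norm \<dots> \<le> norm z powr ?a * norm (z - w) + (norm z powr ?a - norm w powr ?a) * norm w"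
      by (rule order_trans[OF norm_triangle_ineq])
         (use mono in \<open>simp add: norm_mult flip: of_real_diff\<close>)
    also have "(norm z powr ?a - norm w powr ?a) * norm w \<le> ?a * norm z powr ?a * (norm z - norm w)"
      using le \<alpha> by (intro powr_diff_mult_le) auto
    also have "\<dots> \<le> ?a * norm z powr ?a * norm (z - w)"
      using \<alpha> by (intro mult_left_mono norm_triangle_ineq2) auto
    finally show ?thesis by (simp add: algebra_simps)
  qed
  have nn: "0 \<le> \<alpha> * (norm v powr (\<alpha> - 1) * norm (z - w))" for v :: complex using \<alpha> by simp
  show ?thesis
  proof (cases "norm w \<le> norm z")
    case True
    then show ?thesis using main[OF True] nn[of w] by (simp add: distrib_left)
  next
    case False
    then have "norm (power_nonlinearity \<alpha> z - power_nonlinearity \<alpha> w) \<le> \<alpha> * (norm w powr (\<alpha> - 1) * norm (z - w))"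
      using main[of z w] by (simp add: norm_minus_commute)
    then show ?thesis using nn[of z] by (simp add: distrib_left)
  qed
qed

lemma power_nonlinearity_Lp:
  assumes p: "p > 0" and \<alpha>: "\<alpha> > 1" and u: "u \<in> Lp (\<alpha> * p)"
  shows "(\<lambda>x. power_nonlinearity \<alpha> (u x)) \<in> Lp p"
    "Lp_norm p (\<lambda>x. power_nonlinearity \<alpha> (u x)) = Lp_norm (\<alpha> * p) u powr \<alpha>"
proof -
  note [measurable] = u
  show "(\<lambda>x. power_nonlinearity \<alpha> (u x)) \<in> Lp p"
    using Lp_integrable[OF u] by (simp add: Lp_iff norm_power_nonlinearity powr_powr)
  show "Lp_norm p (\<lambda>x. power_nonlinearity \<alpha> (u x)) = Lp_norm (\<alpha> * p) u powr \<alpha>"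
    using p \<alpha> by (simp add: Lp_norm_def norm_power_nonlinearity powr_powr)
qed

lemma radial_real_power_nonlinearity:
  assumes "radial_real u"
  shows "radial_real (\<lambda>x. power_nonlinearity \<alpha> (u x))"
proof -
  obtain \<phi> where "AE x in lborel. u x = complex_of_real (\<phi> (norm x))"
    using assms by (auto simp: radial_real_def)
  then have "AE x in lborel. power_nonlinearity \<alpha> (u x) = of_real (\<bar>\<phi> (norm x)\<bar> powr (\<alpha> - 1) * \<phi> (norm x))"
    by eventually_elim (simp only: power_nonlinearity_of_real)
  then show ?thesis by (rule radial_realI[where \<phi> = "\<lambda>r. \<bar>\<phi> r\<bar> powr (\<alpha> - 1) * \<phi> r"])
qed

text \<open>Banach's iteration is carried out on representatives, for which \<open>Lp_norm\<close>
  of a difference is only a pseudometric. The ball \<open>X\<close> is closed: the norm bound passes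
  to the limit, and being real radial does so along an a.e. convergent subsequence.\<close>

lemma radial_fixed_point:
  fixes T :: "('a::euclidean_space \<Rightarrow> complex) \<Rightarrow> 'a \<Rightarrow> complex" and c N \<epsilon> :: real
  assumes p: "p > 1" and \<alpha>: "\<alpha> > 1" and \<epsilon>: "\<epsilon> > 0" and N: "N > 0"
    and lin: "bounded_linear_Lp p T"
    and rad: "\<And>g. g \<in> Lp p \<Longrightarrow> radial_real g \<Longrightarrow> radial_real (T g)"
    and emb: "\<And>g. g \<in> Lp p \<Longrightarrow> radial_real g \<Longrightarrow> T g \<in> Lp (\<alpha> * p) \<and> Lp_norm (\<alpha> * p) (T g) \<le> N * Lp_norm p g"
    and r: "r \<in> Lp p" "radial_real r"
    and self: "N * (\<bar>c\<bar> * \<epsilon> powr \<alpha> + Lp_norm p r) \<le> \<epsilon>"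
    and contr: "2 * N * \<bar>c\<bar> * \<alpha> * \<epsilon> powr (\<alpha> - 1) < 1"
  obtains u where "u \<in> Lp (\<alpha> * p)" "radial_real u"
    "AE x in lborel. T (\<lambda>x. of_real c * power_nonlinearity \<alpha> (u x) + r x) x = u x"
proof -
  define q where "q = \<alpha> * p"
  have p1: "p \<ge> 1" and p0: "p > 0" using p by auto
  have q1: "q \<ge> 1" unfolding q_def using p \<alpha> mult_mono[of 1 \<alpha> 1 p] by simp
  have q0: "q > 0" using q1 by simp
  define F where "F u x = of_real c * power_nonlinearity \<alpha> (u x) + r x" for u x
  define X where "X = {u :: 'a \<Rightarrow> complex. u \<in> Lp q \<and> radial_real u \<and> Lp_norm q u \<le> \<epsilon>}"
  define K where "K = 2 * N * \<bar>c\<bar> * \<alpha> * \<epsilon> powr (\<alpha> - 1)"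
  have K: "0 \<le> K" "K < 1" using contr N \<alpha> by (auto simp: K_def)
  have F: "F u \<in> Lp p" "radial_real (F u)" "Lp_norm p (F u) \<le> \<bar>c\<bar> * \<epsilon> powr \<alpha> + Lp_norm p r" if "u \<in> X" for u
  proof -
    have u: "u \<in> Lp (\<alpha> * p)" "radial_real u" "Lp_norm (\<alpha> * p) u \<le> \<epsilon>" using that by (auto simp: X_def q_def)
    note P = power_nonlinearity_Lp[OF p0 \<alpha> u(1)]
    note cP = Lp_cmult[OF p0 P(1), of "of_real c"]
    show "F u \<in> Lp p" unfolding F_def[abs_def] by (rule Lp_add(1)[OF p1 cP(1) r(1)])
    show "radial_real (F u)" unfolding F_def[abs_def]
      by (intro radial_real_add radial_real_cmult radial_real_power_nonlinearity u r)
    have "Lp_norm p (F u) \<le> \<bar>c\<bar> * Lp_norm (\<alpha> * p) u powr \<alpha> + Lp_norm p r"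
      using Lp_add(2)[OF p1 cP(1) r(1)] by (simp add: F_def[abs_def] cP P)
    also have "\<bar>c\<bar> * Lp_norm (\<alpha> * p) u powr \<alpha> \<le> \<bar>c\<bar> * \<epsilon> powr \<alpha>"
      using u(3) \<alpha> by (intro mult_left_mono powr_mono2) auto
    finally show "Lp_norm p (F u) \<le> \<bar>c\<bar> * \<epsilon> powr \<alpha> + Lp_norm p r" by simp
  qed
  have G: "T (F u) \<in> X" if "u \<in> X" for u
  proof -
    have "Lp_norm q (T (F u)) \<le> N * (\<bar>c\<bar> * \<epsilon> powr \<alpha> + Lp_norm p r)"
      unfolding q_def
      by (rule order_trans[OF conjunct2[OF emb[OF F(1,2)[OF that]]] mult_left_mono[OF F(3)[OF that]]]) (use N in simp)
    then show ?thesis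
      using self emb[OF F(1,2)[OF that]] rad[OF F(1,2)[OF that]] by (simp add: X_def q_def)
  qed
  have lip: "Lp_norm q (\<lambda>x. T (F u) x - T (F v) x) \<le> K * Lp_norm q (\<lambda>x. u x - v x)" if "u \<in> X" "v \<in> X" for u v
  proof -
    have u: "u \<in> Lp (\<alpha> * p)" "Lp_norm (\<alpha> * p) u \<le> \<epsilon>" and v: "v \<in> Lp (\<alpha> * p)" "Lp_norm (\<alpha> * p) v \<le> \<epsilon>"
      using that by (auto simp: X_def q_def)
    define w where "w x = u x - v x" for x
    have w: "w \<in> Lp (\<alpha> * p)" unfolding w_def[abs_def] using u v q1 by (auto intro: Lp_diff simp: q_def)
    note [measurable] = u(1) v(1) w F(1)[OF that(1)] F(1)[OF that(2)]
    define b where "b x = (\<bar>c\<bar> * \<alpha>) * (norm (u x) powr (\<alpha> - 1) * norm (w x) + norm (v x) powr (\<alpha> - 1) * norm (w x))" for x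
    note Hu = Lp_weighted_Hoelder[OF p0 \<alpha> u(1) w] and Hv = Lp_weighted_Hoelder[OF p0 \<alpha> v(1) w]
    note Huv = Lp_add[OF p1 Hu(1) Hv(1)]
    have b: "(\<lambda>x. complex_of_real (b x)) \<in> Lp p"
      "Lp_norm p (\<lambda>x. complex_of_real (b x)) = \<bar>c\<bar> * \<alpha> * Lp_norm p (\<lambda>x. norm (u x) powr (\<alpha> - 1) * norm (w x) + norm (v x) powr (\<alpha> - 1) * norm (w x))"
    proof -
      let ?s = "\<lambda>x. complex_of_real (norm (u x) powr (\<alpha> - 1) * norm (w x) + norm (v x) powr (\<alpha> - 1) * norm (w x))"
      have s: "?s \<in> Lp p" "Lp_norm p ?s = Lp_norm p (\<lambda>x. norm (u x) powr (\<alpha> - 1) * norm (w x) + norm (v x) powr (\<alpha> - 1) * norm (w x))"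
        using Huv(1) by (simp_all add: Lp_iff Lp_norm_def norm_of_real del: of_real_add of_real_mult)
      show "(\<lambda>x. complex_of_real (b x)) \<in> Lp p"
        using Lp_cmult(1)[OF p0 s(1), of "of_real (\<bar>c\<bar> * \<alpha>)"] by (simp add: b_def)
      show "Lp_norm p (\<lambda>x. complex_of_real (b x)) = \<bar>c\<bar> * \<alpha> * Lp_norm p (\<lambda>x. norm (u x) powr (\<alpha> - 1) * norm (w x) + norm (v x) powr (\<alpha> - 1) * norm (w x))"
        using Lp_cmult(2)[OF p0 s(1), of "of_real (\<bar>c\<bar> * \<alpha>)"] \<alpha> s(2) by (simp add: b_def norm_mult)
    qed
    have "Lp_norm p (\<lambda>x. F u x - F v x) \<le> Lp_norm p (\<lambda>x. complex_of_real (b x))"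
    proof (rule Lp_bound(2)[OF p0 b(1)])
      show "AE x in lborel. norm (F u x - F v x) \<le> norm (complex_of_real (b x))"
      proof (rule AE_I2)
        fix x
        have "F u x - F v x = of_real c * (power_nonlinearity \<alpha> (u x) - power_nonlinearity \<alpha> (v x))"
          by (simp add: F_def algebra_simps)
        then have "norm (F u x - F v x) = \<bar>c\<bar> * norm (power_nonlinearity \<alpha> (u x) - power_nonlinearity \<alpha> (v x))"
          by (simp add: norm_mult)
        also have "\<dots> \<le> \<bar>c\<bar> * (\<alpha> * (norm (u x) powr (\<alpha> - 1) * norm (w x) + norm (v x) powr (\<alpha> - 1) * norm (w x)))"
          unfolding w_def by (intro mult_left_mono power_nonlinearity_lipschitz \<alpha>) auto
        also have "\<dots> = b x" by (simp add: b_def)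
        finally show "norm (F u x - F v x) \<le> norm (complex_of_real (b x))" by simp
      qed
    qed measurable
    also have "\<dots> \<le> \<bar>c\<bar> * \<alpha> * (\<epsilon> powr (\<alpha> - 1) * Lp_norm q w + \<epsilon> powr (\<alpha> - 1) * Lp_norm q w)"
    proof -
      have "Lp_norm (\<alpha> * p) u powr (\<alpha> - 1) * Lp_norm (\<alpha> * p) w \<le> \<epsilon> powr (\<alpha> - 1) * Lp_norm q w"
        "Lp_norm (\<alpha> * p) v powr (\<alpha> - 1) * Lp_norm (\<alpha> * p) w \<le> \<epsilon> powr (\<alpha> - 1) * Lp_norm q w"
        unfolding q_def using u v \<alpha> by (auto intro!: mult_right_mono powr_mono2)
      then show ?thesis
        unfolding b(2) using Huv(2) Hu(2) Hv(2) \<alpha> by (intro mult_left_mono, linarith, simp)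
    qed
    finally have dF: "Lp_norm p (\<lambda>x. F u x - F v x) \<le> 2 * \<bar>c\<bar> * \<alpha> * \<epsilon> powr (\<alpha> - 1) * Lp_norm q w"
      by (simp add: algebra_simps)
    \<comment> \<open>\<open>emb\<close> speaks of radial functions only, so the difference itself
      has to be radial before its image can be estimated.\<close>
    have Fd: "(\<lambda>x. F u x - F v x) \<in> Lp p" "radial_real (\<lambda>x. F u x - F v x)"
      by (intro Lp_diff radial_real_diff F that p1)+
    have TF: "T (F u) \<in> Lp q" "T (F v) \<in> Lp q" "T (\<lambda>x. F u x - F v x) \<in> Lp q"
      using G[OF that(1)] G[OF that(2)] emb[OF Fd] by (auto simp: X_def q_def)
    note [measurable] = TF
    have "Lp_norm q (\<lambda>x. T (F u) x - T (F v) x) = Lp_norm q (T (\<lambda>x. F u x - F v x))"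
      by (rule Lp_norm_cong_AE) (use bounded_linear_Lp_diff[OF p1 lin F(1)[OF that(1)] F(1)[OF that(2)]] in auto)
    also have "\<dots> \<le> N * Lp_norm p (\<lambda>x. F u x - F v x)" using emb[OF Fd] by (simp add: q_def)
    also have "\<dots> \<le> N * (2 * \<bar>c\<bar> * \<alpha> * \<epsilon> powr (\<alpha> - 1) * Lp_norm q w)"
      using N dF by (intro mult_left_mono) auto
    finally show ?thesis by (simp add: K_def w_def[abs_def] mult_ac)
  qed
  define U where "U k = ((\<lambda>u. T (F u)) ^^ k) (\<lambda>x. 0)" for k
  have U_Suc: "U (Suc k) = T (F (U k))" for k by (simp add: U_def)
  have "radial_real (\<lambda>x::'a. 0)" by (rule radial_realI[where \<phi> = "\<lambda>r. 0"]) simp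
  then have "(\<lambda>x::'a. 0) \<in> X" using \<epsilon> by (simp add: X_def)
  then have UX: "U k \<in> X" for k
    by (induction k) (simp_all add: U_Suc G, simp add: U_def)
  have UL: "U k \<in> Lp q" "Lp_norm q (U k) \<le> \<epsilon>" "radial_real (U k)" for k using UX by (auto simp: X_def)
  \<comment> \<open>\<open>2 * \<epsilon>\<close> bounds the diameter of the ball, which settles
    \<open>k = 0\<close> for all \<open>j\<close> at once.\<close>
  have dist: "Lp_norm q (\<lambda>x. U (k + j) x - U k x) \<le> K ^ k * (2 * \<epsilon>)" for k j
  proof (induction k)
    case 0
    show ?case using Lp_diff(2)[OF q1 UL(1)[of j] UL(1)[of 0]] UL(2)[of j] UL(2)[of 0] by simp
  next
    case (Suc k)
    have "Lp_norm q (\<lambda>x. U (Suc k + j) x - U (Suc k) x) \<le> K * Lp_norm q (\<lambda>x. U (k + j) x - U k x)"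
      unfolding add_Suc U_Suc by (rule lip[OF UX UX])
    also have "\<dots> \<le> K * (K ^ k * (2 * \<epsilon>))" by (intro mult_left_mono Suc K)
    finally show ?case by simp
  qed
  have "\<exists>u\<in>Lp q. (\<lambda>k. Lp_norm q (\<lambda>x. U k x - u x)) \<longlonglongrightarrow> 0"
  proof (rule Lp_complete[OF q1 UL(1)])
    fix e :: real assume e: "e > 0"
    have "(\<lambda>k. K ^ k * (2 * \<epsilon>)) \<longlonglongrightarrow> 0 * (2 * \<epsilon>)"
      using K by (intro tendsto_intros LIMSEQ_realpow_zero) auto
    then have "\<forall>\<^sub>F k in sequentially. K ^ k * (2 * \<epsilon>) < e" using e by (intro order_tendstoD) auto
    then obtain n where n: "\<And>k. k \<ge> n \<Longrightarrow> K ^ k * (2 * \<epsilon>) < e" by (auto simp: eventually_sequentially)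
    have *: "Lp_norm q (\<lambda>x. U i x - U k x) \<le> e" if "n \<le> k" "k \<le> i" for i k
      using dist[of k "i - k"] n[OF that(1)] that by simp
    have "Lp_norm q (\<lambda>x. U i x - U k x) \<le> e" if "n \<le> i" "n \<le> k" for i k
      using *[of i k] *[of k i] that Lp_norm_minus_commute[of q "U i" "U k"] by (cases "k \<le> i") auto
    then show "\<exists>n. \<forall>i\<ge>n. \<forall>k\<ge>n. Lp_norm q (\<lambda>x. U i x - U k x) \<le> e" by blast
  qed
  then obtain u where u: "u \<in> Lp q" and lim: "Lp_tendsto q U u" by (auto simp: Lp_tendsto_def)
  obtain s :: "nat \<Rightarrow> nat" where "AE x in lborel. (\<lambda>k. U (s k) x) \<longlonglongrightarrow> u x"
    using Lp_tendsto_AE_subseq[OF q0, of U u] Lp_diff(1)[OF q1 UL(1) u] lim by (auto simp: Lp_tendsto_def)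
  then have ur: "radial_real u" by (rule radial_real_limit[of "\<lambda>k. U (s k)", OF UL(3)])
  have "Lp_norm q u \<le> \<epsilon>"
    by (rule LIMSEQ_le_const2[OF Lp_tendsto_norm[OF q1 UL(1) u lim]]) (use UL(2) in auto)
  with u ur have uX: "u \<in> X" by (simp add: X_def)
  have "AE x in lborel. T (F u) x = u x"
  proof (rule Lp_tendsto_unique[OF q1 _ u])
    show "T (F u) \<in> Lp q" using G[OF uX] by (simp add: X_def)
    show "U (Suc k) \<in> Lp q" for k by (rule UL)
    show "Lp_tendsto q (\<lambda>k. U (Suc k)) u"
      using lim unfolding Lp_tendsto_def by (rule LIMSEQ_Suc)
    show "Lp_tendsto q (\<lambda>k. U (Suc k)) (T (F u))"
      unfolding U_Suc
    proof (rule Lp_tendsto_squeeze)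
      show "Lp_norm q (\<lambda>x. T (F (U k)) x - T (F u) x) \<le> K * Lp_norm q (\<lambda>x. U k x - u x)" for k
        by (rule lip[OF UX uX])
      show "(\<lambda>k. K * Lp_norm q (\<lambda>x. U k x - u x)) \<longlonglongrightarrow> 0"
        using lim by (auto simp: Lp_tendsto_def intro: tendsto_mult_right_zero)
    qed
  qed
  then show thesis using that u ur by (simp add: q_def F_def[abs_def])
qed

text \<open>For use at one fixed point \<open>x\<close>, with \<open>G\<close> the value of
  \<open>\<bar>g x\<bar>\<close> there. After division by \<open>y powr (\<alpha> - 1)\<close> the
  number \<open>G\<close> is multiplied by \<open>y powr (- (\<alpha> - 1))\<close> and drops out in
  the limit.\<close>

lemma growth_constant_ge:
  fixes c \<alpha> C r G :: real
  assumes \<alpha>: "\<alpha> > 1" and C: "C > 0"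
    and bound: "\<And>y. \<bar>deriv (\<lambda>y. c * (\<bar>y\<bar> powr (\<alpha> - 1) * y) + r) y\<bar> \<le> C * (G + \<bar>y\<bar> powr (\<alpha> - 1))"
  shows "\<bar>c\<bar> * \<alpha> \<le> C"
proof -
  have le: "\<bar>c\<bar> * \<alpha> \<le> C * (G * y powr (- (\<alpha> - 1)) + 1)" if y: "y > 0" for y
  proof -
    have "((\<lambda>y. c * y powr \<alpha> + r) has_real_derivative c * (\<alpha> * y powr (\<alpha> - 1))) (at y)"
      using y by (auto intro!: derivative_eq_intros)
    moreover have "\<forall>\<^sub>F z in nhds y. c * (\<bar>z\<bar> powr (\<alpha> - 1) * z) + r = c * z powr \<alpha> + r"
    proof -
      have "\<forall>\<^sub>F z in nhds y. z > 0"
        using eventually_nhds_in_open[of "{0<..}" y] y by simp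
      then show ?thesis by eventually_elim (simp add: powr_diff)
    qed
    ultimately have "((\<lambda>y. c * (\<bar>y\<bar> powr (\<alpha> - 1) * y) + r) has_real_derivative c * (\<alpha> * y powr (\<alpha> - 1))) (at y)"
      by (subst DERIV_cong_ev[OF refl _ refl])
    then have "\<bar>c * (\<alpha> * y powr (\<alpha> - 1))\<bar> \<le> C * (G + y powr (\<alpha> - 1))"
      using bound[of y] y by (simp add: DERIV_imp_deriv)
    then have "\<bar>c\<bar> * \<alpha> * y powr (\<alpha> - 1) \<le> C * (G + y powr (\<alpha> - 1))"
      using \<alpha> by (simp add: abs_mult)
    also have "G = G * (y powr (- (\<alpha> - 1)) * y powr (\<alpha> - 1))"
      using y by (simp add: powr_add[symmetric])
    also have "C * (G * (y powr (- (\<alpha> - 1)) * y powr (\<alpha> - 1)) + y powr (\<alpha> - 1))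
        = (C * (G * y powr (- (\<alpha> - 1)) + 1)) * y powr (\<alpha> - 1)"
      by (simp only: distrib_left distrib_right mult.assoc mult_1_right mult_1)
    finally have "\<bar>c\<bar> * \<alpha> * y powr (\<alpha> - 1) \<le> (C * (G * y powr (- (\<alpha> - 1)) + 1)) * y powr (\<alpha> - 1)" .
    then show ?thesis using y by simp
  qed
  have "((\<lambda>y. C * (G * y powr (- (\<alpha> - 1)) + 1)) \<longlongrightarrow> C * (G * 0 + 1)) at_top"
    using \<alpha> by (intro tendsto_intros tendsto_neg_powr filterlim_ident) simp
  moreover have "\<forall>\<^sub>F y in at_top. \<bar>c\<bar> * \<alpha> \<le> C * (G * y powr (- (\<alpha> - 1)) + 1)"
    using eventually_gt_at_top[of 0] by eventually_elim (rule le)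
  ultimately have "\<bar>c\<bar> * \<alpha> \<le> C * (G * 0 + 1)"
    by (intro tendsto_lowerbound) auto
  then show ?thesis by simp
qed

text \<open>\<open>E \<ge> 2 * C * N\<close> because \<open>p > 1\<close> and
  \<open>2 * C \<ge> 1\<close>. The upper bound on \<epsilon> says
  \<open>\<epsilon> powr (\<alpha> - 1) < 1 / E\<close>, which gives the contraction; the bound on
  \<open>R\<close> says \<open>E * (\<epsilon> powr \<alpha> + R) < \<epsilon>\<close>, which gives
  the self-map.\<close>

lemma radius_conditions:
  fixes p \<alpha> c C N \<epsilon> R :: real
  assumes p: "p > 1" and \<alpha>: "\<alpha> > 1" and C: "C \<ge> 1" "\<bar>c\<bar> * \<alpha> \<le> C" and N: "N > 0" and \<epsilon>: "\<epsilon> > 0"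
    and small: "\<epsilon> < (2 powr p * C powr p * N) powr (1 / (1 - \<alpha>))"
    and R: "R \<ge> 0" "R < \<epsilon> / (2 powr p * C powr p * N) - \<epsilon> powr \<alpha>"
  shows "N * (\<bar>c\<bar> * \<epsilon> powr \<alpha> + R) \<le> \<epsilon>" "2 * N * \<bar>c\<bar> * \<alpha> * \<epsilon> powr (\<alpha> - 1) < 1"
proof -
  define E where "E = 2 powr p * C powr p * N"
  have "2 * C = (2 * C) powr 1" using C by simp
  also have "\<dots> \<le> (2 * C) powr p" using C p by (intro powr_mono) auto
  finally have "2 * C \<le> 2 powr p * C powr p" using C by (simp add: powr_mult)
  then have EC: "2 * C * N \<le> E" unfolding E_def using N by (intro mult_right_mono) auto
  have E0: "E > 0" using C N by (simp add: E_def)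
  have c: "\<bar>c\<bar> \<le> C" using mult_left_mono[of 1 \<alpha> "\<bar>c\<bar>"] \<alpha> C by simp
  \<comment> \<open>\<open>R \<le> C * R\<close>, as \<open>C \<ge> 1\<close>; this lets the common
    factor \<open>C * N\<close> be taken out.\<close>
  have "N * (\<bar>c\<bar> * \<epsilon> powr \<alpha> + R) \<le> N * (C * \<epsilon> powr \<alpha> + C * R)"
    using N c C R by (intro mult_left_mono add_mono mult_right_mono) (auto simp: mult_le_cancel_right1)
  also have "\<dots> = (C * N) * (\<epsilon> powr \<alpha> + R)" by (simp add: algebra_simps)
  also have "\<dots> \<le> E * (\<epsilon> powr \<alpha> + R)" using EC N C R by (intro mult_right_mono) (auto intro: order_trans[rotated])
  also have "\<dots> \<le> E * (\<epsilon> / E)" using R E0 by (intro mult_left_mono) (auto simp: E_def[symmetric])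
  also have "\<dots> = \<epsilon>" using E0 by simp
  finally show "N * (\<bar>c\<bar> * \<epsilon> powr \<alpha> + R) \<le> \<epsilon>" .
  have "\<epsilon> powr (\<alpha> - 1) < (E powr (1 / (1 - \<alpha>))) powr (\<alpha> - 1)"
    using small \<epsilon> \<alpha> by (intro powr_less_mono2) (auto simp: E_def)
  also have "\<dots> = E powr (- 1)"
  proof -
    have "1 / (1 - \<alpha>) * (\<alpha> - 1) = - 1" using \<alpha> by (simp add: field_simps)
    then show ?thesis by (simp only: powr_powr)
  qed
  finally have e: "\<epsilon> powr (\<alpha> - 1) < 1 / E" using E0 by (simp add: powr_minus_divide)
  have "2 * N * \<bar>c\<bar> * \<alpha> * \<epsilon> powr (\<alpha> - 1) = 2 * (\<bar>c\<bar> * \<alpha>) * N * \<epsilon> powr (\<alpha> - 1)" by (simp add: mult_ac)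
  also have "\<dots> \<le> 2 * C * N * \<epsilon> powr (\<alpha> - 1)" using C N by (intro mult_right_mono mult_left_mono) auto
  also have "\<dots> \<le> E * \<epsilon> powr (\<alpha> - 1)" using EC by (intro mult_right_mono) auto
  also have "\<dots> < E * (1 / E)" using e E0 by (intro mult_strict_left_mono) auto
  finally show "2 * N * \<bar>c\<bar> * \<alpha> * \<epsilon> powr (\<alpha> - 1) < 1" using E0 by simp
qed

theorem corollary5p2:
  fixes p \<gamma> m s \<kappa> \<beta> \<alpha> C N \<epsilon> :: real
    and \<rho> :: "real \<Rightarrow> real"
    and V :: "real ^ 'n \<Rightarrow> real \<Rightarrow> real"
  assumes "CARD('n) \<ge> 2"
    and "1 < p"
    and "0 < \<gamma>" and "\<gamma> < 1"
    and "m \<noteq> 0"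
    and "s > 4 * real CARD('n) / \<gamma>"
    and "\<beta> > 0"
    and "continuous_on UNIV (\<lambda>x :: real ^ 'n. \<rho> (norm x))"
    and "compact (closure {x :: real ^ 'n. \<rho> (norm x) \<noteq> 0})"
    and "(\<alpha> = 3 \<and> V = (\<lambda>x y. \<kappa> * y ^ 3 + \<rho> (norm x))) \<or>
         (\<alpha> = \<beta> + 1 \<and> V = (\<lambda>x y. \<bar>y\<bar> powr \<beta> * y + \<rho> (norm x)))"
    and "C > 0"
    and "\<exists>g :: real ^ 'n \<Rightarrow> real. g \<in> Lp (\<alpha> * p / (\<alpha> - 1)) \<and>
           (\<forall>x y. \<bar>V x y\<bar> \<le> C * (\<bar>\<rho> (norm x)\<bar> + \<bar>y\<bar> powr \<alpha>)) \<and>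
           (\<forall>x y. \<bar>deriv (V x) y\<bar> \<le> C * (\<bar>g x\<bar> + \<bar>y\<bar> powr (\<alpha> - 1)))"
    and "N > 0"
    and "\<forall>u :: real ^ 'n \<Rightarrow> complex. u \<in> Hsp_r s p (a_sym \<gamma> m) \<longrightarrow>
           u \<in> Lp (\<alpha> * p) \<and> Lp_norm (\<alpha> * p) u \<le> N * Hsp_norm s p (a_sym \<gamma> m) u"
    and "0 < \<epsilon>" and "\<epsilon> < (2 powr p * C powr p * N) powr (1 / (1 - \<alpha>))"
    and "Lp_norm p (\<lambda>x :: real ^ 'n. \<rho> (norm x)) < \<epsilon> / (2 powr p * C powr p * N) - \<epsilon> powr \<alpha>"
  shows "\<exists>u :: real ^ 'n \<Rightarrow> real.
           (\<lambda>x. complex_of_real (u x)) \<in> Hsp_r s p (a_sym \<gamma> m) \<and>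
           (AE x in lborel.
              J_op s p (a_sym \<gamma> m) (\<lambda>x. complex_of_real (u x)) x = complex_of_real (V x (u x)))"
proof -
  let ?T = "T_op s p (a_sym \<gamma> m) :: (real ^ 'n \<Rightarrow> complex) \<Rightarrow> real ^ 'n \<Rightarrow> complex"
  have p1: "p \<ge> 1" and p0: "p > 0" using \<open>1 < p\<close> by auto
  have "4 * real CARD('n) / \<gamma> \<ge> 0" using \<open>0 < \<gamma>\<close> by simp
  then have s0: "s \<ge> 0" using \<open>s > 4 * real CARD('n) / \<gamma>\<close> by linarith
  have \<gamma>2: "\<gamma> < 2" using \<open>\<gamma> < 1\<close> by simp
  note ctx = p1 s0 \<open>0 < \<gamma>\<close> \<gamma>2 \<open>m \<noteq> 0\<close>
  note lin = T_op_bounded_linear[OF ctx, where 'a = "real ^ 'n"]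
  have \<alpha>1: "\<alpha> > 1" using assms(7,10) by auto
  \<comment> \<open>\<open>c\<close> is \<kappa> in the first equation and 1 in the second.\<close>
  obtain c where V: "\<And>x y. V x y = c * (\<bar>y\<bar> powr (\<alpha> - 1) * y) + \<rho> (norm x)"
  proof -
    have "y ^ 3 = \<bar>y\<bar> powr (3 - 1) * y" for y :: real
      by (simp add: power3_eq_cube power2_eq_square)
    then have "\<exists>c. \<forall>x y. V x y = c * (\<bar>y\<bar> powr (\<alpha> - 1) * y) + \<rho> (norm x)"
      using assms(10) by (elim disjE conjE) (auto intro: exI[of _ \<kappa>] exI[of _ 1])
    then show thesis using that by blast
  qed
  define r where "r x = complex_of_real (\<rho> (norm x))" for x :: "real ^ 'n"
  have rr: "radial_real r" by (rule radial_realI[where \<phi> = \<rho>]) (simp add: r_def)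
  have rL: "r \<in> Lp p"
  proof -
    let ?S = "closure {x :: real ^ 'n. \<rho> (norm x) \<noteq> 0}"
    have zero: "\<rho> (norm x) = 0" if "x \<notin> ?S" for x
      using that closure_subset[of "{x :: real ^ 'n. \<rho> (norm x) \<noteq> 0}"] by auto
    have "compact ((\<lambda>x. \<rho> (norm x)) ` ?S)"
      by (rule compact_continuous_image[OF continuous_on_subset[OF assms(8)] assms(9)]) simp
    from compact_imp_bounded[OF this] obtain B where B: "\<And>x. x \<in> ?S \<Longrightarrow> \<bar>\<rho> (norm x)\<bar> \<le> B"
      by (auto simp: bounded_iff)
    obtain D where D: "\<And>x. x \<in> ?S \<Longrightarrow> norm x \<le> D"
      using compact_imp_bounded[OF assms(9)] unfolding bounded_iff by blast
    show ?thesis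
    proof (rule bounded_support_in_Lp[OF p0, where B = "\<bar>B\<bar>" and R = D])
      show "r \<in> borel_measurable borel"
        unfolding r_def[abs_def]
        by (intro borel_measurable_of_real borel_measurable_continuous_onI continuous_on_of_real assms(8))
      show "norm (r x) \<le> \<bar>B\<bar>" for x
        using B[of x] zero[of x] by (cases "x \<in> ?S") (auto simp: r_def)
      show "r x = 0" if "norm x > D" for x
        using D[of x] zero[of x] that by (auto simp: r_def not_le[symmetric])
    qed
  qed
  have rnorm: "Lp_norm p r = Lp_norm p (\<lambda>x :: real ^ 'n. \<rho> (norm x))"
    by (simp add: Lp_norm_def r_def)
  \<comment> \<open>A fixed point is complex-valued and real only a.e., whereas its real part
    \<open>v\<close> is real everywhere. Replacing \<open>u\<close> by \<open>v\<close> changes the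
    right-hand side, and its image under \<open>?T\<close>, on a null set only.\<close>
  have solution: ?thesis
    if u: "u \<in> borel_measurable borel" "radial_real u"
      and VL: "(\<lambda>x. of_real c * power_nonlinearity \<alpha> (u x) + r x) \<in> Lp p"
      and fixp: "AE x in lborel. ?T (\<lambda>x. of_real c * power_nonlinearity \<alpha> (u x) + r x) x = u x" for u
  proof -
    let ?F = "\<lambda>u x. of_real c * power_nonlinearity \<alpha> (u x) + r x"
    define v where "v x = Re (u x)" for x
    let ?v = "\<lambda>x. complex_of_real (v x)"
    note [measurable] = u(1) rL
    have [measurable]: "v \<in> borel_measurable borel" unfolding v_def[abs_def] by measurable
    obtain \<phi> where "AE x in lborel. u x = complex_of_real (\<phi> (norm x))"
      using u(2) by (auto simp: radial_real_def)
    then have uv: "AE x in lborel. u x = ?v x" by eventually_elim (simp add: v_def)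
    then have FE: "AE x in lborel. ?F u x = ?F ?v x" by eventually_elim simp
    have FvL: "?F ?v \<in> Lp p" by (rule Lp_cong_AE[OF VL _ FE]) measurable
    have vT: "AE x in lborel. ?v x = ?T (?F ?v) x"
      using bounded_linear_Lp_cong_AE[OF p1 lin VL FvL FE] fixp uv by auto
    have vL: "?v \<in> Lp p"
    proof (rule Lp_cong_AE[OF bounded_linear_Lp_mem[OF p1 lin FvL]])
      show "AE x in lborel. ?T (?F ?v) x = ?v x" using vT by eventually_elim simp
    qed measurable
    have "spherically_symmetric ?v"
      by (intro radial_real_imp_spherically_symmetric radial_real_cong_AE[OF u(2) uv])
    then have "?v \<in> Hsp_r s p (a_sym \<gamma> m)"
      using vL FvL vT unfolding Hsp_r_def Hsp_def by blast
    moreover have "?F ?v x = complex_of_real (V x (v x))" for x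
      by (simp add: V r_def power_nonlinearity_of_real)
    then have "AE x in lborel. J_op s p (a_sym \<gamma> m) ?v x = complex_of_real (V x (v x))"
      using J_op_T_op(2)[OF ctx FvL vT] by simp
    ultimately show ?thesis by blast
  qed
  show ?thesis
  proof (cases "\<forall>x :: real ^ 'n. \<rho> (norm x) = 0")
    case True
    \<comment> \<open>That \<open>?T\<close> annihilates the zero function is homogeneity with the
      scalar \<open>0\<close>.\<close>
    have "AE x in lborel. ?T (\<lambda>y. 0 * 0) x = 0 * ?T (\<lambda>y. 0) x"
      by (rule bounded_linear_Lp_cmult[OF p1 lin Lp_zero])
    then have "AE x in lborel. ?T (\<lambda>x. of_real c * power_nonlinearity \<alpha> 0 + r x) x = 0"
      using True by (simp add: r_def power_nonlinearity_def)
    moreover have "radial_real (\<lambda>x :: real ^ 'n. 0)" by (rule radial_realI[where \<phi> = "\<lambda>r. 0"]) simp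
    ultimately show ?thesis
      using True by (intro solution[of "\<lambda>x. 0"]) (simp_all add: r_def power_nonlinearity_def)
  next
    case False
    obtain g where bd: "\<And>x y. \<bar>V x y\<bar> \<le> C * (\<bar>\<rho> (norm x)\<bar> + \<bar>y\<bar> powr \<alpha>)"
      and der: "\<And>x y. \<bar>deriv (V x) y\<bar> \<le> C * (\<bar>g x\<bar> + \<bar>y\<bar> powr (\<alpha> - 1))"
      using assms(12) by blast
    obtain x0 :: "real ^ 'n" where x0: "\<rho> (norm x0) \<noteq> 0" using False by blast
    \<comment> \<open>At \<open>y = 0\<close> the growth bound compares
      \<open>\<bar>\<rho> (norm x0)\<bar>\<close> with \<open>C\<close> times itself.\<close>
    have C1: "C \<ge> 1" using bd[of x0 0] x0 \<alpha>1 by (simp add: V)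
    have "V x0 = (\<lambda>y. c * (\<bar>y\<bar> powr (\<alpha> - 1) * y) + \<rho> (norm x0))" by (intro ext V)
    then have cC: "\<bar>c\<bar> * \<alpha> \<le> C"
      using der[of x0] by (intro growth_constant_ge[OF \<alpha>1 \<open>C > 0\<close>]) auto
    note cond = radius_conditions[OF \<open>1 < p\<close> \<alpha>1 C1 cC \<open>N > 0\<close> \<open>0 < \<epsilon>\<close> assms(16) Lp_norm_nonneg assms(17)]
    have emb: "?T g \<in> Lp (\<alpha> * p) \<and> Lp_norm (\<alpha> * p) (?T g) \<le> N * Lp_norm p g"
      if g: "g \<in> Lp p" "radial_real g" for g
    proof -
      have "?T g \<in> Hsp_r s p (a_sym \<gamma> m)"
        unfolding Hsp_r_def Hsp_def
        using bounded_linear_Lp_mem[OF p1 lin g(1)] g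
          radial_real_imp_spherically_symmetric[OF T_op_radial_real[OF ctx g]] by auto
      moreover have "Hsp_norm s p (a_sym \<gamma> m) (?T g) = Lp_norm p g"
        by (rule J_op_T_op(3)[OF ctx g(1)]) simp
      ultimately show ?thesis using assms(14) by metis
    qed
    obtain u where u: "u \<in> Lp (\<alpha> * p)" "radial_real u"
      "AE x in lborel. ?T (\<lambda>x. of_real c * power_nonlinearity \<alpha> (u x) + r x) x = u x"
      using radial_fixed_point[OF \<open>1 < p\<close> \<alpha>1 \<open>0 < \<epsilon>\<close> \<open>N > 0\<close> lin T_op_radial_real[OF ctx] emb rL rr
          cond(1)[folded rnorm] cond(2)] by blast
    show ?thesis
      by (rule solution[OF Lp_measurable[OF u(1)] u(2) _ u(3)])
         (intro Lp_add p1 rL Lp_cmult p0 power_nonlinearity_Lp \<alpha>1 u)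
  qed
qed

end
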